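(* Let $c\in\mathbb R$ with $1-c^2>0$, let $\sigma>0$, and let $a_1\in\mathbb R$ be such that the quadratic equation $r^2-4\sigma(1-c^2)r-a_1=0$ has two positive roots $\phi_0^2>\phi_1^2>0$ (with $\phi_0>\phi_1>0$). Set $$\kappa^2=\frac{\phi_0^2-\phi_1^2}{\phi_0^2},\qquad \alpha^2=\frac{\phi_0^2}{4(1-c^2)}=\frac{\sigma}{2-\kappa^2},\quad \alpha>0,\qquad T=\frac{K(\kappa)}{\alpha},$$ $$\phi(x)=\phi_0\,\mathrm{dn}(\alpha x,\kappa),\qquad \psi=-\frac{\phi^2}{2(1-c^2)},\qquad \omega=-\sigma-\frac{c^2}{4},$$ and assume that $c=\frac{2\pi l}{T}$ for some integer $l$. Then the $2T$-periodic dnoidal traveling wave $v(t,x)=\psi(x-ct)$, $u(t,x)=e^{-i\omega t}e^{i\frac c2(x-ct)}\phi(x-ct)$ of the Zakharov system is spectrally stable. That is, the eigenvalue problem $$\mathcal J\mathcal H\vec U=\lambda\vec U$$ has no solution $(\lambda,\vec U)$ with $\Re\lambda>0$, $\vec U\neq0$ and $\vec U\in D(\mathcal J\mathcal H)=(H^2[-T,T])^2\oplus H^1[-T,T]\oplus H^1_0[-T,T]$, where $$\mathcal J=\begin{pmatrix}0&-1&0&0\\1&0&0&0\\0&0&0&-\partial_x\\0&0&-\partial_x&0\end{pmatrix},\qquad \mathcal H=\begin{pmatrix}\mathcal L_-&0&0&0\\0&\mathcal L_-&\phi&0\\0&\phi&1&-c\\0&0&-c&1\end{pmatrix},\qquad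 \mathcal L_-=-\partial_x^2+\sigma-\frac{\phi^2}{2(1-c^2)}.$$
   Context: The Zakharov system is $v_{tt}-v_{xx}=\frac12(|u|^2)_{xx}$, $iu_t+u_{xx}-uv=0$, with $v$ real-valued and $u$ complex-valued; it is rewritten as the first-order system $v_t=-V_x$, $V_t=-(v+\frac12|u|^2)_x$, $iu_t+u_{xx}=uv$ with $\int_{-T}^TV\,dx=0$. The condition $c=2\pi l/T$ guarantees that $u$ is $2T$-periodic in $x$. The function $\phi$ solves $-\phi''+\sigma\phi-\frac{\phi^3}{2(1-c^2)}=0$ and has fundamental period $2T$. Here $\mathrm{dn}(\cdot,\kappa)$ is the Jacobi elliptic function of modulus $\kappa$ and $K(\kappa)$ is the complete elliptic integral of the first kind. The problem $\mathcal J\mathcal H\vec U=\lambda\vec U$ is the linearization around the traveling wave in the co-moving frame, with $\vec U=(p_2,p_1,q,h)$, where $p=p_1+ip_2$, $q$, $h$ are the perturbations of $\phi$, $\psi$ and the $V$-component respectively. $H^k[-T,T]$ denotes the Sobolev space of (complex-valued) $2T$-periodic functions, and $H^1_0[-T,T]=\{f\in H^1[-T,T]:\int_{-T}^Tf\,dx=0\}$ denotes mean-zero functions (not Dirichlet conditions). "Spectrally stable" means exactly the nonexistence of eigenvalues with positive real part stated in the claim. *)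

theory Defs
  imports "HOL-Analysis.Analysis"
begin

section \<open>Jacobi elliptic functions\<close>

text \<open>All functions take the modulus \<open>k\<close> (not the parameter \<open>m = k\<^sup>2\<close>) and are meant
  for \<open>k\<^sup>2 < 1\<close>, where \<^term>\<open>elliptic_F k\<close> below is an increasing bijection of the real line
  (the interval integral is signed), so that the amplitude is well defined.\<close>

definition elliptic_F :: "real \<Rightarrow> real \<Rightarrow> real" where
  "elliptic_F k \<theta> = (LBINT t=0..\<theta>. 1 / sqrt (1 - k\<^sup>2 * (sin t)\<^sup>2))"

definition elliptic_K :: "real \<Rightarrow> real" where
  "elliptic_K k = elliptic_F k (pi / 2)"

definition jacobi_am :: "real \<Rightarrow> real \<Rightarrow> real" where
  "jacobi_am x k = (THE \<theta>. elliptic_F k \<theta> = x)"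

definition jacobi_dn :: "real \<Rightarrow> real \<Rightarrow> real" where
  "jacobi_dn x k = sqrt (1 - k\<^sup>2 * (sin (jacobi_am x k))\<^sup>2)"


section \<open>Periodic Sobolev spaces\<close>

text \<open>Elements of the function spaces are represented by \<open>2T\<close>-periodic functions on the whole
  real line, two representatives being identified when they agree almost everywhere.\<close>

definition periodic :: "real \<Rightarrow> (real \<Rightarrow> 'a) \<Rightarrow> bool" where
  "periodic P f \<longleftrightarrow> (\<forall>x. f (x + P) = f x)"

definition L2_per :: "real \<Rightarrow> (real \<Rightarrow> complex) set" where
  "L2_per T = {f. periodic (2 * T) f \<and> f \<in> borel_measurable lebesgue \<and>
                  set_integrable lebesgue {-T..T} (\<lambda>x. (cmod (f x))\<^sup>2)}"

definition vderiv :: "(real \<Rightarrow> complex) \<Rightarrow> real \<Rightarrow> complex" where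
  "vderiv f = (\<lambda>x. vector_derivative f (at x))"

definition test_per :: "real \<Rightarrow> (real \<Rightarrow> complex) set" where
  "test_per T = {\<eta>. periodic (2 * T) \<eta> \<and> (\<forall>n x. (vderiv ^^ n) \<eta> differentiable at x)}"

definition is_weak_deriv :: "real \<Rightarrow> (real \<Rightarrow> complex) \<Rightarrow> (real \<Rightarrow> complex) \<Rightarrow> bool" where
  "is_weak_deriv T f g \<longleftrightarrow>
     (\<forall>\<eta>\<in>test_per T. (LINT x:{-T..T}|lebesgue. f x * vderiv \<eta> x)
                    = - (LINT x:{-T..T}|lebesgue. g x * \<eta> x))"

fun H_per :: "nat \<Rightarrow> real \<Rightarrow> (real \<Rightarrow> complex) set" where
  "H_per 0 T = L2_per T"
| "H_per (Suc k) T = {f \<in> L2_per T. \<exists>g \<in> H_per k T. is_weak_deriv T f g}"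

definition H1_mean0 :: "real \<Rightarrow> (real \<Rightarrow> complex) set" where
  "H1_mean0 T = {f \<in> H_per 1 T. (LINT x:{-T..T}|lebesgue. f x) = 0}"

text \<open>A representative of the weak derivative, which for functions in \<^term>\<open>H_per 1 T\<close> exists
  and is unique up to null sets.\<close>

definition wderiv :: "real \<Rightarrow> (real \<Rightarrow> complex) \<Rightarrow> real \<Rightarrow> complex" where
  "wderiv T f = (SOME g. g \<in> L2_per T \<and> is_weak_deriv T f g)"


section \<open>The Zakharov system and its linearization\<close>

text \<open>Classical solutions \<open>(v, u)\<close>, as functions of \<open>t\<close> and \<open>x\<close>, of
  \<open>v\<^sub>t\<^sub>t - v\<^sub>x\<^sub>x = (|u|\<^sup>2)\<^sub>x\<^sub>x / 2\<close> and \<open>i u\<^sub>t + u\<^sub>x\<^sub>x - u v = 0\<close>.\<close>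

definition zakharov_solution ::
    "(real \<Rightarrow> real \<Rightarrow> real) \<Rightarrow> (real \<Rightarrow> real \<Rightarrow> complex) \<Rightarrow> bool" where
  "zakharov_solution v u \<longleftrightarrow>
    (\<exists>vt vtt vx vxx nx nxx ut ux uxx. \<forall>t x.
       ((\<lambda>s. v s x) has_real_derivative vt t x) (at t) \<and>
       ((\<lambda>s. vt s x) has_real_derivative vtt t x) (at t) \<and>
       ((\<lambda>y. v t y) has_real_derivative vx t x) (at x) \<and>
       ((\<lambda>y. vx t y) has_real_derivative vxx t x) (at x) \<and>
       ((\<lambda>y. (cmod (u t y))\<^sup>2) has_real_derivative nx t x) (at x) \<and>
       ((\<lambda>y. nx t y) has_real_derivative nxx t x) (at x) \<and>
       ((\<lambda>s. u s x) has_vector_derivative ut t x) (at t) \<and>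
       ((\<lambda>y. u t y) has_vector_derivative ux t x) (at x) \<and>
       ((\<lambda>y. ux t y) has_vector_derivative uxx t x) (at x) \<and>
       vtt t x - vxx t x = nxx t x / 2 \<and>
       \<i> * ut t x + uxx t x - u t x * complex_of_real (v t x) = 0)"

text \<open>Vectors \<open>U = (p\<^sub>2, p\<^sub>1, q, h)\<close>.\<close>

type_synonym vec4 =
  "(real \<Rightarrow> complex) \<times> (real \<Rightarrow> complex) \<times> (real \<Rightarrow> complex) \<times> (real \<Rightarrow> complex)"

definition L_minus ::
    "real \<Rightarrow> real \<Rightarrow> real \<Rightarrow> (real \<Rightarrow> real) \<Rightarrow> (real \<Rightarrow> complex) \<Rightarrow> real \<Rightarrow> complex" where
  "L_minus T c \<sigma> \<phi> f =
     (\<lambda>x. - wderiv T (wderiv T f) x + complex_of_real \<sigma> * f x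
          - complex_of_real ((\<phi> x)\<^sup>2 / (2 * (1 - c\<^sup>2))) * f x)"

definition op_H :: "real \<Rightarrow> real \<Rightarrow> real \<Rightarrow> (real \<Rightarrow> real) \<Rightarrow> vec4 \<Rightarrow> vec4" where
  "op_H T c \<sigma> \<phi> = (\<lambda>(p2, p1, q, h).
     (L_minus T c \<sigma> \<phi> p2,
      \<lambda>x. L_minus T c \<sigma> \<phi> p1 x + complex_of_real (\<phi> x) * q x,
      \<lambda>x. complex_of_real (\<phi> x) * p1 x + q x - complex_of_real c * h x,
      \<lambda>x. - complex_of_real c * q x + h x))"

definition op_J :: "real \<Rightarrow> vec4 \<Rightarrow> vec4" where
  "op_J T = (\<lambda>(a, b, f, g).
     (\<lambda>x. - b x, a, \<lambda>x. - wderiv T g x, \<lambda>x. - wderiv T f x))"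

definition dom_JH :: "real \<Rightarrow> vec4 set" where
  "dom_JH T = H_per 2 T \<times> H_per 2 T \<times> H_per 1 T \<times> H1_mean0 T"

definition ae_eq4 :: "vec4 \<Rightarrow> vec4 \<Rightarrow> bool" where
  "ae_eq4 = (\<lambda>(a1, a2, a3, a4) (b1, b2, b3, b4).
     AE x in lebesgue. a1 x = b1 x \<and> a2 x = b2 x \<and> a3 x = b3 x \<and> a4 x = b4 x)"

definition zero4 :: vec4 where
  "zero4 = (\<lambda>_. 0, \<lambda>_. 0, \<lambda>_. 0, \<lambda>_. 0)"

definition scale4 :: "complex \<Rightarrow> vec4 \<Rightarrow> vec4" where
  "scale4 \<mu> = (\<lambda>(a1, a2, a3, a4). (\<lambda>x. \<mu> * a1 x, \<lambda>x. \<mu> * a2 x, \<lambda>x. \<mu> * a3 x, \<lambda>x. \<mu> * a4 x))"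

definition spectrally_stable :: "real \<Rightarrow> real \<Rightarrow> real \<Rightarrow> (real \<Rightarrow> real) \<Rightarrow> bool" where
  "spectrally_stable T c \<sigma> \<phi> \<longleftrightarrow>
     \<not> (\<exists>\<mu> U. Re \<mu> > 0 \<and> U \<in> dom_JH T \<and> \<not> ae_eq4 U zero4 \<and>
              ae_eq4 (op_J T (op_H T c \<sigma> \<phi> U)) (scale4 \<mu> U))"

end

theory Submission
  imports Defs
begin

text \<open>Let \<open>\<L>\<^sub>+ = - \<partial>\<^sub>x\<^sup>2 + \<sigma> - 3 \<phi>\<^sup>2 / (2 (1 - c\<^sup>2))\<close>. If \<open>\<J> \<H> U = \<lambda> U\<close> with \<open>Re \<lambda> > 0\<close>, then conservation of energy forces
  \<open>\<langle>\<H> U, U\<rangle> = 0\<close>, and \<open>\<lambda> p\<^sub>1 = \<L>\<^sub>- p\<^sub>2\<close> forces \<open>p\<^sub>1 \<bottom> \<phi>\<close> because \<open>\<L>\<^sub>- \<phi> = 0\<close>. Completing squares,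
  \<open>\<langle>\<H> U, U\<rangle> = \<langle>\<L>\<^sub>- p\<^sub>2, p\<^sub>2\<rangle> + \<langle>\<L>\<^sub>+ p\<^sub>1, p\<^sub>1\<rangle> + (1 - c\<^sup>2) \<parallel>q + \<phi> p\<^sub>1 / (1 - c\<^sup>2)\<parallel>\<^sup>2 + \<parallel>h - c q\<parallel>\<^sup>2\<close>,
  so \<open>U = 0\<close> follows once \<open>\<L>\<^sub>+ \<ge> 0\<close> on \<open>\<phi>\<^sup>\<bottom>\<close>.

  For the latter, \<open>\<L>\<^sub>+\<close> has a positive eigenvalue with eigenfunction \<open>f = \<phi>\<^sup>2 - r\<close>, whose two zeros
  \<open>\<plusminus>x\<^sub>0\<close> per period make the Jacobi substitution \<open>p = f z\<close> show that \<open>\<L>\<^sub>+ \<ge> 0\<close> on functions vanishing at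
  \<open>\<plusminus>x\<^sub>0\<close>. An explicit periodic \<open>y\<close> with \<open>\<L>\<^sub>+ y\<close> a multiple of \<open>\<phi>\<close> and \<open>\<langle>\<L>\<^sub>+ y, y\<rangle> < 0\<close>, together with the kernel
  element \<open>\<phi>'\<close>, allows one to subtract \<open>w = t y + m \<phi>'\<close> from any \<open>p \<bottom> \<phi>\<close> so that \<open>p - w\<close> vanishes at
  \<open>\<plusminus>x\<^sub>0\<close>; then \<open>\<langle>\<L>\<^sub>+ p, p\<rangle> = \<langle>\<L>\<^sub>+ (p - w), p - w\<rangle> - t\<^sup>2 \<langle>\<L>\<^sub>+ y, y\<rangle> \<ge> 0\<close>.\<close>

section \<open>Smooth periodic functions\<close>

text \<open>Finite-order form of the smoothness required in \<open>test_per\<close>; it provides an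
  order \<open>N\<close> on which the closure properties below can be proved by induction.\<close>

definition diff_upto :: "nat \<Rightarrow> (real \<Rightarrow> complex) \<Rightarrow> bool" where
  "diff_upto N f \<longleftrightarrow> (\<forall>m\<le>N. \<forall>x. (vderiv ^^ m) f differentiable at x)"

lemma test_per_iff: "\<eta> \<in> test_per T \<longleftrightarrow> periodic (2 * T) \<eta> \<and> (\<forall>N. diff_upto N \<eta>)"
  unfolding test_per_def diff_upto_def by auto

lemma diff_upto_0: "diff_upto 0 f \<longleftrightarrow> (\<forall>x. f differentiable at x)"
  by (simp add: diff_upto_def)

lemma diff_upto_Suc:
  "diff_upto (Suc N) f \<longleftrightarrow> (\<forall>x. f differentiable at x) \<and> diff_upto N (vderiv f)"
proof -
  have "(\<forall>m\<le>Suc N. Q m) \<longleftrightarrow> Q 0 \<and> (\<forall>m\<le>N. Q (Suc m))" for Q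
    by (metis Suc_le_mono le0 not0_implies_Suc)
  from this[of "\<lambda>m. \<forall>x. (vderiv ^^ m) f differentiable at x"] show ?thesis
    by (simp add: diff_upto_def funpow_Suc_right del: funpow.simps(2))
qed

lemma diff_upto_mono: "diff_upto N f \<Longrightarrow> M \<le> N \<Longrightarrow> diff_upto M f"
  by (auto simp: diff_upto_def)

lemma vderiv_eqI:
  assumes "\<And>x. (f has_vector_derivative f' x) (at x)"
  shows "vderiv f = f'"
  unfolding vderiv_def using assms by (intro ext vector_derivative_at)

lemma has_vector_derivative_vderiv:
  assumes "f differentiable at x"
  shows "(f has_vector_derivative vderiv f x) (at x)"
  using assms unfolding vderiv_def by (simp add: vector_derivative_works)

lemma diff_upto_SucI:
  assumes "\<And>x. (f has_vector_derivative f' x) (at x)" "diff_upto N f'"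
  shows "diff_upto (Suc N) f"
  unfolding diff_upto_Suc using assms vderiv_eqI[of f f', OF assms(1)]
  by (auto intro: differentiableI_vector)

lemma diff_upto_SucE:
  assumes "diff_upto (Suc N) f"
  obtains "\<And>x. (f has_vector_derivative vderiv f x) (at x)" "diff_upto N (vderiv f)" "diff_upto N f"
  using assms has_vector_derivative_vderiv diff_upto_mono[OF assms, of N] unfolding diff_upto_Suc by auto

lemma diff_upto_add:
  assumes "diff_upto N f" "diff_upto N g"
  shows "diff_upto N (\<lambda>x. f x + g x)"
  using assms
proof (induction N arbitrary: f g)
  case 0
  then show ?case by (auto simp: diff_upto_0)
next
  case (Suc N)
  show ?case
    by (rule diff_upto_SucE[OF Suc.prems(1)], rule diff_upto_SucE[OF Suc.prems(2)],
        rule diff_upto_SucI[where f' = "\<lambda>x. vderiv f x + vderiv g x"])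
       (auto intro!: derivative_eq_intros Suc.IH)
qed

text \<open>The Leibniz rule turns the derivative into a sum of products of order \<open>N\<close>.
  The functions vary in the induction, and \<open>diff_upto_SucE\<close> also lowers the order of
  the undifferentiated factors.\<close>

lemma diff_upto_mult:
  assumes "diff_upto N f" "diff_upto N g"
  shows "diff_upto N (\<lambda>x. f x * g x)"
  using assms
proof (induction N arbitrary: f g)
  case 0
  then show ?case by (auto simp: diff_upto_0)
next
  case (Suc N)
  show ?case
    by (rule diff_upto_SucE[OF Suc.prems(1)], rule diff_upto_SucE[OF Suc.prems(2)],
        rule diff_upto_SucI[where f' = "\<lambda>x. f x * vderiv g x + vderiv f x * g x"])
       (auto intro!: derivative_eq_intros diff_upto_add Suc.IH)
qed

lemma diff_upto_const: "diff_upto N (\<lambda>_. c)"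
proof (induction N arbitrary: c)
  case (Suc N)
  show ?case by (rule diff_upto_SucI[where f' = "\<lambda>_. 0"]) (auto intro: Suc)
qed (auto simp: diff_upto_0)

text \<open>Differentiation rescales the amplitude and shifts the phase by \<open>pi / 2\<close>, so
  the family with arbitrary \<open>A\<close> and \<open>b\<close> is closed under it.\<close>

lemma diff_upto_cos: "diff_upto N (\<lambda>x. of_real (A * cos (w * x + b)))"
proof (induction N arbitrary: A b)
  case 0
  then show ?case
    by (auto simp: diff_upto_0 intro!: differentiableI_vector derivative_eq_intros has_vector_derivative_of_real
         simp flip: has_real_derivative_iff_has_vector_derivative)
next
  case (Suc N)
  have "((\<lambda>x. complex_of_real (A * cos (w * x + b))) has_vector_derivative
          of_real ((w * A) * cos (w * x + (b + pi / 2)))) (at x)" for x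
  proof (rule has_vector_derivative_of_real)
    have "cos (w * x + (b + pi/2)) = - sin (w * x + b)"
      using cos_add[of "w * x + b" "pi / 2"] by (simp add: add.assoc)
    then show "((\<lambda>x. A * cos (w * x + b)) has_real_derivative (w * A) * cos (w * x + (b + pi / 2))) (at x)"
      by (auto intro!: derivative_eq_intros)
  qed
  then show ?case by (rule diff_upto_SucI) (rule Suc)
qed

lemma test_per_mult: "f \<in> test_per T \<Longrightarrow> g \<in> test_per T \<Longrightarrow> (\<lambda>x. f x * g x) \<in> test_per T"
  by (auto simp: test_per_iff periodic_def diff_upto_mult)

lemma test_per_add: "f \<in> test_per T \<Longrightarrow> g \<in> test_per T \<Longrightarrow> (\<lambda>x. f x + g x) \<in> test_per T"
  by (auto simp: test_per_iff periodic_def diff_upto_add)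

lemma test_per_const: "(\<lambda>_. c) \<in> test_per T"
  by (auto simp: test_per_iff periodic_def diff_upto_const)

lemma test_per_cos:
  assumes "T > 0"
  shows "(\<lambda>x. of_real (cos (pi / T * x + b))) \<in> test_per T"
proof -
  have "pi / T * (x + 2 * T) + b = (pi / T * x + b) + 2 * pi" for x using assms by (simp add: field_simps)
  then have "cos (pi / T * (x + 2 * T) + b) = cos (pi / T * x + b)" for x
    by (metis cos_periodic)
  then show ?thesis using diff_upto_cos[of _ 1 "pi / T" b]
    by (simp add: test_per_iff periodic_def)
qed

text \<open>These are the test functions used for approximation below. A bounded linear map on the
  reals is multiplication by its value at 1, which reduces the linear generator to the cosine
  itself.\<close>

lemma test_per_polynomial_cos:
  assumes "T > 0" "real_polynomial_function g"
  shows "(\<lambda>x. of_real (g (cos (pi / T * x + b)))) \<in> test_per T"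
  using assms(2)
proof (induction rule: real_polynomial_function.induct)
  case (linear f)
  have "f y = f 1 * y" for y
    using linear_scale[of f y 1] linear by (simp add: bounded_linear.linear)
  then have "(\<lambda>x. complex_of_real (f (cos (pi / T * x + b)))) =
     (\<lambda>x. of_real (f 1) * of_real (cos (pi / T * x + b)))" by (metis of_real_mult)
  then show ?case using test_per_mult[OF test_per_const test_per_cos[OF assms(1)]] by simp
next
  case (const c)
  then show ?case by (rule test_per_const)
next
  case (add f g)
  then show ?case using test_per_add by simp
next
  case (mult f g)
  then show ?case using test_per_mult by simp
qed

lemma test_per_derivative:
  assumes "\<eta> \<in> test_per T"
  shows "(\<eta> has_vector_derivative vderiv \<eta> x) (at x)"
  using assms unfolding test_per_iff
  by (metis diff_upto_0 has_vector_derivative_vderiv)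

lemma test_per_vderiv:
  assumes "\<eta> \<in> test_per T"
  shows "vderiv \<eta> \<in> test_per T"
proof -
  have "vderiv \<eta> (x + 2 * T) = vderiv \<eta> x" for x
  proof -
    have "((\<lambda>x. \<eta> (x + 2 * T)) has_vector_derivative vderiv \<eta> (x + 2 * T)) (at x)"
    proof -
      have "((\<lambda>x. x + 2 * T) has_vector_derivative 1) (at x)"
        by (auto intro!: derivative_eq_intros simp flip: has_real_derivative_iff_has_vector_derivative)
      from vector_diff_chain_at[OF this test_per_derivative[OF assms]] show ?thesis by (simp add: o_def)
    qed
    moreover have "(\<lambda>x. \<eta> (x + 2 * T)) = \<eta>"
      using assms by (auto simp: test_per_iff periodic_def)
    ultimately show ?thesis unfolding vderiv_def by (metis vector_derivative_at)
  qed
  then show ?thesis using assms unfolding test_per_iff periodic_def diff_upto_Suc[symmetric]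
    by (metis diff_upto_Suc)
qed

lemma test_per_continuous: "\<eta> \<in> test_per T \<Longrightarrow> continuous_on S \<eta>"
  by (meson continuous_at_imp_continuous_on differentiableI_vector differentiable_imp_continuous_within test_per_derivative)

section \<open>Uniqueness and regularity of weak derivatives\<close>

text \<open>Dynkin's argument: the sets over which \<open>f\<close> integrates to zero are closed
  under complements and countable disjoint unions, and the half-lines form an intersection-stable
  generator of the Borel sets. Lebesgue sets differ from Borel sets by null sets only.\<close>

lemma lebesgue_integral_zero_intervals:
  fixes f :: "real \<Rightarrow> complex"
  assumes f: "integrable lebesgue f" and z: "\<And>a. (LINT x:{..a}|lebesgue. f x) = 0"
  shows "AE x in lebesgue. f x = 0"
proof -
  \<comment> \<open>\<open>density_zero\<close> is a fact about sigma-finite measures, so the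
    countable cover of \<open>lborel\<close> is carried over to its completion.\<close>
  interpret L: sigma_finite_measure "lebesgue :: real measure"
  proof
    obtain A :: "real set set" where "countable A" "A \<subseteq> sets lborel" "\<Union>A = UNIV" "\<forall>a\<in>A. emeasure lborel a \<noteq> \<infinity>"
      using lborel.sigma_finite_countable by auto
    then show "\<exists>A. countable A \<and> A \<subseteq> sets lebesgue \<and> \<Union>A = space (lebesgue :: real measure)
        \<and> (\<forall>a\<in>A. emeasure lebesgue a \<noteq> \<infinity>)"
      by (intro exI[of _ A]) (auto simp: subset_iff)
  qed
  define P where "P A \<longleftrightarrow> (LINT x:A|lebesgue. f x) = 0" for A
  have si: "set_integrable lebesgue A f" if "A \<in> sets lebesgue" for A
    using that f unfolding set_integrable_def by (simp add: integrable_mult_indicator)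
  \<comment> \<open>The closure under complements needs the integral over the whole line, obtained
    by exhausting it with half-lines.\<close>
  have univ: "(LINT x:UNIV|lebesgue. f x) = 0"
  proof -
    have "(\<lambda>n. LINT x:{..real n}|lebesgue. f x) \<longlonglongrightarrow> (LINT x:(\<Union>n. {..real n})|lebesgue. f x)"
      by (rule set_integral_cont_up) (auto intro: si simp: incseq_def)
    moreover have "(\<Union>n. {..real n}) = (UNIV :: real set)"
      using real_arch_simple by auto
    ultimately show ?thesis by (simp add: z LIMSEQ_const_iff)
  qed
  have borel: "P A" if "A \<in> sets borel" for A
  proof -
    have sb: "sets borel = sigma_sets UNIV (range (\<lambda>a::real. {..a}))"
      unfolding borel_eq_atMost by (simp add: sets_measure_of)
    have "Int_stable (range (\<lambda>a::real. {..a}))"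
      by (auto simp: Int_stable_def)
    moreover have "range (\<lambda>a::real. {..a}) \<subseteq> Pow UNIV" by simp
    moreover have "A \<in> sigma_sets UNIV (range (\<lambda>a::real. {..a}))" using that sb by simp
    ultimately show ?thesis
    proof (induction rule: sigma_sets_induct_disjoint)
      case (basic A)
      then show ?case using z by (auto simp: P_def)
    next
      case empty
      show ?case by (simp add: P_def set_lebesgue_integral_def)
    next
      case (compl A)
      have A: "A \<in> sets lebesgue" using compl(1) sb by (metis sets_completionI_sets sets_lborel)
      have "(LINT x:A \<union> (UNIV - A)|lebesgue. f x) = (LINT x:A|lebesgue. f x) + (LINT x:UNIV - A|lebesgue. f x)"
        using A by (intro set_integral_Un si) auto
      then show ?case using compl univ by (simp add: P_def)
    next
      case (union A)
      have "A n \<in> sets lebesgue" for n using union(2) sb by (metis range_subsetD sets_completionI_sets sets_lborel)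
      then have "(LINT x:(\<Union>i. A i)|lebesgue. f x) = (\<Sum>i. (LINT x:(A i)|lebesgue. f x))"
        using union(1) by (intro lebesgue_integral_countable_add si) (auto simp: disjoint_family_on_def)
      then show ?case using union(3) by (simp add: P_def)
    qed
  qed
  show ?thesis
  proof (rule L.density_zero[OF f])
    fix A :: "real set" assume "A \<in> sets lebesgue"
    then obtain S N N' where A: "A = S \<union> N" "N \<subseteq> N'" "N' \<in> null_sets lborel" "S \<in> sets lborel"
      using sets_completionE by blast
    have "AE x in lebesgue. x \<notin> N'"
      using A(3) by (simp add: AE_completion AE_not_in)
    then have "AE x \<in> A in lebesgue. x \<in> S \<longleftrightarrow> x \<in> A"
      by eventually_elim (use A in auto)
    then have "(LINT x:A|lebesgue. f x) = (LINT x:S|lebesgue. f x)"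
      unfolding set_lebesgue_integral_def 
      using A \<open>A \<in> sets lebesgue\<close> f \<open>AE x in lebesgue. x \<notin> N'\<close>
      by (intro integral_cong_AE borel_measurable_scaleR borel_measurable_indicator)
         (auto simp: indicator_def elim: eventually_mono)
    then show "(LINT x:A|lebesgue. f x) = 0" using borel[of S] A by (simp add: P_def)
  qed
qed

section \<open>The fundamental lemma of the calculus of variations for periodic test
  functions\<close>

lemma integrable_mult_continuous:
  fixes f g :: "real \<Rightarrow> complex"
  assumes "set_integrable lebesgue {a..b} f" "continuous_on {a..b} g"
  shows "set_integrable lebesgue {a..b} (\<lambda>x. f x * g x)"
proof -
  have "(\<lambda>x. g x * f x) absolutely_integrable_on {a..b}"
    using assms
    by (intro absolutely_integrable_bounded_measurable_product[where h = "(*)"] bilinear_times)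
       (auto intro!: continuous_imp_measurable_on_sets_lebesgue compact_imp_bounded compact_continuous_image)
  then show ?thesis by (simp add: mult.commute)
qed

text \<open>By Stone-Weierstrass \<open>w\<close> is a uniform limit of polynomials on
  \<open>{-1..1}\<close>, and polynomials in the shifted cosine are test functions. Since
  \<open>f\<close> is integrable, uniform closeness of the factors gives closeness of the
  integrals.\<close>

lemma integral_polynomial_cos_zero:
  assumes T: "T > 0" and f: "set_integrable lebesgue {-T..T} f"
    and z: "\<And>\<eta>. \<eta> \<in> test_per T \<Longrightarrow> (LINT x:{-T..T}|lebesgue. f x * \<eta> x) = 0"
    and w: "continuous_on {-1..1} w"
  shows "(LINT x:{-T..T}|lebesgue. f x * complex_of_real (w (cos (pi / T * x + b)))) = 0" (is "?I = 0")
proof -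
  define N where "N = (LINT x:{-T..T}|lebesgue. cmod (f x))"
  have nf: "set_integrable lebesgue {-T..T} (\<lambda>x. cmod (f x))"
    using f by (rule set_integrable_norm)
  have "cmod ?I \<le> N * e" if e: "e > 0" for e
  proof -
    obtain g where g: "real_polynomial_function g" "\<And>x. x \<in> {-1..1} \<Longrightarrow> \<bar>w x - g x\<bar> < e"
      using Stone_Weierstrass_real_polynomial_function[OF _ w e] by auto
    let ?h = "\<lambda>v x. f x * complex_of_real (v (cos (pi / T * x + b)))"
    have c: "continuous_on {-T..T} (\<lambda>x. complex_of_real (v (cos (pi / T * x + b))))" 
      if "continuous_on {-1..1} v" for v
      by (intro continuous_on_of_real continuous_on_compose2[OF that] continuous_intros) auto
    have gc: "continuous_on {-1..1} g" using g(1)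
      by (simp add: continuous_at_imp_continuous_on continuous_real_polymonial_function)
    have i: "set_integrable lebesgue {-T..T} (?h v)" if "continuous_on {-1..1} v" for v
      by (intro integrable_mult_continuous f c that)
    have "?I = (LINT x:{-T..T}|lebesgue. ?h w x) - (LINT x:{-T..T}|lebesgue. ?h g x)"
      using z[OF test_per_polynomial_cos[OF T g(1)]] by simp
    also have "\<dots> = (LINT x:{-T..T}|lebesgue. ?h w x - ?h g x)"
      by (rule set_integral_diff(2)[symmetric]) (intro i w gc)+
    finally have "cmod ?I \<le> (LINT x:{-T..T}|lebesgue. cmod (?h w x - ?h g x))"
      using set_integral_norm_bound[OF set_integral_diff(1)[OF i[OF w] i[OF gc]]] by simp
    also have "\<dots> \<le> (LINT x:{-T..T}|lebesgue. cmod (f x) * e)"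
    proof (rule set_integral_mono)
      show "set_integrable lebesgue {-T..T} (\<lambda>x. cmod (?h w x - ?h g x))"
        by (intro set_integrable_norm set_integral_diff(1) i w gc)
      show "set_integrable lebesgue {-T..T} (\<lambda>x. cmod (f x) * e)" using nf by simp
      fix x
      have "cmod (?h w x - ?h g x) = cmod (f x) * \<bar>w (cos (pi / T * x + b)) - g (cos (pi / T * x + b))\<bar>"
        by (metis norm_mult norm_of_real of_real_diff right_diff_distrib)
      also have "\<dots> \<le> cmod (f x) * e"
        using g(2)[of "cos (pi / T * x + b)"] by (intro mult_left_mono) auto
      finally show "cmod (?h w x - ?h g x) \<le> cmod (f x) * e" .
    qed
    finally show ?thesis by (simp add: N_def)
  qed
  note B = this
  have "N \<ge> 0" unfolding N_def set_lebesgue_integral_def by (intro integral_nonneg_AE) auto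
  have "cmod ?I \<le> 0"
  proof (rule field_le_epsilon)
    fix e :: real assume "e > 0"
    \<comment> \<open>The denominator \<open>N + 1\<close> covers the case
      \<open>N = 0\<close>.\<close>
    have "cmod ?I \<le> N * (e / (N + 1))" using \<open>N \<ge> 0\<close> \<open>e > 0\<close> by (intro B) auto
    also have "\<dots> \<le> e" using \<open>N \<ge> 0\<close> \<open>e > 0\<close> by (simp add: field_simps)
    finally show "cmod ?I \<le> 0 + e" by simp
  qed
  then show ?thesis by simp
qed

text \<open>The interval from \<open>-T\<close> to \<open>a\<close> has centre
  \<open>(a - T) / 2\<close> and half-width \<open>(a + T) / 2\<close>. On the circle of length
  \<open>2 * T\<close> the cosine of the scaled distance to the centre decreases with that distance,
  so its superlevel set is this interval.\<close>

lemma cos_gt_cos_iff_interval: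
  assumes "T > 0" "-T < a" "a \<le> T" "-T \<le> x" "x \<le> T"
  shows "cos (pi / T * x + - pi / T * ((a - T) / 2)) > cos (pi / T * ((a + T) / 2)) \<longleftrightarrow> (-T < x \<and> x < a)"
proof -
  define d where "d = (a + T) / 2"
  define u where "u = \<bar>x - (a - T) / 2\<bar>"
  have d: "0 < d" "d \<le> T" and u: "0 \<le> u" "u \<le> 2 * T - d" using assms by (auto simp: d_def u_def field_simps)
  have "cos (pi / T * x + - pi / T * ((a - T) / 2)) = cos (pi / T * (x - (a - T) / 2))"
    by (simp add: algebra_simps)
  also have "\<dots> = cos \<bar>pi / T * (x - (a - T) / 2)\<bar>" by (simp only: cos_abs_real)
  also have "\<bar>pi / T * (x - (a - T) / 2)\<bar> = pi / T * u"
    using assms by (simp add: u_def abs_mult)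
  finally have eq: "cos (pi / T * x + - pi / T * ((a - T) / 2)) = cos (pi / T * u)" .
  have dpi: "0 \<le> pi / T * d" "pi / T * d \<le> pi" using d assms by (auto simp: field_simps)
  have "cos (pi / T * u) > cos (pi / T * d) \<longleftrightarrow> u < d"
  proof (cases "u \<le> T")
    case True
    then have "0 \<le> pi / T * u" "pi / T * u \<le> pi" using u assms by (auto simp: field_simps)
    then have "cos (pi / T * u) > cos (pi / T * d) \<longleftrightarrow> pi / T * u < pi / T * d"
      using dpi by (intro cos_mono_less_eq) auto
    also have "\<dots> \<longleftrightarrow> u < d" using assms by (simp add: field_simps)
    finally show ?thesis .
  next
    case False
    \<comment> \<open>Beyond half a period the distance is measured the other way round the circle.
      As \<open>u \<le> 2 * T - d\<close>, that distance is still at least \<open>d\<close>, so both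
      sides of the equivalence are false.\<close>
    have e: "cos (pi / T * u) = cos (pi / T * (2 * T - u))"
    proof -
      have "pi / T * (2 * T - u) = 2 * pi - pi / T * u" using assms by (simp add: field_simps)
      then show ?thesis by (simp add: cos_diff)
    qed
    have "0 \<le> pi / T * (2 * T - u)" "pi / T * (2 * T - u) \<le> pi"
      using u d False assms by (auto simp: field_simps)
    then have "cos (pi / T * u) > cos (pi / T * d) \<longleftrightarrow> pi / T * (2 * T - u) < pi / T * d"
      unfolding e using dpi by (intro cos_mono_less_eq) auto
    also have "\<dots> \<longleftrightarrow> 2 * T - u < d" using assms pi_gt_zero by (intro mult_less_cancel_left_pos) auto
    finally show ?thesis using False d u by auto
  qed
  moreover have "u < d \<longleftrightarrow> (-T < x \<and> x < a)" by (auto simp: u_def d_def abs_if field_simps)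
  ultimately show ?thesis using eq d_def by simp
qed

text \<open>Continuous functions of \<open>cos (\<pi> (x - x\<^sub>0) / T)\<close> are uniform limits of test functions, and those
  in the proof below approximate the indicator function of an interval centred at \<open>x\<^sub>0\<close>.\<close>

lemma test_per_fundamental:
  assumes T: "T > 0" and f: "set_integrable lebesgue {-T..T} f"
    and z: "\<And>\<eta>. \<eta> \<in> test_per T \<Longrightarrow> (LINT x:{-T..T}|lebesgue. f x * \<eta> x) = 0"
  shows "AE x in lebesgue. x \<in> {-T..T} \<longrightarrow> f x = 0"
proof -
  let ?F = "\<lambda>x. indicator {-T..T} x *\<^sub>R f x"
  have Fi: "integrable lebesgue ?F" using f by (simp add: set_integrable_def)
  have sing: "AE x in lebesgue. x \<noteq> (y::real)" for y
    by (rule AE_completion) (rule AE_lborel_singleton)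
  have main: "(LINT x:{..a}|lebesgue. ?F x) = 0" if a: "-T < a" "a \<le> T" for a
  proof -
    let ?C = "\<lambda>x. cos (pi / T * x + - pi / T * ((a - T) / 2))"
    let ?k = "cos (pi / T * ((a + T) / 2))"
    \<comment> \<open>Ramps with values in \<open>{0..1}\<close> that tend to the indicator of
      \<open>y > ?k\<close>; composed with \<open>?C\<close> they tend on the period to the
      indicator of \<open>{..a}\<close> away from the two endpoints. Dominated convergence then
      applies with the norm of \<open>?F\<close>.\<close>
    let ?w = "\<lambda>n y. min 1 (real n * max 0 (y - ?k))"
    have "(\<lambda>n. LINT x|lebesgue. indicator {-T..T} x *\<^sub>R (f x * complex_of_real (?w n (?C x))))
        \<longlonglongrightarrow> (LINT x|lebesgue. indicator {..a} x *\<^sub>R ?F x)"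
    proof (rule integral_dominated_convergence[where w = "\<lambda>x. norm (?F x)"])
      show "(\<lambda>x. indicator {..a} x *\<^sub>R ?F x) \<in> borel_measurable lebesgue"
        by (rule borel_measurable_scaleR[OF borel_measurable_indicator borel_measurable_integrable[OF Fi]]) auto
      show "(\<lambda>x. indicator {-T..T} x *\<^sub>R (f x * complex_of_real (?w n (?C x)))) \<in> borel_measurable lebesgue" for n
      proof -
        have "set_integrable lebesgue {-T..T} (\<lambda>x. f x * complex_of_real (?w n (?C x)))"
          by (intro integrable_mult_continuous f continuous_intros)
        then show ?thesis by (auto simp: set_integrable_def)
      qed
      show "integrable lebesgue (\<lambda>x. norm (?F x))" using Fi by (rule integrable_norm)
      show "AE x in lebesgue. norm (indicator {-T..T} x *\<^sub>R (f x * complex_of_real (?w n (?C x)))) \<le> norm (?F x)" for n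
      proof (intro AE_I2)
        fix x
        have "\<bar>?w n (?C x)\<bar> \<le> 1" by auto
        then show "norm (indicator {-T..T} x *\<^sub>R (f x * complex_of_real (?w n (?C x)))) \<le> norm (?F x)"
          by (auto simp: norm_mult indicator_def simp del: of_real_minus intro!: mult_left_le)
      qed
      show "AE x in lebesgue. (\<lambda>n. indicator {-T..T} x *\<^sub>R (f x * complex_of_real (?w n (?C x))))
          \<longlonglongrightarrow> indicator {..a} x *\<^sub>R ?F x"
        using sing[of "-T"] sing[of a]
      proof eventually_elim
        case (elim x)
        show ?case
        proof (cases "x \<in> {-T..T}")
          case True
          have iff: "?C x > ?k \<longleftrightarrow> x < a" using cos_gt_cos_iff_interval[OF T a, of x] True elim by auto
          have "(\<lambda>n. ?w n (?C x)) \<longlonglongrightarrow> indicator {..a} x"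
          proof (cases "x < a")
            case True
            then have "?C x - ?k > 0" using iff by simp
            then obtain n0 :: nat where n0: "1 < real n0 * (?C x - ?k)" using ex_less_of_nat_mult by blast
            have "eventually (\<lambda>n. ?w n (?C x) = 1) sequentially"
              using eventually_ge_at_top[of n0]
            proof eventually_elim
              case (elim n)
              have "real n0 * (?C x - ?k) \<le> real n * (?C x - ?k)"
                using elim \<open>?C x - ?k > 0\<close> by (intro mult_right_mono) auto
              with n0 have "1 \<le> real n * (?C x - ?k)" by linarith
              moreover have "max 0 (?C x - ?k) = ?C x - ?k" using \<open>?C x - ?k > 0\<close> by (rule max_absorb2[OF less_imp_le])
              ultimately show ?case by (metis min_absorb1)
            qed
            then show ?thesis using True by (auto intro: tendsto_eventually simp: eventually_mono)
          next
            case False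
            then have "?w n (?C x) = 0" for n using iff by (auto simp: max_def)
            moreover have "x \<notin> {..a}" using False elim by auto
            ultimately show ?thesis by simp
          qed
          then have "(\<lambda>n. indicator {-T..T} x *\<^sub>R (f x * complex_of_real (?w n (?C x))))
            \<longlonglongrightarrow> indicator {-T..T} x *\<^sub>R (f x * complex_of_real (indicator {..a} x))"
            by (intro tendsto_intros)
          moreover have "indicator {-T..T} x *\<^sub>R (f x * complex_of_real (indicator {..a} x)) = indicator {..a} x *\<^sub>R ?F x"
            by (simp split: split_indicator)
          ultimately show ?thesis by (simp only:)
        qed auto
      qed
    qed
    moreover have "(LINT x|lebesgue. indicator {-T..T} x *\<^sub>R (f x * complex_of_real (?w n (?C x)))) = 0" for n
      using integral_polynomial_cos_zero[OF T f z, of "?w n" "- pi / T * ((a - T) / 2)"]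
      by (simp add: set_lebesgue_integral_def continuous_intros)
    ultimately show ?thesis by (simp add: LIMSEQ_const_iff set_lebesgue_integral_def)
  qed
  have "(LINT x:{..a}|lebesgue. ?F x) = 0" for a
  proof -
    \<comment> \<open>Outside the range of \<open>main\<close>, the half-line meets the period in at
      most one point or contains all of it, as for \<open>a = T\<close>.\<close>
    consider "a \<le> -T" | "-T < a" "a \<le> T" | "a > T" by linarith
    then show ?thesis
    proof cases
      case 1
      have "AE x in lebesgue. indicator {..a} x *\<^sub>R ?F x = 0"
        using sing[of "-T"] by eventually_elim (use 1 in \<open>auto split: split_indicator\<close>)
      from integral_eq_zero_AE[OF this]
      have "(LINT x:{..a}|lebesgue. ?F x) = 0" by (simp add: set_lebesgue_integral_def)
      then show ?thesis by simp
    next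
      case 2
      then show ?thesis by (rule main)
    next
      case 3
      have eq: "indicator {..a} x *\<^sub>R ?F x = indicator {..T} x *\<^sub>R ?F x" for x using 3 by (auto simp: indicator_def)
      show ?thesis using main[of T] T unfolding set_lebesgue_integral_def eq by simp
    qed
  qed
  from lebesgue_integral_zero_intervals[OF Fi this] show ?thesis
    by eventually_elim (auto simp: indicator_def)
qed

section \<open>Primitives of integrable functions and integration by parts\<close>

lemma has_vector_derivative_zero_sandwich:
  assumes "\<And>y. y \<in> S \<Longrightarrow> norm (E y - E x) \<le> \<bar>y - x\<bar> * k y" "(k \<longlongrightarrow> 0) (at x within S)"
  shows "(E has_vector_derivative 0) (at x within S)"
  unfolding has_vector_derivative_def
  by (rule has_derivativeI_sandwich[where e = 1 and H = k])
     (use assms in \<open>auto simp: field_simps\<close>)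

text \<open>For merely integrable \<open>g\<close> the two terms need not be differentiable, but their difference
  is differentiable everywhere; this gives integration by parts without Fubini's theorem.\<close>

lemma by_parts_derivative:
  fixes g \<eta> \<eta>' :: "real \<Rightarrow> complex"
  assumes gi: "set_integrable lebesgue {a..b} g" and x: "x \<in> {a..b}"
    and d: "\<And>t. t \<in> {a..b} \<Longrightarrow> (\<eta> has_vector_derivative \<eta>' t) (at t within {a..b})"
    and c: "continuous_on {a..b} \<eta>'"
  shows "((\<lambda>y. integral {a..y} g * \<eta> y - integral {a..y} (\<lambda>t. g t * \<eta> t)) has_vector_derivative
           integral {a..x} g * \<eta>' x) (at x within {a..b})"
proof -
  define W where "W y = integral {a..y} g" for y
  define G where "G y = integral {a..y} (\<lambda>t. cmod (g t))" for y
  define V where "V y = integral {a..y} (\<lambda>t. g t * \<eta> t)" for y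
  have \<eta>c: "continuous_on {a..b} \<eta>"
    using d by (rule continuous_on_vector_derivative)
  have i1: "g integrable_on {a..b}" using gi by (rule set_lebesgue_integral_eq_integral)
  have i2: "(\<lambda>t. cmod (g t)) integrable_on {a..b}"
    using set_integrable_norm[OF gi] by (rule set_lebesgue_integral_eq_integral)
  have i3: "(\<lambda>t. g t * \<eta> t) integrable_on {a..b}"
    using integrable_mult_continuous[OF gi \<eta>c] by (rule set_lebesgue_integral_eq_integral)
  have "bounded (\<eta>' ` {a..b})" by (intro compact_imp_bounded compact_continuous_image c) auto
  then obtain M where M: "\<And>t. t \<in> {a..b} \<Longrightarrow> cmod (\<eta>' t) \<le> M"
    unfolding bounded_iff by blast
  have "M \<ge> 0" using M[OF x] norm_ge_zero order.trans by blast
  have lip: "cmod (\<eta> s - \<eta> t) \<le> M * \<bar>s - t\<bar>" if "s \<in> {a..b}" "t \<in> {a..b}" for s t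
  proof -
    have "norm (\<eta> s - \<eta> t) \<le> M * norm (s - t)"
    proof (rule differentiable_bound[of "{a..b}" \<eta> "\<lambda>t h. h *\<^sub>R \<eta>' t"])
      show "(\<eta> has_derivative (\<lambda>h. h *\<^sub>R \<eta>' t)) (at t within {a..b})" if "t \<in> {a..b}" for t
        using d[OF that] by (simp add: has_vector_derivative_def)
      show "onorm (\<lambda>h. h *\<^sub>R \<eta>' t) \<le> M" if "t \<in> {a..b}" for t
        using M[OF that] by (intro onorm_le) (simp add: mult.commute[of M] mult_left_mono)
    qed (use that in auto)
    then show ?thesis by simp
  qed
  have split: "W t = W s + integral {s..t} g" "G t = G s + integral {s..t} (\<lambda>t. cmod (g t))"
      "V t = V s + integral {s..t} (\<lambda>t. g t * \<eta> t)"
      "g integrable_on {s..t}" "(\<lambda>t. cmod (g t)) integrable_on {s..t}" "(\<lambda>t. g t * \<eta> t) integrable_on {s..t}"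
    if "a \<le> s" "s \<le> t" "t \<le> b" for s t
  proof -
    have "f integrable_on {a..t} \<and> f integrable_on {s..t}" if "f integrable_on {a..b}" for f :: "real \<Rightarrow> 'a :: banach"
      using that \<open>a \<le> s\<close> \<open>s \<le> t\<close> \<open>t \<le> b\<close> by (auto intro: integrable_on_subinterval)
    with i1 i2 i3 show "W t = W s + integral {s..t} g" "G t = G s + integral {s..t} (\<lambda>t. cmod (g t))"
      "V t = V s + integral {s..t} (\<lambda>t. g t * \<eta> t)"
      "g integrable_on {s..t}" "(\<lambda>t. cmod (g t)) integrable_on {s..t}" "(\<lambda>t. g t * \<eta> t) integrable_on {s..t}"
      unfolding W_def G_def V_def using that by (auto intro!: Henstock_Kurzweil_Integration.integral_combine[symmetric])
  qed
  \<comment> \<open>The left-hand side is the integral of \<open>g u * (\<eta> u - \<eta> x)\<close>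
    over \<open>{s..t}\<close>, and \<eta> is Lipschitz with constant \<open>M\<close>.
    \<open>G\<close> controls the remaining integral of the norm of \<open>g\<close>.\<close>
  have key: "cmod (V t - V s - (W t - W s) * \<eta> x) \<le> M * (t - s) * (G t - G s)"
    if "a \<le> s" "s \<le> t" "t \<le> b" "x = s \<or> x = t" for s t
  proof -
    note S = split[OF that(1-3)]
    have "((\<lambda>u. g u * \<eta> u - g u * \<eta> x) has_integral (V t - V s - (W t - W s) * \<eta> x)) {s..t}"
      using S by (intro has_integral_diff has_integral_mult_left) (auto simp: integrable_integral algebra_simps)
    then have "cmod (V t - V s - (W t - W s) * \<eta> x) \<le> integral {s..t} (\<lambda>u. (M * (t - s)) * cmod (g u))"
    proof (subst integral_unique[symmetric], assumption, intro integral_norm_bound_integral)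
      show "(\<lambda>u. (M * (t - s)) * cmod (g u)) integrable_on {s..t}" using S(5) by (rule integrable_on_mult_right)
      fix u assume u: "u \<in> {s..t}"
      have "cmod (\<eta> u - \<eta> x) \<le> M * \<bar>u - x\<bar>" using u x that by (intro lip) auto
      also have "\<dots> \<le> M * (t - s)" using u that \<open>M \<ge> 0\<close> by (intro mult_left_mono) auto
      finally have "cmod (g u) * cmod (\<eta> u - \<eta> x) \<le> cmod (g u) * (M * (t - s))" by (intro mult_left_mono) auto
      then show "cmod (g u * \<eta> u - g u * \<eta> x) \<le> (M * (t - s)) * cmod (g u)"
        by (metis mult.commute norm_mult right_diff_distrib)
    qed (auto simp: integrable_on_def)
    then show ?thesis using S by simp
  qed
  \<comment> \<open>With \<open>W\<close> frozen at \<open>x\<close> subtracted, the increment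
    consists of a product of the increments of \<open>W\<close> and \<eta> and the term bounded in
    \<open>key\<close>. Both are of order \<open>y - x\<close> times a quantity tending to 0, by
    continuity of \<open>W\<close> and \<open>G\<close>.\<close>
  have "((\<lambda>y. (W y * \<eta> y - V y) - W x * \<eta> y) has_vector_derivative 0) (at x within {a..b})"
  proof (rule has_vector_derivative_zero_sandwich[where k = "\<lambda>y. M * (cmod (W y - W x) + \<bar>G y - G x\<bar>)"])
    have "continuous_on {a..b} W" "continuous_on {a..b} G"
      unfolding W_def G_def using i1 i2 by (auto intro: indefinite_integral_continuous_1)
    then have "(W \<longlongrightarrow> W x) (at x within {a..b})" "(G \<longlongrightarrow> G x) (at x within {a..b})"
      using x by (auto simp: continuous_on_def)
    then show "((\<lambda>y. M * (cmod (W y - W x) + \<bar>G y - G x\<bar>)) \<longlongrightarrow> 0) (at x within {a..b})"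
      by (auto intro!: tendsto_eq_intros)
    fix y assume y: "y \<in> {a..b}"
    have "cmod (V y - V x - (W y - W x) * \<eta> x) \<le> M * \<bar>y - x\<bar> * \<bar>G y - G x\<bar>"
    proof (cases "x \<le> y")
      case True
      have "M * (y - x) * (G y - G x) \<le> M * \<bar>y - x\<bar> * \<bar>G y - G x\<bar>"
        using \<open>M \<ge> 0\<close> True by (auto intro!: mult_left_mono)
      then show ?thesis using key[of x y] True x y by auto
    next
      case False
      have "M * (x - y) * (G x - G y) \<le> M * \<bar>y - x\<bar> * \<bar>G y - G x\<bar>"
        using \<open>M \<ge> 0\<close> False by (auto intro!: mult_left_mono)
      moreover have "cmod (V x - V y - (W x - W y) * \<eta> x) = cmod (V y - V x - (W y - W x) * \<eta> x)"
        using norm_minus_cancel[of "V y - V x - (W y - W x) * \<eta> x"] by (simp add: algebra_simps)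
      ultimately show ?thesis using key[of y x] False x y by auto
    qed
    moreover have "cmod ((W y - W x) * (\<eta> y - \<eta> x)) \<le> cmod (W y - W x) * (M * \<bar>y - x\<bar>)"
      unfolding norm_mult using lip[OF y x] by (intro mult_left_mono) auto
    moreover have "W y * \<eta> y - V y - W x * \<eta> y - (W x * \<eta> x - V x - W x * \<eta> x) =
       (W y - W x) * (\<eta> y - \<eta> x) - (V y - V x - (W y - W x) * \<eta> x)" by (simp add: algebra_simps)
    ultimately show "cmod (W y * \<eta> y - V y - W x * \<eta> y - (W x * \<eta> x - V x - W x * \<eta> x))
        \<le> \<bar>y - x\<bar> * (M * (cmod (W y - W x) + \<bar>G y - G x\<bar>))"
      using norm_triangle_ineq4[of "(W y - W x) * (\<eta> y - \<eta> x)" "V y - V x - (W y - W x) * \<eta> x"]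
      by (simp add: algebra_simps)
  qed
  then have "((\<lambda>y. ((W y * \<eta> y - V y) - W x * \<eta> y) + W x * \<eta> y) has_vector_derivative 0 + W x * \<eta>' x) (at x within {a..b})"
    by (intro has_vector_derivative_add has_vector_derivative_mult_right d x)
  then show ?thesis by (simp add: W_def V_def)
qed

text \<open>The function in \<open>by_parts_derivative\<close> is differentiable at every point, so
  the fundamental theorem applies although \<open>g\<close> is merely integrable.\<close>

lemma integral_by_parts_indefinite:
  fixes g \<eta> \<eta>' :: "real \<Rightarrow> complex"
  assumes "a \<le> b" and gi: "set_integrable lebesgue {a..b} g"
    and d: "\<And>t. t \<in> {a..b} \<Longrightarrow> (\<eta> has_vector_derivative \<eta>' t) (at t within {a..b})"
    and c: "continuous_on {a..b} \<eta>'"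
  shows "((\<lambda>x. integral {a..x} g * \<eta>' x) has_integral
    (integral {a..b} g * \<eta> b - integral {a..b} (\<lambda>t. g t * \<eta> t))) {a..b}"
  using fundamental_theorem_of_calculus[OF \<open>a \<le> b\<close> by_parts_derivative[OF gi _ d c]] by simp

text \<open>One primitive based at 0 serves all \<open>x\<close>; only the auxiliary interval, which
  has 0 and \<open>x\<close> in its interior, depends on \<open>x\<close>.\<close>

lemma antiderivative_everywhere:
  fixes f :: "real \<Rightarrow> 'a :: euclidean_space"
  assumes "continuous_on UNIV f"
  obtains F where "\<And>x. (F has_vector_derivative f x) (at x)"
proof
  fix x :: real
  have "((\<lambda>u. LBINT y=ereal 0..ereal u. f y) has_vector_derivative f x) (at x within {-\<bar>x\<bar>-1..\<bar>x\<bar>+1})"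
    by (rule interval_integral_FTC2) (use assms in \<open>auto intro: continuous_on_subset\<close>)
  moreover have "x \<in> interior {-\<bar>x\<bar>-1..\<bar>x\<bar>+1}" by auto
  ultimately show "((\<lambda>u. LBINT y=ereal 0..ereal u. f y) has_vector_derivative f x) (at x)"
    by (metis at_within_interior)
qed

text \<open>Subtracting the mean makes the primitive periodic. Hence every test function is a
  constant plus the derivative of a test function.\<close>

lemma test_per_antiderivative:
  assumes T: "T > 0" and \<xi>: "\<xi> \<in> test_per T"
  obtains \<eta> m where "\<eta> \<in> test_per T" "vderiv \<eta> = (\<lambda>x. \<xi> x - m)"
proof -
  have \<xi>c: "continuous_on UNIV \<xi>" by (rule test_per_continuous[OF \<xi>])
  obtain F where F: "\<And>x. (F has_vector_derivative \<xi> x) (at x)"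
    using antiderivative_everywhere[OF \<xi>c] by blast
  define m where "m = (F (2 * T) - F 0) / of_real (2 * T)"
  define \<eta> where "\<eta> x = F x - of_real x * m" for x
  have d: "(\<eta> has_vector_derivative \<xi> x - m) (at x)" for x
  proof -
    have "((\<lambda>x. of_real x * m) has_vector_derivative m) (at x)"
      by (auto intro!: derivative_eq_intros has_vector_derivative_of_real)
    then show ?thesis unfolding \<eta>_def using F by (intro has_vector_derivative_diff)
  qed
  have per: "\<eta> (x + 2 * T) = \<eta> x" for x
  proof -
    have "((\<lambda>x. \<eta> (x + 2 * T) - \<eta> x) has_vector_derivative 0) (at x)" for x
    proof -
      have "((\<lambda>x. x + 2 * T) has_vector_derivative 1) (at x)"
        by (auto intro!: derivative_eq_intros simp flip: has_real_derivative_iff_has_vector_derivative)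
      from vector_diff_chain_at[OF this d]
      have "((\<lambda>x. \<eta> (x + 2 * T)) has_vector_derivative \<xi> (x + 2 * T) - m) (at x)" by (simp add: o_def)
      moreover have "\<xi> (x + 2 * T) = \<xi> x" using \<xi> by (auto simp: test_per_iff periodic_def)
      ultimately show ?thesis using has_vector_derivative_diff[OF _ d[of x]] by fastforce
    qed
    then obtain C where C: "\<And>x. \<eta> (x + 2 * T) - \<eta> x = C"
      using has_vector_derivative_zero_constant[of UNIV "\<lambda>x. \<eta> (x + 2 * T) - \<eta> x"] by auto
    \<comment> \<open>At 0 the increment over a period is \<open>F (2 * T) - F 0\<close> minus
      \<open>2 * T\<close> times \<open>m\<close>, which vanishes by the choice of
      \<open>m\<close>.\<close>
    have "C = 0" using C[of 0] T by (simp add: \<eta>_def m_def)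
    then show ?thesis using C[of x] by simp
  qed
  have v: "vderiv \<eta> = (\<lambda>x. \<xi> x - m)" using d by (rule vderiv_eqI)
  have "(\<lambda>x. \<xi> x + (- m)) \<in> test_per T" by (rule test_per_add[OF \<xi> test_per_const])
  then have "\<eta> \<in> test_per T"
    using per d unfolding test_per_iff periodic_def v[symmetric]
    by (metis (no_types, lifting) add_uminus_conv_diff diff_upto_Suc diff_upto_mono differentiableI_vector le_SucI order_refl v ext)
  with v that show thesis by blast
qed

text \<open>Testing with the constant 1 shows that \<open>g\<close> has mean zero. The primitive
  \<open>W\<close> of \<open>g\<close> then has the same weak derivative as \<open>f\<close>, so
  \<open>f - W\<close> annihilates all derivatives of test functions. With \<open>C\<close> its
  mean, \<open>f - W - C\<close> also annihilates constants, hence every test function.\<close>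

lemma weak_deriv_primitive:
  assumes T: "T > 0" and f: "set_integrable lebesgue {-T..T} f" and g: "set_integrable lebesgue {-T..T} g"
    and w: "is_weak_deriv T f g"
  obtains C where "AE x in lebesgue. x \<in> {-T..T} \<longrightarrow> f x = C + integral {-T..x} g" "integral {-T..T} g = 0"
proof -
  have "vderiv (\<lambda>_. 1) = (\<lambda>_. 0)" by (rule vderiv_eqI) auto
  then have "(LINT x:{-T..T}|lebesgue. g x) = 0"
    using w test_per_const[of 1 T] by (auto simp: is_weak_deriv_def set_lebesgue_integral_def)
  then have g0: "integral {-T..T} g = 0" using set_lebesgue_integral_eq_integral(2)[OF g] by simp
  define W where "W x = integral {-T..x} g" for x
  have Wc: "continuous_on {-T..T} W"
    unfolding W_def using set_lebesgue_integral_eq_integral(1)[OF g] by (rule indefinite_integral_continuous_1)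
  have ci: "set_integrable lebesgue {-T..T} h" if "continuous_on {-T..T} h" for h :: "real \<Rightarrow> complex"
    using that by (rule absolutely_integrable_continuous_real)
  have fW: "set_integrable lebesgue {-T..T} (\<lambda>x. f x - W x)" by (intro set_integral_diff f ci Wc)
  have orth: "(LINT x:{-T..T}|lebesgue. (f x - W x) * vderiv \<eta> x) = 0" if \<eta>: "\<eta> \<in> test_per T" for \<eta>
  proof -
    have c: "continuous_on S \<eta>" "continuous_on S (vderiv \<eta>)" for S
      using \<eta> test_per_vderiv test_per_continuous by blast+
    have per: "\<eta> (-T) = \<eta> T" using \<eta> unfolding test_per_iff periodic_def by (metis add.commute add_minus_cancel mult_2)
    have "((\<lambda>x. W x * vderiv \<eta> x) has_integral
      (integral {-T..T} g * \<eta> T - integral {-T..T} (\<lambda>t. g t * \<eta> t))) {-T..T}"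
      unfolding W_def
      using T g by (intro integral_by_parts_indefinite c) (auto intro: has_vector_derivative_at_within test_per_derivative \<eta>)
    then have "(LINT x:{-T..T}|lebesgue. W x * vderiv \<eta> x) = - (LINT x:{-T..T}|lebesgue. g x * \<eta> x)"
      using set_lebesgue_integral_eq_integral(2)[OF ci[OF continuous_on_mult[OF Wc c(2)]]]
        set_lebesgue_integral_eq_integral(2)[OF integrable_mult_continuous[OF g c(1)]] g0
      by (simp add: integral_unique)
    also have "\<dots> = (LINT x:{-T..T}|lebesgue. f x * vderiv \<eta> x)"
      using w \<eta> by (simp add: is_weak_deriv_def)
    finally have "(LINT x:{-T..T}|lebesgue. f x * vderiv \<eta> x) - (LINT x:{-T..T}|lebesgue. W x * vderiv \<eta> x) = 0" by simp
    then show ?thesis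
      using set_integral_diff(2)[OF integrable_mult_continuous[OF f c(2)] ci[OF continuous_on_mult[OF Wc c(2)]]]
      by (simp add: algebra_simps)
  qed
  define C where "C = (LINT x:{-T..T}|lebesgue. f x - W x) / of_real (2 * T)"
  have fWC: "set_integrable lebesgue {-T..T} (\<lambda>x. f x - W x - C)"
    by (intro set_integral_diff(1)[OF fW] ci continuous_intros)
  have LC: "(LINT x:{-T..T}|lebesgue. k) = of_real (2 * T) * k" for k :: complex
    using set_lebesgue_integral_eq_integral(2)[OF ci[OF continuous_on_const[of "{-T..T}" k]]] T
    by (simp add: scaleR_conv_of_real)
  have mean: "(LINT x:{-T..T}|lebesgue. f x - W x - C) = 0"
    using set_integral_diff(2)[OF fW ci[OF continuous_on_const[of "{-T..T}" C]]] T by (simp add: LC C_def)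
  have "AE x in lebesgue. x \<in> {-T..T} \<longrightarrow> f x - W x - C = 0"
  proof (rule test_per_fundamental[OF T fWC])
    fix \<xi> assume \<xi>: "\<xi> \<in> test_per T"
    obtain \<eta> m where \<eta>: "\<eta> \<in> test_per T" "vderiv \<eta> = (\<lambda>x. \<xi> x - m)"
      using test_per_antiderivative[OF T \<xi>] by blast
    have c: "continuous_on S (vderiv \<eta>)" for S
      using \<eta> test_per_vderiv test_per_continuous by blast
    have v0: "(LINT x:{-T..T}|lebesgue. C * vderiv \<eta> x) = 0"
    proof -
      have "(vderiv \<eta> has_integral (\<eta> T - \<eta> (-T))) {-T..T}"
        using T has_vector_derivative_at_within[OF test_per_derivative[OF \<eta>(1)]]
        by (intro fundamental_theorem_of_calculus) auto
      moreover have "\<eta> (-T) = \<eta> T" using \<eta> unfolding test_per_iff periodic_def by (metis add.commute add_minus_cancel mult_2)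
      ultimately show ?thesis using set_lebesgue_integral_eq_integral(2)[OF ci[OF c]] by (simp add: integral_unique)
    qed
    have i1: "set_integrable lebesgue {-T..T} (\<lambda>x. (f x - W x) * vderiv \<eta> x)"
      by (rule integrable_mult_continuous[OF fW c])
    have i2: "set_integrable lebesgue {-T..T} (\<lambda>x. C * vderiv \<eta> x)"
      by (intro ci continuous_intros c)
    have i3: "set_integrable lebesgue {-T..T} (\<lambda>x. m * (f x - W x - C))"
      using fWC by simp
    have "(LINT x:{-T..T}|lebesgue. (f x - W x - C) * \<xi> x) =
      (LINT x:{-T..T}|lebesgue. ((f x - W x) * vderiv \<eta> x - C * vderiv \<eta> x) + m * (f x - W x - C))"
      by (simp add: \<eta>(2) algebra_simps)
    also have "\<dots> = ((LINT x:{-T..T}|lebesgue. (f x - W x) * vderiv \<eta> x) - (LINT x:{-T..T}|lebesgue. C * vderiv \<eta> x))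
         + (LINT x:{-T..T}|lebesgue. m * (f x - W x - C))"
      by (subst set_integral_add(2)[OF set_integral_diff(1)[OF i1 i2] i3], subst set_integral_diff(2)[OF i1 i2]) simp
    also have "\<dots> = 0" using orth[OF \<eta>(1)] v0 mean by simp
    finally show "(LINT x:{-T..T}|lebesgue. (f x - W x - C) * \<xi> x) = 0" .
  qed
  then have "AE x in lebesgue. x \<in> {-T..T} \<longrightarrow> f x = C + integral {-T..x} g"
    by eventually_elim (auto simp: W_def algebra_simps)
  with g0 that show thesis by blast
qed

section \<open>Closure properties of \<open>L2_per\<close> and calculus of weak derivatives up to
  null sets\<close>

lemma L2_per_set_integrable:
  assumes "f \<in> L2_per T"
  shows "set_integrable lebesgue {-T..T} f"
proof (rule set_integrable_bound[where f = "\<lambda>x. 1 + (cmod (f x))\<^sup>2"])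
  show "set_integrable lebesgue {-T..T} (\<lambda>x. 1 + (cmod (f x))\<^sup>2)"
    using assms absolutely_integrable_continuous_real[OF continuous_on_const[of "{-T..T}" "1::real"]]
    by (intro set_integral_add) (auto simp: L2_per_def)
  show "set_borel_measurable lebesgue {-T..T} f"
    using assms by (auto simp: L2_per_def set_borel_measurable_def intro!: borel_measurable_scaleR borel_measurable_indicator)
  have "y \<le> 1 + y\<^sup>2" for y :: real
    using zero_le_power2[of "y - 1/2"] by (simp add: power2_eq_square algebra_simps)
  then show "AE x in lebesgue. x \<in> {-T..T} \<longrightarrow> cmod (f x) \<le> norm (1 + (cmod (f x))\<^sup>2)"
    by (intro AE_I2) (auto simp: abs_of_nonneg add_nonneg_nonneg)
qed

text \<open>A common domination criterion: the two dominating functions are the summands in the case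
  of sums, and coincide in the case of products with a bounded factor.\<close>

lemma L2_per_bound:
  assumes f: "f \<in> L2_per T" and g: "g \<in> L2_per T" and h: "periodic (2 * T) h" "h \<in> borel_measurable lebesgue"
    and B: "\<And>x. x \<in> {-T..T} \<Longrightarrow> (cmod (h x))\<^sup>2 \<le> B * ((cmod (f x))\<^sup>2 + (cmod (g x))\<^sup>2)"
  shows "h \<in> L2_per T"
proof -
  have "set_integrable lebesgue {-T..T} (\<lambda>x. (cmod (h x))\<^sup>2)"
  proof (rule set_integrable_bound[where f = "\<lambda>x. B * ((cmod (f x))\<^sup>2 + (cmod (g x))\<^sup>2)"])
    show "set_integrable lebesgue {-T..T} (\<lambda>x. B * ((cmod (f x))\<^sup>2 + (cmod (g x))\<^sup>2))"
      using f g by (intro set_integrable_mult_right set_integral_add) (auto simp: L2_per_def)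
    show "set_borel_measurable lebesgue {-T..T} (\<lambda>x. (cmod (h x))\<^sup>2)"
      using h(2) unfolding set_borel_measurable_def
      by (intro borel_measurable_scaleR borel_measurable_indicator borel_measurable_power borel_measurable_norm) auto
    show "AE x in lebesgue. x \<in> {-T..T} \<longrightarrow> norm ((cmod (h x))\<^sup>2) \<le> norm (B * ((cmod (f x))\<^sup>2 + (cmod (g x))\<^sup>2))"
      using B by (intro AE_I2) (fastforce intro: order.trans)
  qed
  with h show ?thesis by (simp add: L2_per_def)
qed

lemma L2_per_add:
  assumes "f \<in> L2_per T" "g \<in> L2_per T"
  shows "(\<lambda>x. f x + g x) \<in> L2_per T"
proof (rule L2_per_bound[OF assms])
  fix x
  have "(cmod (f x + g x))\<^sup>2 \<le> (cmod (f x) + cmod (g x))\<^sup>2"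
    by (intro power_mono norm_triangle_ineq) auto
  also have "\<dots> \<le> 2 * ((cmod (f x))\<^sup>2 + (cmod (g x))\<^sup>2)"
    using zero_le_power2[of "cmod (f x) - cmod (g x)"] by (simp add: power2_eq_square algebra_simps)
  finally show "(cmod (f x + g x))\<^sup>2 \<le> 2 * ((cmod (f x))\<^sup>2 + (cmod (g x))\<^sup>2)" .
qed (use assms in \<open>auto simp: L2_per_def periodic_def intro!: borel_measurable_add\<close>)

lemma L2_per_mult:
  assumes f: "f \<in> L2_per T" and k: "periodic (2 * T) k" "continuous_on UNIV k"
  shows "(\<lambda>x. k x * f x) \<in> L2_per T"
proof -
  have "bounded (k ` {-T..T})"
    by (intro compact_imp_bounded compact_continuous_image continuous_on_subset[OF k(2)]) auto
  then obtain M where M: "\<And>x. x \<in> {-T..T} \<Longrightarrow> cmod (k x) \<le> M" unfolding bounded_iff by blast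
  have "k \<in> borel_measurable borel" using k(2) by (rule borel_measurable_continuous_onI)
  then have km: "k \<in> borel_measurable lebesgue" by (simp add: measurable_completion)
  show ?thesis
  proof (rule L2_per_bound[OF f f])
    fix x assume "x \<in> {-T..T}"
    then have "(cmod (k x))\<^sup>2 * (cmod (f x))\<^sup>2 \<le> M\<^sup>2 * (cmod (f x))\<^sup>2"
      by (intro mult_right_mono power_mono M) auto
    then show "(cmod (k x * f x))\<^sup>2 \<le> (M\<^sup>2 / 2) * ((cmod (f x))\<^sup>2 + (cmod (f x))\<^sup>2)"
      by (simp add: norm_mult power_mult_distrib)
  qed (use f k(1) km in \<open>auto simp: L2_per_def periodic_def intro!: borel_measurable_times\<close>)
qed

lemma L2_per_cmult: "f \<in> L2_per T \<Longrightarrow> (\<lambda>x. k * f x) \<in> L2_per T"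
  by (rule L2_per_mult) (auto simp: periodic_def)

lemma L2_per_mult_test:
  assumes "f \<in> L2_per T" "\<eta> \<in> test_per T"
  shows "set_integrable lebesgue {-T..T} (\<lambda>x. f x * \<eta> x)" "set_integrable lebesgue {-T..T} (\<lambda>x. f x * vderiv \<eta> x)"
  by (rule integrable_mult_continuous[OF L2_per_set_integrable[OF assms(1)] test_per_continuous],
      rule assms test_per_vderiv[OF assms(2)])+

lemma is_weak_deriv_add:
  assumes "f \<in> L2_per T" "g \<in> L2_per T" "f' \<in> L2_per T" "g' \<in> L2_per T"
    "is_weak_deriv T f f'" "is_weak_deriv T g g'"
  shows "is_weak_deriv T (\<lambda>x. f x + g x) (\<lambda>x. f' x + g' x)"
  unfolding is_weak_deriv_def
proof
  fix \<eta> assume \<eta>: "\<eta> \<in> test_per T"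
  have "(LINT x:{-T..T}|lebesgue. f x * vderiv \<eta> x) = - (LINT x:{-T..T}|lebesgue. f' x * \<eta> x)"
    "(LINT x:{-T..T}|lebesgue. g x * vderiv \<eta> x) = - (LINT x:{-T..T}|lebesgue. g' x * \<eta> x)"
    using assms(5,6) \<eta> by (auto simp: is_weak_deriv_def)
  then show "(LINT x:{-T..T}|lebesgue. (f x + g x) * vderiv \<eta> x) = - (LINT x:{-T..T}|lebesgue. (f' x + g' x) * \<eta> x)"
    using assms(1-4) \<eta> by (simp add: distrib_right set_integral_add L2_per_mult_test)
qed

lemma is_weak_deriv_cmult:
  assumes "is_weak_deriv T f f'"
  shows "is_weak_deriv T (\<lambda>x. k * f x) (\<lambda>x. k * f' x)"
  using assms by (simp add: is_weak_deriv_def mult.assoc)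

lemma set_integral_cong_AE_interval:
  assumes f: "set_integrable lebesgue {-T..T} f" and g: "set_integrable lebesgue {-T..T} g" 
    and "AE x in lebesgue. x \<in> {-T..T} \<longrightarrow> f x = g x"
  shows "(LINT x:{-T..T}|lebesgue. f x) = (LINT x:{-T..T}|lebesgue. g x :: complex)"
  unfolding set_lebesgue_integral_def
  by (rule integral_cong_AE)
     (use assms in \<open>auto simp: set_integrable_def split: split_indicator elim: eventually_mono\<close>)

text \<open>Allows passing between the representatives chosen by \<open>wderiv\<close> and
  continuous ones.\<close>

lemma is_weak_deriv_cong:
  assumes i: "set_integrable lebesgue {-T..T} f" "set_integrable lebesgue {-T..T} g"
      "set_integrable lebesgue {-T..T} f'" "set_integrable lebesgue {-T..T} g'"
    and e: "AE x in lebesgue. x \<in> {-T..T} \<longrightarrow> f x = g x" "AE x in lebesgue. x \<in> {-T..T} \<longrightarrow> f' x = g' x"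
    and w: "is_weak_deriv T f f'"
  shows "is_weak_deriv T g g'"
  unfolding is_weak_deriv_def
proof
  fix \<eta> assume \<eta>: "\<eta> \<in> test_per T"
  have c: "continuous_on {-T..T} \<eta>" "continuous_on {-T..T} (vderiv \<eta>)"
    using \<eta> by (auto intro: test_per_continuous test_per_vderiv)
  have "(LINT x:{-T..T}|lebesgue. g x * vderiv \<eta> x) = (LINT x:{-T..T}|lebesgue. f x * vderiv \<eta> x)"
    by (rule set_integral_cong_AE_interval) (use e(1) in \<open>auto intro!: integrable_mult_continuous i c elim: eventually_mono\<close>)
  also have "\<dots> = - (LINT x:{-T..T}|lebesgue. f' x * \<eta> x)" using w \<eta> by (simp add: is_weak_deriv_def)
  also have "(LINT x:{-T..T}|lebesgue. f' x * \<eta> x) = (LINT x:{-T..T}|lebesgue. g' x * \<eta> x)"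
    by (rule set_integral_cong_AE_interval) (use e(2) in \<open>auto intro!: integrable_mult_continuous i c elim: eventually_mono\<close>)
  finally show "(LINT x:{-T..T}|lebesgue. g x * vderiv \<eta> x) = - (LINT x:{-T..T}|lebesgue. g' x * \<eta> x)" .
qed

lemma is_weak_deriv_unique:
  assumes T: "T > 0" and "is_weak_deriv T f g" "is_weak_deriv T f h" "g \<in> L2_per T" "h \<in> L2_per T"
  shows "AE x in lebesgue. x \<in> {-T..T} \<longrightarrow> g x = h x"
proof -
  have "AE x in lebesgue. x \<in> {-T..T} \<longrightarrow> g x - h x = 0"
  proof (rule test_per_fundamental[OF T])
    show "set_integrable lebesgue {-T..T} (\<lambda>x. g x - h x)"
      using assms by (intro set_integral_diff L2_per_set_integrable)
    fix \<eta> assume \<eta>: "\<eta> \<in> test_per T"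
    then have "(LINT x:{-T..T}|lebesgue. g x * \<eta> x) = (LINT x:{-T..T}|lebesgue. h x * \<eta> x)"
      using assms(2,3) unfolding is_weak_deriv_def by (metis neg_equal_iff_equal)
    then show "(LINT x:{-T..T}|lebesgue. (g x - h x) * \<eta> x) = 0"
      using L2_per_mult_test(1)[OF assms(4) \<eta>] L2_per_mult_test(1)[OF assms(5) \<eta>]
      by (simp add: left_diff_distrib set_integral_diff)
  qed
  then show ?thesis by simp
qed

lemma wderiv_weak_deriv:
  assumes "g \<in> L2_per T" "is_weak_deriv T f g"
  shows "wderiv T f \<in> L2_per T" "is_weak_deriv T f (wderiv T f)"
  using someI[of "\<lambda>g. g \<in> L2_per T \<and> is_weak_deriv T f g" g] assms by (auto simp: wderiv_def)

lemma H_per_1: 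
  assumes "f \<in> H_per 1 T"
  shows "f \<in> L2_per T" "wderiv T f \<in> L2_per T" "is_weak_deriv T f (wderiv T f)"
  using assms wderiv_weak_deriv by auto

text \<open>The function \<open>wderiv T f\<close> is an arbitrary choice, not the witness
  \<open>g\<close> from \<open>H_per\<close>. It agrees with \<open>g\<close> almost everywhere on
  the period by uniqueness, and so inherits the weak derivative of \<open>g\<close>.\<close>

lemma H_per_2:
  assumes T: "T > 0" and "f \<in> H_per 2 T"
  shows "f \<in> L2_per T" "wderiv T f \<in> L2_per T" "is_weak_deriv T f (wderiv T f)"
    "wderiv T (wderiv T f) \<in> L2_per T" "is_weak_deriv T (wderiv T f) (wderiv T (wderiv T f))"
proof -
  obtain g h where g: "f \<in> L2_per T" "g \<in> L2_per T" "h \<in> L2_per T" "is_weak_deriv T f g" "is_weak_deriv T g h"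
    using assms(2) by (auto simp: numeral_2_eq_2)
  note w = wderiv_weak_deriv[OF g(2) g(4)]
  show "f \<in> L2_per T" "wderiv T f \<in> L2_per T" "is_weak_deriv T f (wderiv T f)" using g w by auto
  have "is_weak_deriv T (wderiv T f) h"
    by (rule is_weak_deriv_cong[OF _ _ _ _ is_weak_deriv_unique[OF T g(4) w(2) g(2) w(1)] _ g(5)])
       (use g w in \<open>auto intro: L2_per_set_integrable\<close>)
  from wderiv_weak_deriv[OF g(3) this] 
  show "wderiv T (wderiv T f) \<in> L2_per T" "is_weak_deriv T (wderiv T f) (wderiv T (wderiv T f))" .
qed

section \<open>Continuous and continuously differentiable representatives\<close>

lemma continuous_AE_eq:
  fixes F G :: "real \<Rightarrow> complex"
  assumes T: "T > 0" and c: "continuous_on {-T..T} F" "continuous_on {-T..T} G"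
    and e: "AE x in lebesgue. x \<in> {-T..T} \<longrightarrow> F x = G x" and x: "x \<in> {-T..T}"
  shows "F x = G x"
proof -
  have c': "continuous_on {-T..T} (\<lambda>x. cmod (F x - G x))" by (intro continuous_intros c)
  have "(LINT x:{-T..T}|lebesgue. cmod (F x - G x)) = 0"
    unfolding set_lebesgue_integral_def using e by (intro integral_eq_zero_AE) (auto elim!: eventually_mono split: split_indicator)
  then have "integral {-T..T} (\<lambda>x. cmod (F x - G x)) = 0"
    using set_lebesgue_integral_eq_integral(2)[OF absolutely_integrable_continuous_real[OF c']] by simp
  then show ?thesis
    using integral_eq_0_iff[OF c'] T x by simp
qed

text \<open>The representative is the primitive of \<open>g\<close>; its end values agree because
  \<open>g\<close> has integral zero.\<close>

lemma weak_deriv_continuous_rep: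
  assumes T: "T > 0" and fg: "f \<in> L2_per T" "g \<in> L2_per T" and w: "is_weak_deriv T f g"
  obtains F where "AE x in lebesgue. x \<in> {-T..T} \<longrightarrow> f x = F x" "continuous_on {-T..T} F" "F (-T) = F T"
proof -
  note i = fg[THEN L2_per_set_integrable]
  obtain C where C: "AE x in lebesgue. x \<in> {-T..T} \<longrightarrow> f x = C + integral {-T..x} g" "integral {-T..T} g = 0"
    using weak_deriv_primitive[OF T i w] by blast
  show thesis
  proof (rule that[OF C(1)])
    show "continuous_on {-T..T} (\<lambda>x. C + integral {-T..x} g)"
      by (intro continuous_intros indefinite_integral_continuous_1 set_lebesgue_integral_eq_integral(1)[OF i(2)])
  qed (use C(2) in simp)
qed

text \<open>Bootstrap step: with a continuous representative \<open>G\<close> of the weak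
  derivative, the primitive of \<open>G\<close> is differentiable in the classical sense.\<close>

lemma weak_deriv_C1_rep:
  assumes T: "T > 0" and fg: "f \<in> L2_per T" "g \<in> L2_per T" and w: "is_weak_deriv T f g"
    and G: "AE x in lebesgue. x \<in> {-T..T} \<longrightarrow> g x = G x" "continuous_on {-T..T} G"
  obtains F where "AE x in lebesgue. x \<in> {-T..T} \<longrightarrow> f x = F x" "continuous_on {-T..T} F" "F (-T) = F T"
    "\<And>x. x \<in> {-T..T} \<Longrightarrow> (F has_vector_derivative G x) (at x within {-T..T})"
proof -
  note i = fg[THEN L2_per_set_integrable]
  have Gi: "set_integrable lebesgue {-T..T} G" using G(2) by (rule absolutely_integrable_continuous_real)
  have "is_weak_deriv T f G"
    by (rule is_weak_deriv_cong[OF i(1) i(1) i(2) Gi _ G(1) w]) simp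
  then obtain C where C: "AE x in lebesgue. x \<in> {-T..T} \<longrightarrow> f x = C + integral {-T..x} G" "integral {-T..T} G = 0"
    using weak_deriv_primitive[OF T i(1) Gi] by blast
  show thesis
  proof (rule that[OF C(1)])
    show d: "((\<lambda>x. C + integral {-T..x} G) has_vector_derivative G x) (at x within {-T..T})" if "x \<in> {-T..T}" for x
      using integral_has_vector_derivative[OF G(2) that] by (auto intro!: derivative_eq_intros)
    then show "continuous_on {-T..T} (\<lambda>x. C + integral {-T..x} G)" by (rule continuous_on_vector_derivative)
  qed (use C(2) in simp)
qed

lemma C1_is_weak_deriv:
  assumes T: "T > 0" and d: "\<And>x. x \<in> {-T..T} \<Longrightarrow> (F has_vector_derivative G x) (at x within {-T..T})"
    and G: "continuous_on {-T..T} G" and e: "F (-T) = F T"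
  shows "is_weak_deriv T F G"
  unfolding is_weak_deriv_def
proof
  fix \<eta> assume \<eta>: "\<eta> \<in> test_per T"
  have c: "continuous_on {-T..T} \<eta>" "continuous_on {-T..T} (vderiv \<eta>)"
    using \<eta> by (auto intro: test_per_continuous test_per_vderiv)
  have Fc: "continuous_on {-T..T} F" using d by (rule continuous_on_vector_derivative)
  have per: "\<eta> (-T) = \<eta> T" using \<eta> unfolding test_per_iff periodic_def by (metis add.commute add_minus_cancel mult_2)
  have "((\<lambda>x. F x * \<eta> x) has_vector_derivative (F x * vderiv \<eta> x + G x * \<eta> x)) (at x within {-T..T})" if "x \<in> {-T..T}" for x
    by (rule has_vector_derivative_mult[OF d[OF that] has_vector_derivative_at_within[OF test_per_derivative[OF \<eta>]]])
  then have "((\<lambda>x. F x * vderiv \<eta> x + G x * \<eta> x) has_integral (F T * \<eta> T - F (-T) * \<eta> (-T))) {-T..T}"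
    using T by (intro fundamental_theorem_of_calculus) auto
  then have z: "integral {-T..T} (\<lambda>x. F x * vderiv \<eta> x + G x * \<eta> x) = 0"
    using e per by (simp add: integral_unique)
  have i: "set_integrable lebesgue {-T..T} (\<lambda>x. F x * vderiv \<eta> x)" "set_integrable lebesgue {-T..T} (\<lambda>x. G x * \<eta> x)"
    by (intro absolutely_integrable_continuous_real continuous_intros c Fc G)+
  have "(LINT x:{-T..T}|lebesgue. F x * vderiv \<eta> x + G x * \<eta> x) = 0"
    using set_lebesgue_integral_eq_integral(2)[OF set_integral_add(1)[OF i]] z by simp
  then show "(LINT x:{-T..T}|lebesgue. F x * vderiv \<eta> x) = - (LINT x:{-T..T}|lebesgue. G x * \<eta> x)"
    using set_integral_add(2)[OF i] by (simp add: eq_neg_iff_add_eq_0)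
qed

text \<open>The exceptional set is covered by countably many translates of its part in one period,
  each of them null.\<close>

lemma AE_periodic:
  assumes T: "T > 0" and e: "AE x in lebesgue. x \<in> {-T..T} \<longrightarrow> f x = 0" and p: "periodic (2 * T) (f :: real \<Rightarrow> complex)"
  shows "AE x in lebesgue. f x = 0"
proof -
  let ?N = "{x \<in> {-T..T}. f x \<noteq> 0}"
  have N: "negligible ?N"
    using e unfolding negligible_iff_null_sets completion.AE_iff_null_sets by (auto simp: completion.AE_iff_null_sets Collect_conj_eq elim: back_subst[of "\<lambda>A. A \<in> null_sets lebesgue"])
  have pn: "f (x + 2 * T * of_nat n) = f x" for x and n :: nat
  proof (induction n)
    case (Suc n)
    have "f (x + 2 * T * of_nat (Suc n)) = f ((x + 2 * T * of_nat n) + 2 * T)" by (simp add: algebra_simps)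
    then show ?case using p Suc by (simp add: periodic_def)
  qed simp
  have pi: "f (x + 2 * T * of_int k) = f x" for x and k :: int
  proof (cases "k \<ge> 0")
    case True
    then show ?thesis using pn[of x "nat k"] by simp
  next
    case False
    then show ?thesis using pn[of "x + 2 * T * of_int k" "nat (-k)"] by (simp add: algebra_simps)
  qed
  have "{x. f x \<noteq> 0} \<subseteq> (\<Union>k::int. (+) (2 * T * of_int k) ` ?N)"
  proof
    fix x assume x: "x \<in> {x. f x \<noteq> 0}"
    define k where "k = \<lfloor>(x + T) / (2 * T)\<rfloor>"
    have "of_int k \<le> (x + T) / (2 * T)" "(x + T) / (2 * T) < of_int k + 1" unfolding k_def by linarith+
    then have "x - 2 * T * of_int k \<in> {-T..T}" using T by (auto simp: field_simps)
    moreover have "f (x - 2 * T * of_int k) \<noteq> 0" using x pi[of x "- k"] by simp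
    ultimately show "x \<in> (\<Union>k::int. (+) (2 * T * of_int k) ` ?N)"
      by (intro UN_I[of k] image_eqI[of _ _ "x - 2 * T * of_int k"]) auto
  qed
  moreover have "negligible (\<Union>k::int. (+) (2 * T * of_int k) ` ?N)"
  proof (rule negligible_countable_Union)
    have "negligible ((+) a ` ?N)" for a by (rule negligible_translation[OF N])
    then show "negligible S" if "S \<in> range (\<lambda>k::int. (+) (2 * T * of_int k) ` ?N)" for S
      using that by blast
  qed simp
  ultimately have "negligible {x. f x \<noteq> 0}" by (rule negligible_subset[rotated])
  then show ?thesis by (simp add: completion.AE_iff_null_sets negligible_iff_null_sets)
qed

text \<open>Elliptic regularity by bootstrapping. All four components have continuous
  representatives, and the eigenvalue equation expresses the second derivatives of
  \<open>p1\<close>, \<open>p2\<close> and the first derivatives of the two combinations of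
  \<open>p1\<close>, \<open>q\<close>, \<open>h\<close> inside \<open>op_J\<close> through them.
  These derivatives are therefore continuous and classical.\<close>

lemma eigenfunction_regularity:
  fixes \<phi> \<phi>' :: "real \<Rightarrow> real" and p1 p2 q h :: "real \<Rightarrow> complex"
  assumes T: "T > 0" and c: "1 - c\<^sup>2 > 0"
    and per: "periodic (2 * T) \<phi>"
    and d: "\<And>x. (\<phi> has_real_derivative \<phi>' x) (at x)" and d': "continuous_on UNIV \<phi>'"
    and U: "(p2, p1, q, h) \<in> dom_JH T"
    and eig: "ae_eq4 (op_J T (op_H T c \<sigma> \<phi> (p2, p1, q, h))) (scale4 \<mu> (p2, p1, q, h))"
    and Vdef: "V = (\<lambda>x. \<sigma> - (\<phi> x)\<^sup>2 / (2 * (1 - c\<^sup>2)))"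
  obtains P1 P2 D1 D2 Q H :: "real \<Rightarrow> complex" where
    "AE x in lebesgue. x \<in> {-T..T} \<longrightarrow> p1 x = P1 x" "AE x in lebesgue. x \<in> {-T..T} \<longrightarrow> p2 x = P2 x"
    "AE x in lebesgue. x \<in> {-T..T} \<longrightarrow> q x = Q x" "AE x in lebesgue. x \<in> {-T..T} \<longrightarrow> h x = H x"
    "continuous_on {-T..T} Q" "continuous_on {-T..T} H"
    "P1 (-T) = P1 T" "P2 (-T) = P2 T" "D1 (-T) = D1 T" "D2 (-T) = D2 T" "Q (-T) = Q T" "H (-T) = H T"
    "\<And>x. x \<in> {-T..T} \<Longrightarrow> (P1 has_vector_derivative D1 x) (at x within {-T..T})"
    "\<And>x. x \<in> {-T..T} \<Longrightarrow> (P2 has_vector_derivative D2 x) (at x within {-T..T})"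
    "\<And>x. x \<in> {-T..T} \<Longrightarrow> (D1 has_vector_derivative \<mu> * P2 x + of_real (V x) * P1 x + of_real (\<phi> x) * Q x) (at x within {-T..T})"
    "\<And>x. x \<in> {-T..T} \<Longrightarrow> (D2 has_vector_derivative of_real (V x) * P2 x - \<mu> * P1 x) (at x within {-T..T})"
    "\<And>x. x \<in> {-T..T} \<Longrightarrow> ((\<lambda>x. H x - of_real c * Q x) has_vector_derivative - \<mu> * Q x) (at x within {-T..T})"
    "\<And>x. x \<in> {-T..T} \<Longrightarrow> ((\<lambda>x. of_real (\<phi> x) * P1 x + Q x - of_real c * H x) has_vector_derivative - \<mu> * H x) (at x within {-T..T})"
proof -
  note H1 = H_per_1 and H2 = H_per_2[OF T]
  have dom: "p2 \<in> H_per 2 T" "p1 \<in> H_per 2 T" "q \<in> H_per 1 T" "h \<in> H_per 1 T"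
    using U by (auto simp: dom_JH_def H1_mean0_def)
  note p1 = H2[OF dom(2)] and p2 = H2[OF dom(1)] and q = H1[OF dom(3)] and h = H1[OF dom(4)]
  obtain P1 where P1: "AE x in lebesgue. x \<in> {-T..T} \<longrightarrow> p1 x = P1 x" "continuous_on {-T..T} P1" "P1 (-T) = P1 T"
    using weak_deriv_continuous_rep[OF T p1(1-3)] by blast
  obtain P2 where P2: "AE x in lebesgue. x \<in> {-T..T} \<longrightarrow> p2 x = P2 x" "continuous_on {-T..T} P2" "P2 (-T) = P2 T"
    using weak_deriv_continuous_rep[OF T p2(1-3)] by blast
  obtain Q where Q: "AE x in lebesgue. x \<in> {-T..T} \<longrightarrow> q x = Q x" "continuous_on {-T..T} Q" "Q (-T) = Q T"
    using weak_deriv_continuous_rep[OF T q] by blast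
  obtain H where H: "AE x in lebesgue. x \<in> {-T..T} \<longrightarrow> h x = H x" "continuous_on {-T..T} H" "H (-T) = H T"
    using weak_deriv_continuous_rep[OF T h] by blast
  have \<phi>c: "continuous_on S \<phi>" for S
    using d by (meson DERIV_isCont continuous_at_imp_continuous_on)
  have Vc: "continuous_on S V" for S unfolding Vdef by (intro continuous_intros \<phi>c) (use c in auto)
  have \<phi>T: "\<phi> (-T) = \<phi> T" using per unfolding periodic_def by (metis add.commute add_minus_cancel mult_2)
  define f1 where "f1 = (\<lambda>x. - of_real c * q x + h x)"
  define f2 where "f2 = (\<lambda>x. of_real (\<phi> x) * p1 x + q x - of_real c * h x)"
  have E: "AE x in lebesgue. - (L_minus T c \<sigma> \<phi> p1 x + of_real (\<phi> x) * q x) = \<mu> * p2 x"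
    "AE x in lebesgue. L_minus T c \<sigma> \<phi> p2 x = \<mu> * p1 x"
    "AE x in lebesgue. - wderiv T f1 x = \<mu> * q x"
    "AE x in lebesgue. - wderiv T f2 x = \<mu> * h x"
    using eig unfolding ae_eq4_def op_J_def op_H_def scale4_def f1_def f2_def by (auto elim: eventually_mono)
  have V: "V x = \<sigma> - (\<phi> x)\<^sup>2 / (2 * (1 - c\<^sup>2))" for x by (simp add: Vdef)

  have "AE x in lebesgue. x \<in> {-T..T} \<longrightarrow> wderiv T (wderiv T p1) x = \<mu> * P2 x + of_real (V x) * P1 x + of_real (\<phi> x) * Q x"
    using E(1) P1(1) P2(1) Q(1)
    by eventually_elim (auto simp: L_minus_def V algebra_simps)
  then obtain D1 where D1: "AE x in lebesgue. x \<in> {-T..T} \<longrightarrow> wderiv T p1 x = D1 x" "continuous_on {-T..T} D1" "D1 (-T) = D1 T"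
     "\<And>x. x \<in> {-T..T} \<Longrightarrow> (D1 has_vector_derivative \<mu> * P2 x + of_real (V x) * P1 x + of_real (\<phi> x) * Q x) (at x within {-T..T})"
    by (rule weak_deriv_C1_rep[OF T p1(2,4,5)]) (auto intro!: continuous_intros P1 P2 Q Vc \<phi>c)
  have "AE x in lebesgue. x \<in> {-T..T} \<longrightarrow> wderiv T (wderiv T p2) x = of_real (V x) * P2 x - \<mu> * P1 x"
    using E(2) P1(1) P2(1)
    by eventually_elim (auto simp: L_minus_def V algebra_simps)
  then obtain D2 where D2: "AE x in lebesgue. x \<in> {-T..T} \<longrightarrow> wderiv T p2 x = D2 x" "continuous_on {-T..T} D2" "D2 (-T) = D2 T"
     "\<And>x. x \<in> {-T..T} \<Longrightarrow> (D2 has_vector_derivative of_real (V x) * P2 x - \<mu> * P1 x) (at x within {-T..T})"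
    by (rule weak_deriv_C1_rep[OF T p2(2,4,5)]) (auto intro!: continuous_intros P1 P2 Q Vc \<phi>c)

  \<comment> \<open>The continuous representative \<open>P\<close> agrees almost everywhere with a
    primitive of \<open>D\<close>, hence everywhere on the period by continuity.\<close>
  have C1: "(P has_vector_derivative D x) (at x within {-T..T})"
    if L: "p \<in> L2_per T" "wderiv T p \<in> L2_per T" "is_weak_deriv T p (wderiv T p)"
      and P: "AE x in lebesgue. x \<in> {-T..T} \<longrightarrow> p x = P x" "continuous_on {-T..T} P"
      and D: "AE x in lebesgue. x \<in> {-T..T} \<longrightarrow> wderiv T p x = D x" "continuous_on {-T..T} D"
      and x: "x \<in> {-T..T}" for p P D x
  proof -
    obtain F where F: "AE x in lebesgue. x \<in> {-T..T} \<longrightarrow> p x = F x" "continuous_on {-T..T} F" 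
      "\<And>x. x \<in> {-T..T} \<Longrightarrow> (F has_vector_derivative D x) (at x within {-T..T})"
      using weak_deriv_C1_rep[OF T L D] by blast
    have "AE x in lebesgue. x \<in> {-T..T} \<longrightarrow> F x = P x" using F(1) P(1) by eventually_elim auto
    then have "F y = P y" if "y \<in> {-T..T}" for y using continuous_AE_eq[OF T F(2) P(2)] that by blast
    then show ?thesis by (intro has_vector_derivative_transform[OF x _ F(3)[OF x]]) auto
  qed
  have dP1: "\<And>x. x \<in> {-T..T} \<Longrightarrow> (P1 has_vector_derivative D1 x) (at x within {-T..T})"
    by (rule C1[OF p1(1-3) P1(1,2) D1(1,2)])
  have dP2: "\<And>x. x \<in> {-T..T} \<Longrightarrow> (P2 has_vector_derivative D2 x) (at x within {-T..T})"
    by (rule C1[OF p2(1-3) P2(1,2) D2(1,2)])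

  have phic: "continuous_on UNIV (\<lambda>x. complex_of_real (\<phi> x))" "continuous_on UNIV (\<lambda>x. complex_of_real (\<phi>' x))"
    by (intro continuous_on_of_real \<phi>c d')+
  have per': "periodic (2 * T) \<phi>'"
    unfolding periodic_def
  proof
    fix x
    have "((\<lambda>x. \<phi> (x + 2 * T)) has_real_derivative \<phi>' (x + 2 * T)) (at x)"
      using DERIV_shift[of \<phi> "\<phi>' (x + 2 * T)" x "2 * T"] d by simp
    moreover have "(\<lambda>x. \<phi> (x + 2 * T)) = \<phi>" using per by (auto simp: periodic_def)
    ultimately show "\<phi>' (x + 2 * T) = \<phi>' x" using d DERIV_unique by metis
  qed
  have perc: "periodic (2 * T) (\<lambda>x. complex_of_real (\<phi> x))" "periodic (2 * T) (\<lambda>x. complex_of_real (\<phi>' x))"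
    using per per' by (auto simp: periodic_def)

  \<comment> \<open>\<open>op_J\<close> applies \<open>wderiv\<close> to a combination, and this
    choice is meaningful only after some weak derivative in \<open>L2_per\<close> has been
    exhibited.\<close>
  have f1: "f1 \<in> L2_per T" "is_weak_deriv T f1 (\<lambda>x. - of_real c * wderiv T q x + wderiv T h x)"
    "(\<lambda>x. - of_real c * wderiv T q x + wderiv T h x) \<in> L2_per T"
    unfolding f1_def by (intro L2_per_add L2_per_cmult is_weak_deriv_add is_weak_deriv_cmult q h)+
  note w1 = wderiv_weak_deriv[OF f1(3,2)]
  \<comment> \<open>The product rule for \<open>\<phi> * p1\<close> is classical for the
    representatives \<open>P1\<close>, \<open>D1\<close>, and is then transferred to
    \<open>p1\<close> and \<open>wderiv T p1\<close>.\<close>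
  have "is_weak_deriv T (\<lambda>x. of_real (\<phi> x) * P1 x) (\<lambda>x. of_real (\<phi>' x) * P1 x + of_real (\<phi> x) * D1 x)"
  proof (rule C1_is_weak_deriv[OF T])
    fix x assume x: "x \<in> {-T..T}"
    have "((\<lambda>x. complex_of_real (\<phi> x)) has_vector_derivative of_real (\<phi>' x)) (at x within {-T..T})"
      using d by (intro has_vector_derivative_of_real) (rule has_field_derivative_at_within)
    from has_vector_derivative_mult[OF this dP1[OF x]]
    show "((\<lambda>x. of_real (\<phi> x) * P1 x) has_vector_derivative of_real (\<phi>' x) * P1 x + of_real (\<phi> x) * D1 x) (at x within {-T..T})"
      by (simp add: add.commute)
  qed (auto intro!: continuous_intros continuous_on_subset[OF phic(1)] continuous_on_subset[OF phic(2)] P1 D1 simp: \<phi>T P1(3))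
  moreover have L: "(\<lambda>x. of_real (\<phi> x) * p1 x) \<in> L2_per T" "(\<lambda>x. of_real (\<phi>' x) * p1 x + of_real (\<phi> x) * wderiv T p1 x) \<in> L2_per T"
    by (intro L2_per_add L2_per_mult p1 perc phic)+
  moreover have "set_integrable lebesgue {-T..T} (\<lambda>x. of_real (\<phi> x) * P1 x)"
    "set_integrable lebesgue {-T..T} (\<lambda>x. of_real (\<phi>' x) * P1 x + of_real (\<phi> x) * D1 x)"
    by (intro absolutely_integrable_continuous_real continuous_intros P1 D1
        continuous_on_subset[OF phic(1)] continuous_on_subset[OF phic(2)] subset_UNIV)+
  moreover have "AE x in lebesgue. x \<in> {-T..T} \<longrightarrow> of_real (\<phi> x) * P1 x = of_real (\<phi> x) * p1 x"
    using P1(1) by eventually_elim auto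
  moreover have "AE x in lebesgue. x \<in> {-T..T} \<longrightarrow>
      of_real (\<phi>' x) * P1 x + of_real (\<phi> x) * D1 x = of_real (\<phi>' x) * p1 x + of_real (\<phi> x) * wderiv T p1 x"
    using P1(1) D1(1) by eventually_elim auto
  ultimately have w: "is_weak_deriv T (\<lambda>x. of_real (\<phi> x) * p1 x) (\<lambda>x. of_real (\<phi>' x) * p1 x + of_real (\<phi> x) * wderiv T p1 x)"
    using L2_per_set_integrable by (blast intro: is_weak_deriv_cong)
  let ?g2 = "\<lambda>x. ((of_real (\<phi>' x) * p1 x + of_real (\<phi> x) * wderiv T p1 x) + wderiv T q x) + (- of_real c) * wderiv T h x"
  have f2eq: "f2 = (\<lambda>x. (of_real (\<phi> x) * p1 x + q x) + (- of_real c) * h x)" by (simp add: f2_def)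
  have f2: "f2 \<in> L2_per T" "is_weak_deriv T f2 ?g2" "?g2 \<in> L2_per T"
    unfolding f2eq by (intro L2_per_add[OF L2_per_add L2_per_cmult] is_weak_deriv_add is_weak_deriv_cmult L2_per_add L2_per_cmult w L q h)+
  note w2 = wderiv_weak_deriv[OF f2(3,2)]

  have "AE x in lebesgue. x \<in> {-T..T} \<longrightarrow> wderiv T f1 x = - \<mu> * Q x"
    using E(3) Q(1) by eventually_elim (auto simp: neg_eq_iff_add_eq_0 eq_neg_iff_add_eq_0)
  then obtain N1 where N1: "AE x in lebesgue. x \<in> {-T..T} \<longrightarrow> f1 x = N1 x" "continuous_on {-T..T} N1"
     "\<And>x. x \<in> {-T..T} \<Longrightarrow> (N1 has_vector_derivative - \<mu> * Q x) (at x within {-T..T})"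
    by (rule weak_deriv_C1_rep[OF T f1(1) w1]) (auto intro!: continuous_intros Q)
  have "AE x in lebesgue. x \<in> {-T..T} \<longrightarrow> wderiv T f2 x = - \<mu> * H x"
    using E(4) H(1) by eventually_elim (auto simp: neg_eq_iff_add_eq_0 eq_neg_iff_add_eq_0)
  then obtain N2 where N2: "AE x in lebesgue. x \<in> {-T..T} \<longrightarrow> f2 x = N2 x" "continuous_on {-T..T} N2"
     "\<And>x. x \<in> {-T..T} \<Longrightarrow> (N2 has_vector_derivative - \<mu> * H x) (at x within {-T..T})"
    by (rule weak_deriv_C1_rep[OF T f2(1) w2]) (auto intro!: continuous_intros H)
  have N1e: "N1 x = H x - of_real c * Q x" if "x \<in> {-T..T}" for x
  proof (rule continuous_AE_eq[OF T N1(2) _ _ that])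
    show "AE x in lebesgue. x \<in> {-T..T} \<longrightarrow> N1 x = H x - of_real c * Q x"
      using N1(1) Q(1) H(1) by eventually_elim (auto simp: f1_def)
  qed (intro continuous_intros Q H)
  have N2e: "N2 x = of_real (\<phi> x) * P1 x + Q x - of_real c * H x" if "x \<in> {-T..T}" for x
  proof (rule continuous_AE_eq[OF T N2(2) _ _ that])
    show "AE x in lebesgue. x \<in> {-T..T} \<longrightarrow> N2 x = of_real (\<phi> x) * P1 x + Q x - of_real c * H x"
      using N2(1) Q(1) H(1) P1(1) by eventually_elim (auto simp: f2_def)
  qed (intro continuous_intros Q H P1 continuous_on_subset[OF phic(1)]; simp)
  have dN1: "((\<lambda>x. H x - of_real c * Q x) has_vector_derivative - \<mu> * Q x) (at x within {-T..T})" if "x \<in> {-T..T}" for x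
    by (rule has_vector_derivative_transform[OF that _ N1(3)[OF that]]) (simp add: N1e)
  have dN2: "((\<lambda>x. of_real (\<phi> x) * P1 x + Q x - of_real c * H x) has_vector_derivative - \<mu> * H x) (at x within {-T..T})" if "x \<in> {-T..T}" for x
    by (rule has_vector_derivative_transform[OF that _ N2(3)[OF that]]) (simp add: N2e)
  show thesis
    by (rule that[OF P1(1) P2(1) Q(1) H(1) Q(2) H(2) P1(3) P2(3) D1(3) D2(3) Q(3) H(3) dP1 dP2 D1(4) D2(4) dN1 dN2])
qed

section \<open>Nonnegativity of the linearised operator on the complement of the profile\<close>

text \<open>A squared zero in the numerator dominates the simple zero of the denominator: after
  dividing \<open>q\<close> and \<open>f\<close> by \<open>x - x0\<close>, one factor
  \<open>q\<close> is left and forces the limit 0, which is also the value at \<open>x0\<close>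
  since \<open>x / 0 = 0\<close>.\<close>

lemma isCont_square_divide:
  fixes q f k :: "real \<Rightarrow> real"
  assumes "(q has_real_derivative a) (at x0)" "(f has_real_derivative b) (at x0)" "b \<noteq> 0"
    "q x0 = 0" "f x0 = 0" "isCont k x0"
  shows "isCont (\<lambda>x. (q x)\<^sup>2 * k x / f x) x0"
proof -
  have q: "((\<lambda>x. q x / (x - x0)) \<longlongrightarrow> a) (at x0)" and f: "((\<lambda>x. f x / (x - x0)) \<longlongrightarrow> b) (at x0)"
    using assms by (simp_all add: has_field_derivative_iff)
  have q0: "(q \<longlongrightarrow> 0) (at x0)" using DERIV_isCont[OF assms(1)] assms(4) by (simp add: isCont_def)
  have k: "(k \<longlongrightarrow> k x0) (at x0)" using assms(6) by (simp add: isCont_def)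
  have "((\<lambda>x. q x * ((q x / (x - x0)) / (f x / (x - x0))) * k x) \<longlongrightarrow> 0 * (a / b) * k x0) (at x0)"
    by (intro tendsto_mult tendsto_divide q f q0 k assms(3))
  then have "((\<lambda>x. q x * ((q x / (x - x0)) / (f x / (x - x0))) * k x) \<longlongrightarrow> 0) (at x0)" by simp
  moreover have "eventually (\<lambda>x. q x * ((q x / (x - x0)) / (f x / (x - x0))) * k x = (q x)\<^sup>2 * k x / f x) (at x0)"
    unfolding eventually_at by (rule exI[of _ 1]) (auto simp: power2_eq_square)
  ultimately have "((\<lambda>x. (q x)\<^sup>2 * k x / f x) \<longlongrightarrow> 0) (at x0)"
    by (rule Lim_transform_eventually)
  then show ?thesis using assms(4,5) by (simp add: isCont_def)
qed

text \<open>The spectral argument uses only this ODE description, without elliptic functions. Here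
  \<open>s\<close> stands for \<sigma>, \<open>g\<close> for
  \<open>1 / (2 * (1 - c\<^sup>2))\<close>, and \<rho> is the constant of the first integral;
  \<open>disc\<close> says that \<open>g * z\<^sup>2 / 2 - s * z + \<rho>\<close> has two distinct
  real roots \<open>z\<close>.\<close>

locale dnoidal_profile =
  fixes \<phi> \<phi>' :: "real \<Rightarrow> real" and s g \<rho> T :: real
  assumes T: "T > 0" and s: "s > 0" and g: "g > 0" and rho: "\<rho> > 0" and disc: "2 * \<rho> * g < s\<^sup>2"
    and pos: "\<And>x. \<phi> x > 0"
    and d1: "\<And>x. (\<phi> has_real_derivative \<phi>' x) (at x)"
    and d2: "\<And>x. (\<phi>' has_real_derivative s * \<phi> x - g * \<phi> x ^ 3) (at x)"
    and energy: "\<And>x. (\<phi>' x)\<^sup>2 = s * (\<phi> x)\<^sup>2 - g * \<phi> x ^ 4 / 2 - \<rho>"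
    and even: "\<And>x. \<phi> (- x) = \<phi> x"
    and periodic: "\<And>x. \<phi> (x + 2 * T) = \<phi> x"
    and decr: "\<And>x. 0 < x \<Longrightarrow> x < T \<Longrightarrow> \<phi>' x < 0"
begin

text \<open>The potential of \<open>\<L>\<^sub>+\<close>.\<close>

definition V :: "real \<Rightarrow> real" where "V x = s - 3 * g * (\<phi> x)\<^sup>2"

lemma cont: "continuous_on S \<phi>" "continuous_on S \<phi>'"
  by (intro continuous_at_imp_continuous_on ballI DERIV_isCont[OF d1] DERIV_isCont[OF d2])+

lemma contV: "continuous_on S V"
  unfolding V_def by (intro continuous_intros cont)

lemma odd: "\<phi>' (- x) = - \<phi>' x"
proof -
  have "((\<lambda>x. \<phi> (- x)) has_real_derivative - \<phi>' (- x)) (at x)"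
    by (rule DERIV_chain'[OF _ d1, of "\<lambda>x. - x" "-1", simplified]) (auto intro!: derivative_eq_intros)
  then have "(\<phi> has_real_derivative - \<phi>' (- x)) (at x)" by (simp only: even)
  from DERIV_unique[OF this d1] show ?thesis by simp
qed

lemma periodic': "\<phi>' (x + 2 * T) = \<phi>' x"
proof -
  have "((\<lambda>x. \<phi> (x + 2 * T)) has_real_derivative \<phi>' (x + 2 * T)) (at x)"
    using DERIV_shift[of \<phi> "\<phi>' (x + 2 * T)" x "2 * T"] d1 by simp
  then have "(\<phi> has_real_derivative \<phi>' (x + 2 * T)) (at x)" by (simp only: periodic)
  from DERIV_unique[OF this d1] show ?thesis .
qed

lemma ends: "\<phi>' 0 = 0" "\<phi>' T = 0" "\<phi>' (- T) = 0" "\<phi> (- T) = \<phi> T"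
proof -
  show "\<phi>' 0 = 0" using odd[of 0] by simp
  show "\<phi>' T = 0" using odd[of T] periodic'[of "- T"] by simp
  then show "\<phi>' (- T) = 0" using odd[of T] by simp
  show "\<phi> (- T) = \<phi> T" by (rule even)
qed

lemma strict_decr: 
  assumes "0 \<le> x" "x < y" "y \<le> T"
  shows "\<phi> y < \<phi> x"
proof (rule DERIV_neg_imp_decreasing_open[OF assms(2)])
  show "\<exists>D. (\<phi> has_real_derivative D) (at z) \<and> D < 0" if "x < z" "z < y" for z
    using d1[of z] decr[of z] that assms by auto
qed (rule cont)

subsection \<open>An eigenfunction with two zeros per period\<close>

text \<open>Requiring \<open>- f'' + V * f = e2 * f\<close> for
  \<open>f = \<phi>\<^sup>2 - r\<close> and comparing powers of \<phi> gives
  \<open>3 * g * r = e2 + 3 * s\<close> and \<open>s * r - 2 * \<rho> = e2 * r\<close>. Eliminating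
  \<open>r\<close> leaves a quadratic equation for \<open>e2\<close>, of which this is the larger
  root; \<open>disc\<close> makes it positive.\<close>

definition e2 :: real where "e2 = sqrt (4 * s\<^sup>2 - 6 * \<rho> * g) - s"
definition r :: real where "r = (e2 + 3 * s) / (3 * g)"

lemma e2_pos: "e2 > 0"
proof -
  have "s < sqrt (4 * s\<^sup>2 - 6 * \<rho> * g)" using disc s by (intro real_less_rsqrt) (auto simp: algebra_simps)
  then show ?thesis by (simp add: e2_def)
qed

lemma e2_quadratic: "e2\<^sup>2 + 2 * s * e2 = 3 * s\<^sup>2 - 6 * \<rho> * g"
proof -
  have "6 * \<rho> * g \<le> 4 * s\<^sup>2" using disc zero_le_power2[of s] by linarith
  then have "(e2 + s)\<^sup>2 = 4 * s\<^sup>2 - 6 * \<rho> * g" by (simp add: e2_def)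
  then show ?thesis by (simp add: power2_eq_square algebra_simps)
qed

lemma r_eq: "3 * g * r = e2 + 3 * s" using g by (simp add: r_def)

lemma r_root: "s * r - 2 * \<rho> = e2 * r"
proof -
  have "3 * g * (s * r - 2 * \<rho> - e2 * r) = 0"
    using r_eq e2_quadratic by algebra
  then show ?thesis using g by simp
qed

text \<open>The first integral at the critical points 0 and \<open>T\<close> makes the squared
  maximum and minimum of \<phi> the roots of this quadratic. A negative value thus places
  \<open>r\<close> strictly between them.\<close>

lemma r_between: "g * r\<^sup>2 / 2 - s * r + \<rho> < 0"
proof -
  have "18 * g * (g * r\<^sup>2 / 2 - s * r + \<rho>) = (3 * g * r)\<^sup>2 - 6 * s * (3 * g * r) + 3 * (6 * \<rho> * g)"
    by (simp add: power2_eq_square algebra_simps)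
  also have "\<dots> = - 2 * e2\<^sup>2 - 6 * s * e2"
    using r_eq e2_quadratic by algebra
  also have "\<dots> < 0" using mult_pos_pos[OF s e2_pos] zero_le_power2[of e2] by linarith
  finally show ?thesis using g by (simp add: mult_less_0_iff)
qed

definition f :: "real \<Rightarrow> real" where "f x = (\<phi> x)\<^sup>2 - r"
definition f' :: "real \<Rightarrow> real" where "f' x = 2 * \<phi> x * \<phi>' x"
definition f'' :: "real \<Rightarrow> real" where "f'' x = (V x - e2) * f x"

lemma f_deriv: "(f has_real_derivative f' x) (at x)"
  unfolding f_def f'_def by (auto intro!: derivative_eq_intros d1 simp: power2_eq_square)

lemma f'_deriv: "(f' has_real_derivative f'' x) (at x)"
proof -
  have "(f' has_real_derivative 2 * (\<phi>' x)\<^sup>2 + 2 * \<phi> x * (s * \<phi> x - g * \<phi> x ^ 3)) (at x)"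
    unfolding f'_def by (auto intro!: derivative_eq_intros d1 d2 simp: power2_eq_square algebra_simps)
  also have "2 * (\<phi>' x)\<^sup>2 + 2 * \<phi> x * (s * \<phi> x - g * \<phi> x ^ 3) = f'' x"
    unfolding f''_def V_def f_def using energy[of x] r_eq r_root by algebra
  finally show ?thesis .
qed

lemma f_signs: "f 0 > 0" "f T < 0"
proof -
  have root: "g / 2 * ((\<phi> x)\<^sup>2)\<^sup>2 - s * (\<phi> x)\<^sup>2 + \<rho> = 0" if "\<phi>' x = 0" for x
    using energy[of x] that by (simp add: power_mult[symmetric])
  have "(\<phi> T)\<^sup>2 < (\<phi> 0)\<^sup>2" using strict_decr[of 0 T] T pos[of T] by (intro power_strict_mono) auto
  define A B where "A = (\<phi> 0)\<^sup>2" and "B = (\<phi> T)\<^sup>2"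
  have AB: "g / 2 * A\<^sup>2 - s * A + \<rho> = 0" "g / 2 * B\<^sup>2 - s * B + \<rho> = 0" "B < A"
    using root[OF ends(1)] root[OF ends(2)] \<open>(\<phi> T)\<^sup>2 < (\<phi> 0)\<^sup>2\<close> by (auto simp: A_def B_def)
  \<comment> \<open>Vieta: the two root equations give the sum of the roots, and with it the
    factorisation \<open>g / 2 * ((r - A) * (r - B))\<close>.\<close>
  have "(A - B) * (g / 2 * (A + B) - s) = (g / 2 * A\<^sup>2 - s * A + \<rho>) - (g / 2 * B\<^sup>2 - s * B + \<rho>)"
    by (simp add: power2_eq_square field_simps)
  then have "(A - B) * (g / 2 * (A + B) - s) = 0" using AB(1,2) by simp
  then have "g / 2 * (A + B) = s" using AB(3) by simp
  moreover have "g * r\<^sup>2 / 2 - s * r + \<rho> = g / 2 * ((r - A) * (r - B)) + (r - A) * (g / 2 * (A + B) - s) + (g / 2 * A\<^sup>2 - s * A + \<rho>)"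
    by (simp add: power2_eq_square field_simps)
  ultimately have "g * r\<^sup>2 / 2 - s * r + \<rho> = g / 2 * ((r - A) * (r - B))" using AB(1) by simp
  then have "(r - A) * (r - B) < 0"
    using r_between mult_nonneg_nonneg[of "g / 2" "(r - A) * (r - B)"] g by linarith
  then show "f 0 > 0" "f T < 0" using AB(3) by (auto simp: f_def A_def B_def mult_less_0_iff)
qed

text \<open>Existence comes from the signs at 0 and \<open>T\<close>, uniqueness up to sign from
  monotonicity and evenness. The zeros are simple because \<open>\<phi>'\<close> does not vanish
  there.\<close>

lemma zero_exists:
  obtains x0 where "0 < x0" "x0 < T" "f x0 = 0" "f (- x0) = 0" "f' x0 \<noteq> 0" "f' (- x0) \<noteq> 0"
    "\<And>x. x \<in> {-T..T} \<Longrightarrow> x \<noteq> x0 \<Longrightarrow> x \<noteq> - x0 \<Longrightarrow> f x \<noteq> 0"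
proof -
  have "\<exists>x\<ge>0. x \<le> T \<and> f x = 0"
    using f_signs T by (intro IVT2) (auto intro: DERIV_isCont f_deriv)
  then obtain x0 where x0: "0 \<le> x0" "x0 \<le> T" "f x0 = 0" by blast
  then have x0': "0 < x0" "x0 < T" using f_signs by (auto simp: less_le)
  have inj: "f x \<noteq> f y" if "0 \<le> x" "x < y" "y \<le> T" for x y
    using power_strict_mono[OF strict_decr[OF that], of 2] pos[of y] by (simp add: f_def)
  have fe: "f (- x) = f x" for x by (simp add: f_def even)
  show thesis
  proof (rule that[of x0])
    show "f (- x0) = 0" using fe x0 by simp
    show "f' x0 \<noteq> 0" "f' (- x0) \<noteq> 0" using decr[OF x0'] pos[of x0] by (auto simp: f'_def odd even)
    fix x assume x: "x \<in> {-T..T}" "x \<noteq> x0" "x \<noteq> - x0"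
    have "f x = f \<bar>x\<bar>" using fe by (simp add: abs_if)
    moreover have "f \<bar>x\<bar> \<noteq> f x0" using inj[of "\<bar>x\<bar>" x0] inj[of x0 "\<bar>x\<bar>"] x x0 by (cases "\<bar>x\<bar> < x0") (auto simp: abs_if split: if_splits)
    ultimately show "f x \<noteq> 0" using x0 by simp
  qed (use x0 x0' in auto)
qed

text \<open>Jacobi's identity: since \<open>f'' = (V - e2) * f\<close>, the integrand equals the
  derivative of the flux \<open>q\<^sup>2 * f' / f\<close> plus
  \<open>(q' - q * f' / f)\<^sup>2 + e2 * q\<^sup>2\<close> wherever \<open>f\<close> is nonzero.
  The flux is continuous through the zeros of \<open>f\<close>, where \<open>q\<close> vanishes too,
  and is zero at the ends because \<open>f'\<close> is.\<close>

lemma form_nonneg_of_zeros: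
  assumes x0: "0 < x0" "x0 < T" "f x0 = 0" "f (- x0) = 0" "f' x0 \<noteq> 0" "f' (- x0) \<noteq> 0"
    "\<And>x. x \<in> {-T..T} \<Longrightarrow> x \<noteq> x0 \<Longrightarrow> x \<noteq> - x0 \<Longrightarrow> f x \<noteq> 0"
    and q: "\<And>x. x \<in> {-T..T} \<Longrightarrow> (q has_real_derivative q' x) (at x within {-T..T})"
    and q': "continuous_on {-T..T} q'" and z: "q x0 = 0" "q (- x0) = 0"
  shows "integral {-T..T} (\<lambda>x. (q' x)\<^sup>2 + V x * (q x)\<^sup>2) \<ge> 0"
proof -
  have qc: "continuous_on {-T..T} q" using q by (rule DERIV_continuous_on)
  \<comment> \<open>At the zeros of \<open>f\<close> the convention \<open>x / 0 = 0\<close> gives \<open>N\<close> its continuous extension.\<close>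
  define N where "N x = (q x)\<^sup>2 * f' x / f x" for x
  define M where "M x = (q' x)\<^sup>2 + (q x)\<^sup>2 * f'' x / f x - (q' x - q x * f' x / f x)\<^sup>2" for x
  have qi: "(q has_real_derivative q' x) (at x)" if "x \<in> {-T<..<T}" for x
    using q[of x] that at_within_interior[of x "{-T..T}"] by (auto simp: interior_atLeastAtMost_real)
  have f'c: "isCont f' x" for x using f'_deriv by (rule DERIV_isCont)
  have fc: "isCont f x" for x using f_deriv by (rule DERIV_isCont)
  have "(M has_integral (N T - N (- T))) {-T..T}"
  \<comment> \<open>This version tolerates the finite exceptional set \<open>{x0, - x0}\<close>,
    provided that \<open>N\<close> is continuous.\<close>
  proof (rule fundamental_theorem_of_calculus_interior_strong[of "{x0, - x0}"])
    fix x assume x: "x \<in> {-T<..<T} - {x0, - x0}"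
    then have "f x \<noteq> 0" using x0(7) by auto
    then have "(N has_real_derivative M x) (at x)"
      unfolding N_def M_def using x
      by (auto intro!: derivative_eq_intros qi f_deriv f'_deriv simp: field_simps power2_eq_square)
    then show "(N has_vector_derivative M x) (at x)" by (simp add: has_real_derivative_iff_has_vector_derivative)
  next
    show "continuous_on {-T..T} N"
      unfolding continuous_on_eq_continuous_within
    proof
      fix x assume x: "x \<in> {-T..T}"
      show "continuous (at x within {-T..T}) N"
      proof (cases "x = x0 \<or> x = - x0")
        case True
        then have "isCont N x" unfolding N_def
          using x0 z by (auto intro!: isCont_square_divide qi f_deriv f'c)
        then show ?thesis by (rule continuous_at_imp_continuous_at_within)
      next
        case False
        then have "f x \<noteq> 0" using x0(7) x by auto
        then show ?thesis unfolding N_def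
          using qc x by (intro continuous_intros continuous_at_imp_continuous_at_within[OF fc] continuous_at_imp_continuous_at_within[OF f'c])
            (auto simp: continuous_on_eq_continuous_within)
      qed
    qed
  qed (use T in auto)
  moreover have "N T = 0" "N (- T) = 0" using ends by (auto simp: N_def f'_def)
  ultimately have M: "(M has_integral 0) {-T..T}" by simp
  have G: "(\<lambda>x. (q' x)\<^sup>2 + V x * (q x)\<^sup>2) integrable_on {-T..T}"
    by (intro integrable_continuous_real continuous_intros contV q' qc)
  show ?thesis
  proof (rule has_integral_le[OF M integrable_integral[OF G]])
    fix x assume x: "x \<in> {-T..T}"
    show "M x \<le> (q' x)\<^sup>2 + V x * (q x)\<^sup>2"
    proof (cases "f x = 0")
      case True
      then have "q x = 0" using x0(7)[OF x] z by auto
      then show ?thesis by (simp add: M_def)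
    next
      case False
      then have "(q x)\<^sup>2 * f'' x / f x = V x * (q x)\<^sup>2 - e2 * (q x)\<^sup>2"
        by (simp add: f''_def field_simps)
      moreover have "e2 * (q x)\<^sup>2 \<ge> 0" using e2_pos by simp
      ultimately show ?thesis
        using zero_le_power2[of "q' x - q x * f' x / f x"] unfolding M_def by linarith
    qed
  qed
qed

subsection \<open>The solution of the linearised equation with the profile as source\<close>

text \<open>\<open>e\<close> is the mean of \<open>\<phi>\<^sup>2\<close> over a period. For the
  dnoidal profile \<open>Z\<close> is a rescaled Jacobi zeta function.\<close>

lemma mean_square:
  obtains Z e where "\<And>x. (Z has_real_derivative (\<phi> x)\<^sup>2 - e) (at x)" "Z T = 0" "Z (- T) = 0"
proof -
  have "continuous_on UNIV (\<lambda>x. (\<phi> x)\<^sup>2)" by (intro continuous_intros cont)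
  then obtain F where F: "\<And>x. (F has_vector_derivative (\<phi> x)\<^sup>2) (at x)"
    using antiderivative_everywhere by blast
  define e where "e = (F T - F (- T)) / (2 * T)"
  show thesis
  proof (rule that[of "\<lambda>x. F x - F (- T) - e * (x + T)" e])
    show "((\<lambda>x. F x - F (- T) - e * (x + T)) has_real_derivative (\<phi> x)\<^sup>2 - e) (at x)" for x
      using F[of x] unfolding has_real_derivative_iff_has_vector_derivative[symmetric]
      by (auto intro!: derivative_eq_intros)
  qed (use T in \<open>auto simp: e_def\<close>)
qed

lemma has_integral_derivative:
  assumes "\<And>x. x \<in> {-T..T} \<Longrightarrow> (F has_real_derivative F' x) (at x within {-T..T})" "F T - F (- T) = d"
  shows "(F' has_integral d) {-T..T}"
  using fundamental_theorem_of_calculus[of "-T" T F F'] assms T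
  by (simp add: has_real_derivative_iff_has_vector_derivative)

text \<open>Both bounds come from \<open>e > sqrt (2 \<rho> / g)\<close>: since \<open>(\<phi>' / \<phi>)' = \<rho> / \<phi>\<^sup>2 - g \<phi>\<^sup>2 / 2\<close> has mean zero,
  \<open>e\<close> is the mean of \<open>(\<phi>\<^sup>2 + (2 \<rho> / g) / \<phi>\<^sup>2) / 2\<close>.\<close>

lemma mean_bounds:
  assumes Z: "\<And>x. (Z has_real_derivative (\<phi> x)\<^sup>2 - e) (at x)" "Z T = 0" "Z (- T) = 0"
  shows "\<rho> / g - e\<^sup>2 / 2 < 0" "2 * s * e - 4 * \<rho> > 0"
proof -
  define k where "k = sqrt (2 * \<rho> / g)"
  have k: "k > 0" "k\<^sup>2 = 2 * \<rho> / g" using rho g by (auto simp: k_def)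
  define ig where "ig = 1 / g"
  have ig: "ig * g = 1" using g by (simp add: ig_def)
  have nz: "\<phi> x \<noteq> 0" for x using pos[of x] by simp
  \<comment> \<open>Expanding the square and inserting the two means gives
    \<open>e + e - 2 * k\<close> as the mean of \<open>G\<close>, so nonnegativity of
    \<open>G\<close> yields \<open>e \<ge> k\<close>.\<close>
  define G where "G x = (\<phi> x - k / \<phi> x)\<^sup>2" for x
  have cG: "continuous_on {-T..T} G" unfolding G_def by (intro continuous_intros cont) (simp add: nz)
  have G: "(G has_integral 4 * T * (e - k)) {-T..T}"
  proof (rule has_integral_derivative)
    fix x assume "x \<in> {-T..T}"
    have "((\<lambda>x. 2 * Z x + 2 * (e - k) * x + 2 * ig * (\<phi>' x / \<phi> x)) has_real_derivative
      2 * ((\<phi> x)\<^sup>2 - e) + 2 * (e - k) + 2 * ig * (((s * \<phi> x - g * \<phi> x ^ 3) * \<phi> x - \<phi>' x * \<phi>' x) / (\<phi> x * \<phi> x))) (at x)"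
      using nz by (auto intro!: derivative_eq_intros Z d1 d2 simp: algebra_simps)
    also have "((s * \<phi> x - g * \<phi> x ^ 3) * \<phi> x - \<phi>' x * \<phi>' x) / (\<phi> x * \<phi> x) = \<rho> / (\<phi> x)\<^sup>2 - g * (\<phi> x)\<^sup>2 / 2"
      unfolding power2_eq_square[of "\<phi>' x", symmetric] energy
      using nz[of x] by (simp add: field_simps power2_eq_square power3_eq_cube power4_eq_xxxx)
    also have "2 * ((\<phi> x)\<^sup>2 - e) + 2 * (e - k) + 2 * ig * (\<rho> / (\<phi> x)\<^sup>2 - g * (\<phi> x)\<^sup>2 / 2) = G x"
    proof -
      have "G x = (\<phi> x)\<^sup>2 - 2 * k + k\<^sup>2 / (\<phi> x)\<^sup>2"
        using nz[of x] by (simp add: G_def power2_eq_square field_simps)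
      moreover have "2 * ig * (\<rho> / (\<phi> x)\<^sup>2 - g * (\<phi> x)\<^sup>2 / 2) = k\<^sup>2 / (\<phi> x)\<^sup>2 - (ig * g) * (\<phi> x)\<^sup>2"
        unfolding k(2) ig_def by (simp add: right_diff_distrib)
      ultimately show ?thesis using ig by simp
    qed
    finally show "((\<lambda>x. 2 * Z x + 2 * (e - k) * x + 2 * ig * (\<phi>' x / \<phi> x)) has_real_derivative G x) (at x within {-T..T})"
      by (rule has_field_derivative_at_within)
  qed (use Z ends in \<open>simp add: algebra_simps\<close>)
  have "0 \<le> 4 * T * (e - k)" by (rule has_integral_nonneg[OF G]) (simp add: G_def)
  \<comment> \<open>Equality would force \<open>G = 0\<close>, that is a constant
    \<open>\<phi>\<^sup>2\<close>, against strict monotonicity on \<open>{0..T}\<close>.\<close>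
  moreover have "e \<noteq> k"
  proof
    assume "e = k"
    then have "integral {-T..T} G = 0" using G by (simp add: integral_unique)
    then have z: "G x = 0" if "x \<in> {-T..T}" for x
      using integral_eq_0_iff[OF cG] T that by (simp add: G_def)
    have "(\<phi> x)\<^sup>2 = k" if "x \<in> {-T..T}" for x
    proof -
      have "\<phi> x = k / \<phi> x" using z[OF that] by (simp add: G_def)
      then show ?thesis using nz[of x] by (simp add: power2_eq_square field_simps)
    qed
    then have "(\<phi> 0)\<^sup>2 = (\<phi> T)\<^sup>2" using T by simp
    then show False using strict_decr[of 0 T] T pos[of 0] pos[of T] by (simp add: power2_eq_iff)
  qed
  ultimately have ek: "e > k" using T by (simp add: zero_le_mult_iff less_le)
  have e2: "e\<^sup>2 > 2 * \<rho> / g" using power_strict_mono[OF ek, of 2] k by simp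
  then show "\<rho> / g - e\<^sup>2 / 2 < 0" by (simp add: field_simps)
  \<comment> \<open>The two factors are below \<open>s\<^sup>2\<close> by \<open>disc\<close> and
    below \<open>e\<^sup>2\<close> by the bound just obtained.\<close>
  have "(2 * \<rho>)\<^sup>2 = (2 * \<rho> * g) * (2 * \<rho> / g)" using g by (simp add: power2_eq_square)
  also have "\<dots> < s\<^sup>2 * e\<^sup>2" using disc e2 rho g s by (intro mult_strict_mono) auto
  finally have "2 * \<rho> < s * e"
    using s ek k by (intro power_less_imp_less_base[of "2 * \<rho>" 2 "s * e"]) (auto simp: power_mult_distrib)
  then show "2 * s * e - 4 * \<rho> > 0" by (simp add: algebra_simps)
qed

text \<open>\<open>B * J\<close> below is the negative number
  \<open>\<langle>\<L>\<^sub>+ y, y\<rangle>\<close>: \<open>B\<close> comes from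
  \<open>\<L>\<^sub>+ y = B * \<phi>\<close>, and \<open>J\<close> is the integral of
  \<open>y * \<phi>\<close>.\<close>

theorem form_nonneg_orthogonal:
  assumes p: "\<And>x. x \<in> {-T..T} \<Longrightarrow> (p has_real_derivative p' x) (at x within {-T..T})"
    and p': "continuous_on {-T..T} p'" and pe: "p (- T) = p T"
    and orth: "((\<lambda>x. p x * \<phi> x) has_integral 0) {-T..T}"
  shows "integral {-T..T} (\<lambda>x. (p' x)\<^sup>2 + V x * (p x)\<^sup>2) \<ge> 0"
proof -
  obtain Z e where Z: "\<And>x. (Z has_real_derivative (\<phi> x)\<^sup>2 - e) (at x)" "Z T = 0" "Z (- T) = 0"
    using mean_square by blast
  define B where "B = 2 * s * e - 4 * \<rho>"
  define J where "J = 2 * T * (\<rho> / g - e\<^sup>2 / 2)"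
  have BJ: "B * J < 0"
    using mean_bounds[OF Z] T by (auto simp: B_def J_def mult_less_0_iff)
  define ig where "ig = 1 / g"
  have ig: "ig * g = 1" using g by (simp add: ig_def)
  \<comment> \<open>Since \<open>Z' = \<phi>\<^sup>2 - e\<close> and
    \<open>\<L>\<^sub>+ \<phi>' = 0\<close>, applying \<open>\<L>\<^sub>+\<close> to
    \<open>\<phi>' * Z\<close> leaves a polynomial in \<phi> of degree five. Subtracting
    \<open>\<phi> ^ 3\<close> removes the quintic term;
    \<open>\<L>\<^sub>+ \<phi> = - 2 * g * \<phi> ^ 3\<close>, so this \<open>K\<close> removes the
    cubic one, and \<open>B * \<phi>\<close> remains.\<close>
  define K where "K = 2 * s * ig - e"
  have K: "g * K = 2 * s - g * e" using g by (simp add: K_def ig_def field_simps)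
  define y where "y x = \<phi>' x * Z x - \<phi> x ^ 3 + K * \<phi> x" for x
  define y' where "y' x = (s * \<phi> x - g * \<phi> x ^ 3) * Z x + \<phi>' x * ((\<phi> x)\<^sup>2 - e) - 3 * (\<phi> x)\<^sup>2 * \<phi>' x + K * \<phi>' x" for x
  have yd: "(y has_real_derivative y' x) (at x)" for x
    unfolding y_def y'_def by (auto intro!: derivative_eq_intros d1 d2 Z)
  have yd': "(y' has_real_derivative V x * y x - B * \<phi> x) (at x)" for x
  proof -
    have "(y' has_real_derivative (s * \<phi>' x - 3 * g * (\<phi> x)\<^sup>2 * \<phi>' x) * Z x + 2 * (s * \<phi> x - g * \<phi> x ^ 3) * ((\<phi> x)\<^sup>2 - e)
       + 2 * \<phi> x * (\<phi>' x)\<^sup>2 - 6 * \<phi> x * (\<phi>' x)\<^sup>2 - 3 * (\<phi> x)\<^sup>2 * (s * \<phi> x - g * \<phi> x ^ 3)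
       + K * (s * \<phi> x - g * \<phi> x ^ 3)) (at x)"
      unfolding y'_def by (auto intro!: derivative_eq_intros d1 d2 Z simp: power2_eq_square algebra_simps)
    also have "(s * \<phi>' x - 3 * g * (\<phi> x)\<^sup>2 * \<phi>' x) * Z x + 2 * (s * \<phi> x - g * \<phi> x ^ 3) * ((\<phi> x)\<^sup>2 - e)
       + 2 * \<phi> x * (\<phi>' x)\<^sup>2 - 6 * \<phi> x * (\<phi>' x)\<^sup>2 - 3 * (\<phi> x)\<^sup>2 * (s * \<phi> x - g * \<phi> x ^ 3)
       + K * (s * \<phi> x - g * \<phi> x ^ 3) = V x * y x - B * \<phi> x"
    proof -
      have "(s * \<phi>' x - 3 * g * (\<phi> x)\<^sup>2 * \<phi>' x) * Z x + 2 * (s * \<phi> x - g * \<phi> x ^ 3) * ((\<phi> x)\<^sup>2 - e)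
       + 2 * \<phi> x * (\<phi>' x)\<^sup>2 - 6 * \<phi> x * (\<phi>' x)\<^sup>2 - 3 * (\<phi> x)\<^sup>2 * (s * \<phi> x - g * \<phi> x ^ 3)
       + K * (s * \<phi> x - g * \<phi> x ^ 3) - (V x * y x - B * \<phi> x)
       = - 4 * \<phi> x * ((\<phi>' x)\<^sup>2 - (s * (\<phi> x)\<^sup>2 - g * \<phi> x ^ 4 / 2 - \<rho>)) + 2 * \<phi> x ^ 3 * (g * K - (2 * s - g * e))"
        unfolding V_def y_def B_def
        by (simp add: power2_eq_square power3_eq_cube power4_eq_xxxx algebra_simps)
      then show ?thesis unfolding energy K by simp
    qed
    finally show ?thesis .
  qed
  have ye: "y (- T) = y T" "y' T = 0" "y' (- T) = 0" using ends Z by (auto simp: y_def y'_def)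
  have yJ: "((\<lambda>x. y x * \<phi> x) has_integral J) {-T..T}"
  proof (rule has_integral_derivative)
    fix x
    \<comment> \<open>The primitive integrates \<open>\<phi> * \<phi>' * Z\<close> by parts, removes
      the quartic terms through the derivative of \<open>\<phi> * \<phi>'\<close>, and absorbs the
      remaining \<open>\<phi>\<^sup>2\<close> into \<open>Z\<close>; only a linear term contributes
      at the ends.\<close>
    have "((\<lambda>x. (\<phi> x)\<^sup>2 * Z x / 2 + ig * (\<phi> x * \<phi>' x) - e / 2 * Z x + (\<rho> * ig - e\<^sup>2 / 2) * x) has_real_derivative
      \<phi> x * \<phi>' x * Z x + (\<phi> x)\<^sup>2 * ((\<phi> x)\<^sup>2 - e) / 2 + ig * ((\<phi>' x)\<^sup>2 + \<phi> x * (s * \<phi> x - g * \<phi> x ^ 3))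
       - e / 2 * ((\<phi> x)\<^sup>2 - e) + (\<rho> * ig - e\<^sup>2 / 2)) (at x)"
      by (auto intro!: derivative_eq_intros d1 d2 Z simp: power2_eq_square field_simps)
    also have "\<phi> x * \<phi>' x * Z x + (\<phi> x)\<^sup>2 * ((\<phi> x)\<^sup>2 - e) / 2 + ig * ((\<phi>' x)\<^sup>2 + \<phi> x * (s * \<phi> x - g * \<phi> x ^ 3))
       - e / 2 * ((\<phi> x)\<^sup>2 - e) + (\<rho> * ig - e\<^sup>2 / 2) = y x * \<phi> x
       + ig * ((\<phi>' x)\<^sup>2 - (s * (\<phi> x)\<^sup>2 - g * \<phi> x ^ 4 / 2 - \<rho>)) - 3 / 2 * \<phi> x ^ 4 * (ig * g - 1)"
      unfolding y_def K_def by (simp add: power2_eq_square power3_eq_cube power4_eq_xxxx field_simps)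
    also have "\<dots> = y x * \<phi> x" unfolding energy ig by simp
    finally show "((\<lambda>x. (\<phi> x)\<^sup>2 * Z x / 2 + ig * (\<phi> x * \<phi>' x) - e / 2 * Z x + (\<rho> * ig - e\<^sup>2 / 2) * x) has_real_derivative y x * \<phi> x) (at x within {-T..T})"
      by (rule has_field_derivative_at_within)
  next
    show "(\<phi> T)\<^sup>2 * Z T / 2 + ig * (\<phi> T * \<phi>' T) - e / 2 * Z T + (\<rho> * ig - e\<^sup>2 / 2) * T
      - ((\<phi> (- T))\<^sup>2 * Z (- T) / 2 + ig * (\<phi> (- T) * \<phi>' (- T)) - e / 2 * Z (- T) + (\<rho> * ig - e\<^sup>2 / 2) * (- T)) = J"
      unfolding Z ends J_def ig_def by simp
  qed

  \<comment> \<open>\<open>y\<close> solves \<open>- y'' + V y = B \<phi>\<close>, and \<open>\<phi>'\<close> solves the homogeneous equation.\<close>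
  define w where "w t m x = t * y x + m * \<phi>' x" for t m x
  define w' where "w' t m x = t * y' x + m * (s * \<phi> x - g * \<phi> x ^ 3)" for t m x
  have wd: "(w t m has_real_derivative w' t m x) (at x)" for t m x
    unfolding w_def w'_def by (auto intro!: derivative_eq_intros yd d2)
  have wd': "(w' t m has_real_derivative V x * w t m x - t * B * \<phi> x) (at x)" for t m x
    unfolding w_def w'_def by (auto intro!: derivative_eq_intros yd' d1 simp: V_def power2_eq_square algebra_simps)
  have we: "w t m (- T) = w t m T" "w' t m (- T) = w' t m T" for t m
    using ye ends by (auto simp: w_def w'_def)
  have w'c: "continuous_on {-T..T} (w' t m)" for t m
    by (intro continuous_at_imp_continuous_on ballI DERIV_isCont[OF wd'])

  \<comment> \<open>Because \<open>\<L>\<^sub>+ w = t * B * \<phi>\<close>, the cross term is a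
    multiple of the integral of \<open>p * \<phi>\<close> and vanishes, and the quadratic term
    reduces to \<open>t\<^sup>2 * B * J\<close>, as \<open>\<phi> * \<phi>'\<close> has mean zero.
    It is stated for general \<open>p\<close>, since it is also applied to
    \<open>p = 0\<close>.\<close>
  have expand: "integral {-T..T} (\<lambda>x. (p' x - w' t m x)\<^sup>2 + V x * (p x - w t m x)\<^sup>2)
      = integral {-T..T} (\<lambda>x. (p' x)\<^sup>2 + V x * (p x)\<^sup>2) + t\<^sup>2 * (B * J)"
    if p: "\<And>x. x \<in> {-T..T} \<Longrightarrow> (p has_real_derivative p' x) (at x within {-T..T})"
    and p': "continuous_on {-T..T} p'" and pe: "p (- T) = p T"
    and orth: "((\<lambda>x. p x * \<phi> x) has_integral 0) {-T..T}" for p p' t m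
  proof (rule integral_unique)
    have pc: "continuous_on {-T..T} p" using p by (rule DERIV_continuous_on)
    have Q: "((\<lambda>x. (p' x)\<^sup>2 + V x * (p x)\<^sup>2) has_integral integral {-T..T} (\<lambda>x. (p' x)\<^sup>2 + V x * (p x)\<^sup>2)) {-T..T}"
      by (intro integrable_integral integrable_continuous_real continuous_intros contV p' pc)
    have F: "((\<lambda>x. - 2 * (p' x * w' t m x + p x * (V x * w t m x - t * B * \<phi> x))
        + (w' t m x * w' t m x + w t m x * (V x * w t m x - t * B * \<phi> x)) + t * B * m * (\<phi> x * \<phi>' x)) has_integral 0) {-T..T}"
    proof (rule has_integral_derivative)
      fix x assume x: "x \<in> {-T..T}"
      note D = has_field_derivative_at_within[OF wd] has_field_derivative_at_within[OF wd'] has_field_derivative_at_within[OF d1]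
      show "((\<lambda>x. - 2 * (p x * w' t m x) + w t m x * w' t m x + t * B * m * ((\<phi> x)\<^sup>2 / 2)) has_real_derivative
         - 2 * (p' x * w' t m x + p x * (V x * w t m x - t * B * \<phi> x))
        + (w' t m x * w' t m x + w t m x * (V x * w t m x - t * B * \<phi> x)) + t * B * m * (\<phi> x * \<phi>' x)) (at x within {-T..T})"
        by (auto intro!: derivative_eq_intros p[OF x] D simp: algebra_simps)
    qed (use pe we ends in simp)
    have "((\<lambda>x. ((p' x)\<^sup>2 + V x * (p x)\<^sup>2) + (- 2 * (p' x * w' t m x + p x * (V x * w t m x - t * B * \<phi> x))
        + (w' t m x * w' t m x + w t m x * (V x * w t m x - t * B * \<phi> x)) + t * B * m * (\<phi> x * \<phi>' x))
        + (- 2 * t * B) * (p x * \<phi> x) + t\<^sup>2 * B * (y x * \<phi> x)) has_integral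
        (integral {-T..T} (\<lambda>x. (p' x)\<^sup>2 + V x * (p x)\<^sup>2) + 0 + (- 2 * t * B) * 0 + t\<^sup>2 * B * J)) {-T..T}"
      by (intro has_integral_add has_integral_mult_right Q F orth yJ)
    moreover have "((p' x)\<^sup>2 + V x * (p x)\<^sup>2) + (- 2 * (p' x * w' t m x + p x * (V x * w t m x - t * B * \<phi> x))
        + (w' t m x * w' t m x + w t m x * (V x * w t m x - t * B * \<phi> x)) + t * B * m * (\<phi> x * \<phi>' x))
        + (- 2 * t * B) * (p x * \<phi> x) + t\<^sup>2 * B * (y x * \<phi> x) = (p' x - w' t m x)\<^sup>2 + V x * (p x - w t m x)\<^sup>2" for x
      by (simp add: w_def power2_eq_square algebra_simps)
    ultimately show "((\<lambda>x. (p' x - w' t m x)\<^sup>2 + V x * (p x - w t m x)\<^sup>2) has_integral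
       integral {-T..T} (\<lambda>x. (p' x)\<^sup>2 + V x * (p x)\<^sup>2) + t\<^sup>2 * (B * J)) {-T..T}" by (simp add: mult.assoc)
  qed
  obtain x0 where x0: "0 < x0" "x0 < T" "f x0 = 0" "f (- x0) = 0" "f' x0 \<noteq> 0" "f' (- x0) \<noteq> 0"
    "\<And>x. x \<in> {-T..T} \<Longrightarrow> x \<noteq> x0 \<Longrightarrow> x \<noteq> - x0 \<Longrightarrow> f x \<noteq> 0"
    using zero_exists by blast
  have nonneg: "integral {-T..T} (\<lambda>x. (p' x)\<^sup>2 + V x * (p x)\<^sup>2) + t\<^sup>2 * (B * J) \<ge> 0"
    if C: "\<And>x. x \<in> {-T..T} \<Longrightarrow> (p has_real_derivative p' x) (at x within {-T..T})"
    "continuous_on {-T..T} p'" "p (- T) = p T"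
    "((\<lambda>x. p x * \<phi> x) has_integral 0) {-T..T}" "p x0 = w t m x0" "p (- x0) = w t m (- x0)" for p p' t m
  proof -
    have "integral {-T..T} (\<lambda>x. (p' x - w' t m x)\<^sup>2 + V x * (p x - w t m x)\<^sup>2) \<ge> 0"
    proof (rule form_nonneg_of_zeros[OF x0])
      show "((\<lambda>x. p x - w t m x) has_real_derivative p' x - w' t m x) (at x within {-T..T})" if "x \<in> {-T..T}" for x
        by (rule DERIV_diff[OF C(1)[OF that] has_field_derivative_at_within[OF wd]])
      show "continuous_on {-T..T} (\<lambda>x. p' x - w' t m x)" by (rule continuous_on_diff[OF C(2) w'c])
    qed (use C in simp_all)
    also have "\<dots> = integral {-T..T} (\<lambda>x. (p' x)\<^sup>2 + V x * (p x)\<^sup>2) + t\<^sup>2 * (B * J)"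
      by (rule expand[OF C(1-4)])
    finally show ?thesis .
  qed
  have \<phi>0: "\<phi>' x0 \<noteq> 0" using decr[OF x0(1,2)] by simp
  \<comment> \<open>Otherwise \<open>w\<close> with \<open>t = 1\<close> and a suitable
    \<open>m\<close> would vanish at both zeros, and \<open>p = 0\<close> in \<open>nonneg\<close>
    would give \<open>B * J \<ge> 0\<close>.\<close>
  have den: "y x0 + y (- x0) \<noteq> 0"
  proof
    assume "y x0 + y (- x0) = 0"
    then have "y (- x0) = - y x0" by simp
    then have w0: "0 = w 1 (- y x0 / \<phi>' x0) x0" "0 = w 1 (- y x0 / \<phi>' x0) (- x0)"
      using \<phi>0 by (simp_all add: w_def odd)
    have "integral {-T..T} (\<lambda>x. 0\<^sup>2 + V x * 0\<^sup>2) + 1\<^sup>2 * (B * J) \<ge> 0"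
      by (rule nonneg[OF _ _ _ _ w0]) simp_all
    then have "B * J \<ge> 0" by simp
    with BJ show False by simp
  qed
  \<comment> \<open>As \<open>\<phi>'\<close> is odd, adding the two interpolation conditions at
    \<open>x0\<close> and \<open>- x0\<close> eliminates \<open>m\<close> and determines
    \<open>t\<close>; the condition at \<open>x0\<close> then determines \<open>m\<close>.\<close>
  define t where "t = (p x0 + p (- x0)) / (y x0 + y (- x0))"
  define m where "m = (p x0 - t * y x0) / \<phi>' x0"
  have m: "m * \<phi>' x0 = p x0 - t * y x0" using \<phi>0 by (simp add: m_def)
  then have "p x0 = w t m x0" by (simp add: w_def)
  moreover have "p (- x0) = w t m (- x0)"
  proof -
    have "t * (y x0 + y (- x0)) = p x0 + p (- x0)" using den by (simp add: t_def)
    then show ?thesis using m by (simp add: w_def odd algebra_simps)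
  qed
  ultimately have "integral {-T..T} (\<lambda>x. (p' x)\<^sup>2 + V x * (p x)\<^sup>2) + t\<^sup>2 * (B * J) \<ge> 0"
    by (intro nonneg[where p = p and p' = p' and t = t and m = m] p p' pe orth)
  moreover have "t\<^sup>2 * (B * J) \<le> 0" using BJ by (simp add: mult_nonneg_nonpos)
  ultimately show ?thesis by linarith
qed

end

section \<open>The energy argument\<close>

context dnoidal_profile
begin

text \<open>The integral of the energy \<open>E\<close> vanishes and splits into nonnegative parts,
  so the three squares are identically zero. From \<open>R = 0\<close> it follows that
  \<open>\<mu> * P1 = 0\<close>; the other two squares then give \<open>Q = H = 0\<close>, and the
  equation for \<open>D1\<close> leaves \<open>\<mu> * P2 = 0\<close>.\<close>

lemma eigenvector_zero:
  fixes P1 P2 D1 D2 Q H :: "real \<Rightarrow> complex" and \<mu> :: complex and c :: real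
  assumes c: "1 - c\<^sup>2 > 0" and gc: "2 * g * (1 - c\<^sup>2) = 1" and \<mu>: "Re \<mu> > 0"
    and W: "W = (\<lambda>x. s - g * (\<phi> x)\<^sup>2)"
    and cQ: "continuous_on {-T..T} Q" and cH: "continuous_on {-T..T} H"
    and e: "P1 (-T) = P1 T" "P2 (-T) = P2 T" "D1 (-T) = D1 T" "D2 (-T) = D2 T" "Q (-T) = Q T" "H (-T) = H T"
    and P1: "\<And>x. x \<in> {-T..T} \<Longrightarrow> (P1 has_vector_derivative D1 x) (at x within {-T..T})"
    and P2: "\<And>x. x \<in> {-T..T} \<Longrightarrow> (P2 has_vector_derivative D2 x) (at x within {-T..T})"
    and D1: "\<And>x. x \<in> {-T..T} \<Longrightarrow> (D1 has_vector_derivative \<mu> * P2 x + of_real (W x) * P1 x + of_real (\<phi> x) * Q x) (at x within {-T..T})"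
    and D2: "\<And>x. x \<in> {-T..T} \<Longrightarrow> (D2 has_vector_derivative of_real (W x) * P2 x - \<mu> * P1 x) (at x within {-T..T})"
    and N1: "\<And>x. x \<in> {-T..T} \<Longrightarrow> ((\<lambda>x. H x - of_real c * Q x) has_vector_derivative - \<mu> * Q x) (at x within {-T..T})"
    and N2: "\<And>x. x \<in> {-T..T} \<Longrightarrow> ((\<lambda>x. of_real (\<phi> x) * P1 x + Q x - of_real c * H x) has_vector_derivative - \<mu> * H x) (at x within {-T..T})"
    and x: "x \<in> {-T..T}"
  shows "P1 x = 0 \<and> P2 x = 0 \<and> Q x = 0 \<and> H x = 0"
proof -
  have cP1: "continuous_on {-T..T} P1" using P1 by (rule continuous_on_vector_derivative)
  have cP2: "continuous_on {-T..T} P2" using P2 by (rule continuous_on_vector_derivative)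
  have cD1: "continuous_on {-T..T} D1" using D1 by (rule continuous_on_vector_derivative)
  have cD2: "continuous_on {-T..T} D2" using D2 by (rule continuous_on_vector_derivative)
  have nz: "\<phi> x \<noteq> 0" for x using pos[of x] by simp
  have \<phi>W: "s * \<phi> x - g * \<phi> x ^ 3 = W x * \<phi> x" for x
    by (simp add: W power2_eq_square power3_eq_cube algebra_simps)
  have dphi: "((\<lambda>x. complex_of_real (\<phi> x)) has_vector_derivative of_real (\<phi>' x)) (at x within S)"
    "((\<lambda>x. complex_of_real (\<phi>' x)) has_vector_derivative of_real (W x * \<phi> x)) (at x within S)" for x S
    by (intro has_vector_derivative_of_real has_field_derivative_at_within[OF d1]
        has_field_derivative_at_within[OF d2, unfolded \<phi>W])+
  have FTC: "(F' has_integral 0) {-T..T}"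
    if "\<And>x. x \<in> {-T..T} \<Longrightarrow> (F has_vector_derivative F' x) (at x within {-T..T})" "F (-T) = F T"
    for F F' :: "real \<Rightarrow> 'a :: banach"
    using fundamental_theorem_of_calculus[of "-T" T F F'] that T by simp

  define E where "E x = (cmod (D2 x))\<^sup>2 + W x * (cmod (P2 x))\<^sup>2 + (cmod (D1 x))\<^sup>2 + V x * (cmod (P1 x))\<^sup>2
     + (1 - c\<^sup>2) * (cmod (Q x + of_real (2 * g * \<phi> x) * P1 x))\<^sup>2 + (cmod (H x - of_real c * Q x))\<^sup>2" for x
  have "((\<lambda>x. Re \<mu> * E x) has_integral 0) {-T..T}"
  proof -
    \<comment> \<open>\<open>?F\<close> is the flux of the energy density \<open>E\<close> of the solution \<open>exp (\<mu> t) U\<close>.\<close>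
    let ?F = "\<lambda>x. cnj (\<mu> * P2 x) * D2 x + cnj (\<mu> * P1 x) * D1 x - cnj (H x - of_real c * Q x) * (of_real (\<phi> x) * P1 x + Q x - of_real c * H x)"
    let ?F' = "\<lambda>x. (cnj (\<mu> * P2 x) * (of_real (W x) * P2 x - \<mu> * P1 x) + cnj (\<mu> * D2 x) * D2 x)
        + (cnj (\<mu> * P1 x) * (\<mu> * P2 x + of_real (W x) * P1 x + of_real (\<phi> x) * Q x) + cnj (\<mu> * D1 x) * D1 x)
        - (cnj (H x - of_real c * Q x) * (- \<mu> * H x) + cnj (- \<mu> * Q x) * (of_real (\<phi> x) * P1 x + Q x - of_real c * H x))"
    have "(?F has_vector_derivative ?F' x) (at x within {-T..T})" if "x \<in> {-T..T}" for x
      by (intro has_vector_derivative_add has_vector_derivative_diff has_vector_derivative_mult has_vector_derivative_cnj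
          has_vector_derivative_mult_right P1 P2 D1 D2 N1 N2 that)
    then have "((\<lambda>x. Re (?F x)) has_vector_derivative Re (?F' x)) (at x within {-T..T})" if "x \<in> {-T..T}" for x
      using that by (intro bounded_linear.has_vector_derivative[OF bounded_linear_Re])
    then have "((\<lambda>x. Re (?F' x)) has_integral 0) {-T..T}"
      by (rule FTC) (simp_all add: e ends)
    moreover have "Re (?F' x) = Re \<mu> * E x" for x
    proof -
      \<comment> \<open>By \<open>gc\<close> the square contains exactly the term
        \<open>2 * g * \<phi>\<^sup>2 * \<bar>P1\<bar>\<^sup>2\<close> that separates the potential
        \<open>W\<close> of \<open>\<L>\<^sub>-\<close> from \<open>V\<close>.\<close>
      have g1: "(1 - c\<^sup>2) * (cmod (Q x + of_real (2 * g * \<phi> x) * P1 x))\<^sup>2 = (1 - c\<^sup>2) * (cmod (Q x))\<^sup>2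
        + (2 * g * (1 - c\<^sup>2)) * (2 * \<phi> x * Re (P1 x * cnj (Q x))) + (2 * g * (1 - c\<^sup>2)) * (2 * g * (\<phi> x)\<^sup>2 * (cmod (P1 x))\<^sup>2)"
        unfolding cmod_power2 by (simp add: power2_eq_square algebra_simps)
      have E: "E x = (cmod (D2 x))\<^sup>2 + W x * (cmod (P2 x))\<^sup>2 + (cmod (D1 x))\<^sup>2 + W x * (cmod (P1 x))\<^sup>2
        + 2 * \<phi> x * Re (P1 x * cnj (Q x)) + (1 - c\<^sup>2) * (cmod (Q x))\<^sup>2 + (cmod (H x - of_real c * Q x))\<^sup>2"
        unfolding E_def g1 gc V_def W by (simp add: algebra_simps)
      show ?thesis unfolding E cmod_power2 by (simp add: power2_eq_square algebra_simps)
    qed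
    ultimately show ?thesis by simp
  qed
  from has_integral_mult_right[OF this, of "1 / Re \<mu>"] have E0: "(E has_integral 0) {-T..T}"
    using \<mu> by simp

  have "((\<lambda>x. \<mu> * (P1 x * of_real (\<phi> x))) has_integral 0) {-T..T}"
  proof (rule FTC)
    fix x assume x: "x \<in> {-T..T}"
    \<comment> \<open>The Wronskian of \<open>P2\<close> and \<phi>: as
      \<open>\<L>\<^sub>- \<phi> = 0\<close>, its derivative is \<open>\<mu> * P1 * \<phi>\<close>,
      which yields the orthogonality.\<close>
    have "((\<lambda>x. P2 x * of_real (\<phi>' x) - D2 x * of_real (\<phi> x)) has_vector_derivative
      (P2 x * of_real (W x * \<phi> x) + D2 x * of_real (\<phi>' x)) - (D2 x * of_real (\<phi>' x) + (of_real (W x) * P2 x - \<mu> * P1 x) * of_real (\<phi> x))) (at x within {-T..T})"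
      by (intro has_vector_derivative_diff has_vector_derivative_mult dphi P2 D2 x)
    then show "((\<lambda>x. P2 x * of_real (\<phi>' x) - D2 x * of_real (\<phi> x)) has_vector_derivative \<mu> * (P1 x * of_real (\<phi> x))) (at x within {-T..T})"
      by (simp add: algebra_simps)
  qed (simp add: e ends)
  from has_integral_mult_right[OF this, of "1 / \<mu>"] have orth: "((\<lambda>x. P1 x * of_real (\<phi> x)) has_integral 0) {-T..T}"
    using \<mu> by (simp add: field_simps) (auto simp: complex_eq_iff)
  \<comment> \<open>The form inequality is for real functions; \<phi> and \<open>V\<close> are real,
    so it applies to real and imaginary parts separately.\<close>
  have "integral {-T..T} (\<lambda>x. (Re (D1 x))\<^sup>2 + V x * (Re (P1 x))\<^sup>2) \<ge> 0"
  proof (rule form_nonneg_orthogonal)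
    show "((\<lambda>x. Re (P1 x)) has_real_derivative Re (D1 x)) (at x within {-T..T})" if "x \<in> {-T..T}" for x
      unfolding has_real_derivative_iff_has_vector_derivative
      by (intro bounded_linear.has_vector_derivative[OF bounded_linear_Re] P1 that)
    show "((\<lambda>x. Re (P1 x) * \<phi> x) has_integral 0) {-T..T}"
      using has_integral_linear[OF orth bounded_linear_Re] by (simp add: o_def)
  qed (simp_all add: e continuous_on_Re cD1)
  moreover have "integral {-T..T} (\<lambda>x. (Im (D1 x))\<^sup>2 + V x * (Im (P1 x))\<^sup>2) \<ge> 0"
  proof (rule form_nonneg_orthogonal)
    show "((\<lambda>x. Im (P1 x)) has_real_derivative Im (D1 x)) (at x within {-T..T})" if "x \<in> {-T..T}" for x
      unfolding has_real_derivative_iff_has_vector_derivative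
      by (intro bounded_linear.has_vector_derivative[OF bounded_linear_Im] P1 that)
    show "((\<lambda>x. Im (P1 x) * \<phi> x) has_integral 0) {-T..T}"
      using has_integral_linear[OF orth bounded_linear_Im] by (simp add: o_def)
  qed (simp_all add: e continuous_on_Im cD1)
  moreover have "integral {-T..T} (\<lambda>x. (cmod (D1 x))\<^sup>2 + V x * (cmod (P1 x))\<^sup>2)
      = integral {-T..T} (\<lambda>x. (Re (D1 x))\<^sup>2 + V x * (Re (P1 x))\<^sup>2) + integral {-T..T} (\<lambda>x. (Im (D1 x))\<^sup>2 + V x * (Im (P1 x))\<^sup>2)"
    by (subst integral_add[symmetric])
       (auto intro!: integrable_continuous_real continuous_intros contV cD1 cP1 simp: cmod_power2 algebra_simps)
  ultimately have I1: "integral {-T..T} (\<lambda>x. (cmod (D1 x))\<^sup>2 + V x * (cmod (P1 x))\<^sup>2) \<ge> 0" by simp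

  define R where "R x = D2 x - P2 x * of_real (\<phi>' x / \<phi> x)" for x
  have dq: "((\<lambda>x. \<phi>' x / \<phi> x) has_real_derivative W x - (\<phi>' x / \<phi> x)\<^sup>2) (at x within S)" for x S
  proof (rule has_field_derivative_at_within)
    show "((\<lambda>x. \<phi>' x / \<phi> x) has_real_derivative W x - (\<phi>' x / \<phi> x)\<^sup>2) (at x)"
      using nz[of x] d2[of x] unfolding \<phi>W
      by (auto intro!: derivative_eq_intros d1 simp: field_simps power2_eq_square)
  qed
  have cdq: "continuous_on S (\<lambda>x. \<phi>' x / \<phi> x)" for S by (intro continuous_intros cont) (simp add: nz)
  \<comment> \<open>\<open>\<L>\<^sub>- \<phi> = 0\<close> with \<open>\<phi> > 0\<close>, so the form of \<open>\<L>\<^sub>-\<close> is \<open>\<integral> \<bar>P2' - P2 \<phi>' / \<phi>\<bar>\<^sup>2\<close>.\<close>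
  have I2: "((\<lambda>x. ((cmod (D2 x))\<^sup>2 + W x * (cmod (P2 x))\<^sup>2) - (cmod (R x))\<^sup>2) has_integral 0) {-T..T}"
  proof (rule FTC)
    fix x assume x: "x \<in> {-T..T}"
    have "((\<lambda>x. Re (cnj (P2 x) * P2 x) * (\<phi>' x / \<phi> x)) has_vector_derivative
       Re (cnj (P2 x) * P2 x) * (W x - (\<phi>' x / \<phi> x)\<^sup>2) + Re (cnj (P2 x) * D2 x + cnj (D2 x) * P2 x) * (\<phi>' x / \<phi> x)) (at x within {-T..T})"
      by (intro has_vector_derivative_mult bounded_linear.has_vector_derivative[OF bounded_linear_Re] has_vector_derivative_cnj P2 x
          dq[unfolded has_real_derivative_iff_has_vector_derivative])
    also have "Re (cnj (P2 x) * P2 x) * (W x - (\<phi>' x / \<phi> x)\<^sup>2) + Re (cnj (P2 x) * D2 x + cnj (D2 x) * P2 x) * (\<phi>' x / \<phi> x)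
      = ((cmod (D2 x))\<^sup>2 + W x * (cmod (P2 x))\<^sup>2) - (cmod (R x))\<^sup>2"
    proof -
      define k where "k = \<phi>' x / \<phi> x"
      show ?thesis unfolding R_def k_def[symmetric] cmod_power2 by (simp add: power2_eq_square algebra_simps)
    qed
    finally show "((\<lambda>x. Re (cnj (P2 x) * P2 x) * (\<phi>' x / \<phi> x)) has_vector_derivative
      ((cmod (D2 x))\<^sup>2 + W x * (cmod (P2 x))\<^sup>2) - (cmod (R x))\<^sup>2) (at x within {-T..T})" .
  qed (simp add: ends)

  let ?A = "\<lambda>x. (cmod (R x))\<^sup>2"
  let ?B = "\<lambda>x. (1 - c\<^sup>2) * (cmod (Q x + of_real (2 * g * \<phi> x) * P1 x))\<^sup>2"
  let ?C = "\<lambda>x. (cmod (H x - of_real c * Q x))\<^sup>2"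
  let ?D = "\<lambda>x. (cmod (D1 x))\<^sup>2 + V x * (cmod (P1 x))\<^sup>2"
  have ci: "continuous_on {-T..T} ?A" "continuous_on {-T..T} ?B" "continuous_on {-T..T} ?C" "continuous_on {-T..T} ?D"
    unfolding R_def by (intro continuous_intros cdq cont contV cP1 cP2 cD1 cD2 cQ cH)+
  note i = ci[THEN integrable_continuous_real, THEN integrable_integral]
  have "((\<lambda>x. E x - (((cmod (D2 x))\<^sup>2 + W x * (cmod (P2 x))\<^sup>2) - (cmod (R x))\<^sup>2)) has_integral (0 - 0)) {-T..T}"
    by (rule has_integral_diff[OF E0 I2])
  moreover have "E x - (((cmod (D2 x))\<^sup>2 + W x * (cmod (P2 x))\<^sup>2) - (cmod (R x))\<^sup>2) = ?A x + ?B x + ?C x + ?D x" for x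
    by (simp add: E_def)
  ultimately have "((\<lambda>x. ?A x + ?B x + ?C x + ?D x) has_integral 0) {-T..T}" by simp
  moreover have "((\<lambda>x. ?A x + ?B x + ?C x + ?D x) has_integral (integral {-T..T} ?A + integral {-T..T} ?B + integral {-T..T} ?C + integral {-T..T} ?D)) {-T..T}"
    by (intro has_integral_add i)
  ultimately have sum: "integral {-T..T} ?A + integral {-T..T} ?B + integral {-T..T} ?C + integral {-T..T} ?D = 0"
    using has_integral_unique by blast
  have nn: "0 \<le> integral {-T..T} ?A" "0 \<le> integral {-T..T} ?B" "0 \<le> integral {-T..T} ?C"
    by (rule has_integral_nonneg[OF i(1)] has_integral_nonneg[OF i(2)] has_integral_nonneg[OF i(3)]; use c in simp)+
  have z: "integral {-T..T} ?A = 0" "integral {-T..T} ?B = 0" "integral {-T..T} ?C = 0"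
    using sum nn I1 by linarith+
  have zA: "R x = 0" and zB: "Q x + of_real (2 * g * \<phi> x) * P1 x = 0" and zC: "H x - of_real c * Q x = 0" if "x \<in> {-T..T}" for x
    using z integral_eq_0_iff[OF ci(1)] integral_eq_0_iff[OF ci(2)] integral_eq_0_iff[OF ci(3)] T that c
    by auto

  have unique: "a = b" if "(F has_vector_derivative a) (at x within {-T..T})" "(G has_vector_derivative b) (at x within {-T..T})"
      "\<And>x. x \<in> {-T..T} \<Longrightarrow> F x = G x" "x \<in> {-T..T}" for F G :: "real \<Rightarrow> complex" and a b x
  proof -
    have "(G has_vector_derivative a) (at x within {-T..T})"
      using has_vector_derivative_transform[OF that(4) _ that(1)] that(3) by metis
    then show ?thesis
      using vector_derivative_unique_within_closed_interval[of "-T" T x G a b] that(2,4) T by simp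
  qed
  \<comment> \<open>Since \<open>R = 0\<close>, \<open>D2\<close> equals
    \<open>P2 * \<phi>' / \<phi>\<close>. Differentiating this and comparing with the equation for
    \<open>D2\<close> leaves only \<open>\<mu> * P1\<close>.\<close>
  have P1z: "P1 x = 0" if x: "x \<in> {-T..T}" for x
  proof -
    have "((\<lambda>x. P2 x * of_real (\<phi>' x / \<phi> x)) has_vector_derivative
        P2 x * of_real (W x - (\<phi>' x / \<phi> x)\<^sup>2) + D2 x * of_real (\<phi>' x / \<phi> x)) (at x within {-T..T})"
      by (intro has_vector_derivative_mult P2 x has_vector_derivative_of_real dq)
    from unique[OF D2[OF x] this _ x] zA
    have "of_real (W x) * P2 x - \<mu> * P1 x = P2 x * of_real (W x - (\<phi>' x / \<phi> x)\<^sup>2) + D2 x * of_real (\<phi>' x / \<phi> x)"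
      by (simp add: R_def)
    moreover have "D2 x = P2 x * of_real (\<phi>' x / \<phi> x)" using zA[OF x] by (simp add: R_def)
    ultimately have "\<mu> * P1 x = 0" by (simp add: power2_eq_square algebra_simps)
    then show ?thesis using \<mu> by auto
  qed
  have Qz: "Q x = 0" if x: "x \<in> {-T..T}" for x using zB[OF x] P1z[OF x] by simp
  have Hz: "H x = 0" if x: "x \<in> {-T..T}" for x using zC[OF x] Qz[OF x] by simp
  have D1z: "D1 x = 0" if x: "x \<in> {-T..T}" for x
    by (rule unique[OF P1[OF x] has_vector_derivative_const[of 0] P1z x])
  have "\<mu> * P2 x + of_real (W x) * P1 x + of_real (\<phi> x) * Q x = 0"
    by (rule unique[OF D1[OF x] has_vector_derivative_const[of 0] D1z x])
  then have "P2 x = 0" using P1z[OF x] Qz[OF x] \<mu> by auto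
  then show ?thesis using P1z[OF x] Qz[OF x] Hz[OF x] by simp
qed

end

section \<open>Jacobi elliptic functions: derivatives and periodicity\<close>

context
  fixes k :: real
  assumes k: "k\<^sup>2 < 1"
begin

lemma modulus_sin_pos: "0 < 1 - k\<^sup>2 * (sin t)\<^sup>2"
proof -
  have "k\<^sup>2 * (sin t)\<^sup>2 \<le> k\<^sup>2 * 1" by (intro mult_left_mono) (auto simp: abs_square_le_1)
  then show ?thesis using k by simp
qed

lemma elliptic_F_deriv:
  "(elliptic_F k has_real_derivative 1 / sqrt (1 - k\<^sup>2 * (sin x)\<^sup>2)) (at x)"
proof -
  have "continuous_on S (\<lambda>t. 1 / sqrt (1 - k\<^sup>2 * (sin t)\<^sup>2))" for S :: "real set"
    using modulus_sin_pos by (intro continuous_intros) (auto simp: less_imp_neq[THEN not_sym])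
  then have "((\<lambda>u. LBINT t=ereal 0..ereal u. 1 / sqrt (1 - k\<^sup>2 * (sin t)\<^sup>2)) has_vector_derivative 1 / sqrt (1 - k\<^sup>2 * (sin x)\<^sup>2))
      (at x within {-\<bar>x\<bar>-1..\<bar>x\<bar>+1})"
    by (intro interval_integral_FTC2) auto
  moreover have "x \<in> interior {-\<bar>x\<bar>-1..\<bar>x\<bar>+1}" by auto
  moreover have "elliptic_F k = (\<lambda>u. LBINT t=ereal 0..ereal u. 1 / sqrt (1 - k\<^sup>2 * (sin t)\<^sup>2))"
    unfolding elliptic_F_def zero_ereal_def ..
  ultimately show ?thesis
    by (simp only: at_within_interior has_real_derivative_iff_has_vector_derivative)
qed

lemma elliptic_F_0: "elliptic_F k 0 = 0"
  unfolding elliptic_F_def zero_ereal_def by (rule interval_integral_endpoints_same)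

text \<open>The integrand is at least 1. This one estimate yields injectivity, surjectivity by
  intermediate values, and a Lipschitz bound for the inverse.\<close>

lemma elliptic_F_expanding:
  assumes "a \<le> b"
  shows "b - a \<le> elliptic_F k b - elliptic_F k a"
proof -
  have "elliptic_F k a - a \<le> elliptic_F k b - b"
  proof (rule DERIV_nonneg_imp_nondecreasing[OF assms])
    fix x
    have "sqrt (1 - k\<^sup>2 * (sin x)\<^sup>2) \<le> 1" by simp
    then have "1 \<le> 1 / sqrt (1 - k\<^sup>2 * (sin x)\<^sup>2)" using modulus_sin_pos[of x] by simp
    moreover have "((\<lambda>x. elliptic_F k x - x) has_real_derivative 1 / sqrt (1 - k\<^sup>2 * (sin x)\<^sup>2) - 1) (at x)"
      by (auto intro!: derivative_eq_intros elliptic_F_deriv)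
    ultimately show "\<exists>y. ((\<lambda>x. elliptic_F k x - x) has_real_derivative y) (at x) \<and> 0 \<le> y"
      by (intro exI[of _ "1 / sqrt (1 - k\<^sup>2 * (sin x)\<^sup>2) - 1"]) simp
  qed
  then show ?thesis by simp
qed

lemma elliptic_F_inj: "elliptic_F k a = elliptic_F k b \<longleftrightarrow> a = b"
  using elliptic_F_expanding[of a b] elliptic_F_expanding[of b a] by (cases "a \<le> b") auto

lemma elliptic_F_am: "elliptic_F k (jacobi_am x k) = x"
proof -
  have "\<exists>t. - \<bar>x\<bar> \<le> t \<and> t \<le> \<bar>x\<bar> \<and> elliptic_F k t = x"
    using elliptic_F_expanding[of 0 "\<bar>x\<bar>"] elliptic_F_expanding[of "- \<bar>x\<bar>" 0] elliptic_F_0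
    by (intro IVT) (auto intro!: DERIV_isCont elliptic_F_deriv)
  then obtain t where t: "elliptic_F k t = x" by auto
  have "\<exists>!t. elliptic_F k t = x"
    by (rule ex1I[of _ t], rule t) (simp flip: t add: elliptic_F_inj)
  then show ?thesis unfolding jacobi_am_def by (rule theI')
qed

lemma am_elliptic_F: "jacobi_am (elliptic_F k t) k = t"
  using elliptic_F_inj[of "jacobi_am (elliptic_F k t) k" t] elliptic_F_am by simp

lemma jacobi_dn_pos: "jacobi_dn x k > 0"
  using modulus_sin_pos by (simp add: jacobi_dn_def)

lemma jacobi_dn_square: "(jacobi_dn x k)\<^sup>2 = 1 - k\<^sup>2 * (sin (jacobi_am x k))\<^sup>2"
  using modulus_sin_pos[of "jacobi_am x k"] by (simp add: jacobi_dn_def)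

text \<open>The inverse function rule; the continuity it requires is the Lipschitz bound
  \<open>lip\<close>.\<close>

lemma jacobi_am_deriv: "((\<lambda>x. jacobi_am x k) has_real_derivative jacobi_dn x k) (at x)"
proof -
  have lip: "\<bar>jacobi_am x k - jacobi_am y k\<bar> \<le> \<bar>x - y\<bar>" for x y
    using elliptic_F_expanding[of "jacobi_am x k" "jacobi_am y k"] elliptic_F_expanding[of "jacobi_am y k" "jacobi_am x k"]
    unfolding elliptic_F_am by (cases "jacobi_am x k \<le> jacobi_am y k") auto
  have "isCont (\<lambda>x. jacobi_am x k) x"
    unfolding continuous_at_eps_delta dist_real_def using lip[of _ x] by (auto intro: le_less_trans)
  then have "((\<lambda>x. jacobi_am x k) has_real_derivative inverse (1 / sqrt (1 - k\<^sup>2 * (sin (jacobi_am x k))\<^sup>2))) (at x)"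
    using modulus_sin_pos[of "jacobi_am x k"]
    by (intro DERIV_inverse_function[OF elliptic_F_deriv, where a = "x - 1" and b = "x + 1"])
       (auto simp: elliptic_F_am)
  then show ?thesis by (simp add: jacobi_dn_def)
qed

text \<open>In Jacobi's notation, \<open>- k\<^sup>2\<close> times sn times cn.\<close>

definition jacobi_dn' :: "real \<Rightarrow> real" where
  "jacobi_dn' x = - k\<^sup>2 * sin (jacobi_am x k) * cos (jacobi_am x k)"

lemma jacobi_dn_deriv: "((\<lambda>x. jacobi_dn x k) has_real_derivative jacobi_dn' x) (at x)"
proof -
  have nz: "jacobi_dn x k \<noteq> 0" using jacobi_dn_pos[of x] by simp
  have "((\<lambda>x. sqrt (1 - k\<^sup>2 * (sin (jacobi_am x k))\<^sup>2)) has_real_derivative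
     - (k\<^sup>2 * (2 * sin (jacobi_am x k) * (cos (jacobi_am x k) * jacobi_dn x k))) * (inverse (sqrt (1 - k\<^sup>2 * (sin (jacobi_am x k))\<^sup>2)) / 2)) (at x)"
    using modulus_sin_pos[of "jacobi_am x k"] by (auto intro!: derivative_eq_intros jacobi_am_deriv)
  then show ?thesis
    using nz unfolding jacobi_dn_def[symmetric] jacobi_dn'_def by (simp add: field_simps)
qed

lemma jacobi_dn'_deriv:
  "(jacobi_dn' has_real_derivative (2 - k\<^sup>2) * jacobi_dn x k - 2 * jacobi_dn x k ^ 3) (at x)"
proof -
  let ?a = "jacobi_am x k"
  have "(jacobi_dn' has_real_derivative - (k\<^sup>2 * ((cos ?a)\<^sup>2 - (sin ?a)\<^sup>2)) * jacobi_dn x k) (at x)"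
    unfolding jacobi_dn'_def
    by (auto intro!: derivative_eq_intros jacobi_am_deriv simp: power2_eq_square algebra_simps)
  also have "k\<^sup>2 * ((cos ?a)\<^sup>2 - (sin ?a)\<^sup>2) = k\<^sup>2 - 2 + 2 * (jacobi_dn x k)\<^sup>2"
    unfolding cos_squared_eq jacobi_dn_square by (simp add: algebra_simps)
  finally show ?thesis by (simp add: power2_eq_square power3_eq_cube algebra_simps)
qed

text \<open>The first integral of the preceding second-order equation; its constant
  \<open>1 - k\<^sup>2\<close> becomes \<rho> after scaling.\<close>

lemma jacobi_dn'_square:
  "(jacobi_dn' x)\<^sup>2 = (2 - k\<^sup>2) * (jacobi_dn x k)\<^sup>2 - jacobi_dn x k ^ 4 - (1 - k\<^sup>2)"
proof -
  have 4: "jacobi_dn x k ^ 4 = ((jacobi_dn x k)\<^sup>2)\<^sup>2" by simp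
  have "(jacobi_dn' x)\<^sup>2 = k\<^sup>2 * k\<^sup>2 * (sin (jacobi_am x k))\<^sup>2 * (cos (jacobi_am x k))\<^sup>2"
    by (simp add: jacobi_dn'_def power2_eq_square)
  then show ?thesis unfolding 4 jacobi_dn_square cos_squared_eq by (simp add: power2_eq_square algebra_simps)
qed

lemma jacobi_am_minus: "jacobi_am (- x) k = - jacobi_am x k"
proof -
  have "((\<lambda>t. elliptic_F k (- t) + elliptic_F k t) has_real_derivative 0) (at t)" for t
    using DERIV_add[OF DERIV_chain2[OF elliptic_F_deriv DERIV_minus[OF DERIV_ident]] elliptic_F_deriv, of t] by simp
  then have "elliptic_F k (- t) + elliptic_F k t = elliptic_F k (- 0) + elliptic_F k 0" for t
    by (intro DERIV_isconst_all[of "\<lambda>t. elliptic_F k (- t) + elliptic_F k t"] allI)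
  then have "elliptic_F k (- jacobi_am x k) + x = 0"
    using elliptic_F_am[of x] elliptic_F_0 by (metis add_0 minus_zero)
  then have "elliptic_F k (- jacobi_am x k) = - x" by linarith
  then show ?thesis using am_elliptic_F[of "- jacobi_am x k"] by simp
qed

lemma elliptic_K_pos: "elliptic_K k > 0"
  using elliptic_F_expanding[of 0 "pi / 2"] pi_gt_zero elliptic_F_0 unfolding elliptic_K_def by linarith

lemma jacobi_am_elliptic_K: "jacobi_am (elliptic_K k) k = pi / 2"
  unfolding elliptic_K_def by (rule am_elliptic_F)

text \<open>The integrand of \<open>elliptic_F\<close> has period \<open>pi\<close>, so the
  increment over \<open>pi\<close> is constant. Evaluated from \<open>- pi / 2\<close> to
  \<open>pi / 2\<close> it is \<open>2 * elliptic_K k\<close> by oddness.\<close>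

lemma jacobi_am_periodic: "jacobi_am (x + 2 * elliptic_K k) k = jacobi_am x k + pi"
proof -
  have "((\<lambda>t. elliptic_F k (t + pi) - elliptic_F k t) has_real_derivative 0) (at t)" for t
    using DERIV_diff[OF DERIV_chain2[OF elliptic_F_deriv DERIV_add[OF DERIV_ident DERIV_const]] elliptic_F_deriv, of pi t]
    by simp
  then have "elliptic_F k (t + pi) - elliptic_F k t = elliptic_F k (- (pi / 2) + pi) - elliptic_F k (- (pi / 2))" for t
    by (intro DERIV_isconst_all[of "\<lambda>t. elliptic_F k (t + pi) - elliptic_F k t"] allI)
  moreover have "elliptic_F k (- (pi / 2)) = - elliptic_K k"
    using jacobi_am_minus[of "elliptic_K k"] elliptic_F_am[of "- elliptic_K k"] by (simp add: jacobi_am_elliptic_K)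
  ultimately have "elliptic_F k (jacobi_am x k + pi) - elliptic_F k (jacobi_am x k) = 2 * elliptic_K k"
    by (simp add: elliptic_K_def)
  then have "elliptic_F k (jacobi_am x k + pi) - x = 2 * elliptic_K k"
    by (simp only: elliptic_F_am)
  then have "elliptic_F k (jacobi_am x k + pi) = x + 2 * elliptic_K k" by simp
  then show ?thesis using am_elliptic_F[of "jacobi_am x k + pi"] by simp
qed

lemma jacobi_dn_minus: "jacobi_dn (- x) k = jacobi_dn x k"
  by (simp add: jacobi_dn_def jacobi_am_minus)

lemma jacobi_dn_periodic: "jacobi_dn (x + 2 * elliptic_K k) k = jacobi_dn x k"
  by (simp add: jacobi_dn_def jacobi_am_periodic)

lemma jacobi_dn'_neg:
  assumes "k \<noteq> 0" "0 < x" "x < elliptic_K k"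
  shows "jacobi_dn' x < 0"
proof -
  have mono: "jacobi_am y k < jacobi_am z k" if "y < z" for y z
    using elliptic_F_expanding[of "jacobi_am z k" "jacobi_am y k"] that unfolding elliptic_F_am by linarith
  have "jacobi_am 0 k = 0" using am_elliptic_F[of 0] by (simp add: elliptic_F_0)
  then have "0 < jacobi_am x k" "jacobi_am x k < pi / 2"
    using mono[OF assms(2)] mono[OF assms(3)] by (simp_all add: jacobi_am_elliptic_K)
  then have "0 < sin (jacobi_am x k)" "0 < cos (jacobi_am x k)"
    by (auto intro!: sin_gt_zero cos_gt_zero)
  then show ?thesis using assms(1) by (simp add: jacobi_dn'_def)
qed

end

section \<open>The travelling wave\<close>

lemma (in dnoidal_profile) spectrally_stable_profile:
  assumes c: "1 - c\<^sup>2 > 0" and gc: "2 * g * (1 - c\<^sup>2) = 1"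
  shows "spectrally_stable T c s \<phi>"
  unfolding spectrally_stable_def
proof (intro notI, elim exE conjE)
  fix \<mu> :: complex and U
  assume \<mu>: "Re \<mu> > 0" and U: "U \<in> dom_JH T" and nz: "\<not> ae_eq4 U zero4"
    and eig: "ae_eq4 (op_J T (op_H T c s \<phi> U)) (scale4 \<mu> U)"
  obtain p2 p1 q h where Ueq: "U = (p2, p1, q, h)" by (metis prod_cases4)
  define W where "W = (\<lambda>x. s - g * (\<phi> x)\<^sup>2)"
  have g: "g = 1 / (2 * (1 - c\<^sup>2))" using gc c by (simp add: field_simps)
  have W: "W = (\<lambda>x. s - (\<phi> x)\<^sup>2 / (2 * (1 - c\<^sup>2)))" by (simp add: W_def g)
  have per: "Defs.periodic (2 * T) \<phi>" using periodic by (simp add: periodic_def)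
  obtain P1 P2 D1 D2 Q H where R:
    "AE x in lebesgue. x \<in> {-T..T} \<longrightarrow> p1 x = P1 x" "AE x in lebesgue. x \<in> {-T..T} \<longrightarrow> p2 x = P2 x"
    "AE x in lebesgue. x \<in> {-T..T} \<longrightarrow> q x = Q x" "AE x in lebesgue. x \<in> {-T..T} \<longrightarrow> h x = H x"
    and R': "continuous_on {-T..T} Q" "continuous_on {-T..T} H"
    "P1 (-T) = P1 T" "P2 (-T) = P2 T" "D1 (-T) = D1 T" "D2 (-T) = D2 T" "Q (-T) = Q T" "H (-T) = H T"
    "\<And>x. x \<in> {-T..T} \<Longrightarrow> (P1 has_vector_derivative D1 x) (at x within {-T..T})"
    "\<And>x. x \<in> {-T..T} \<Longrightarrow> (P2 has_vector_derivative D2 x) (at x within {-T..T})"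
    "\<And>x. x \<in> {-T..T} \<Longrightarrow> (D1 has_vector_derivative \<mu> * P2 x + of_real (W x) * P1 x + of_real (\<phi> x) * Q x) (at x within {-T..T})"
    "\<And>x. x \<in> {-T..T} \<Longrightarrow> (D2 has_vector_derivative of_real (W x) * P2 x - \<mu> * P1 x) (at x within {-T..T})"
    "\<And>x. x \<in> {-T..T} \<Longrightarrow> ((\<lambda>x. H x - of_real c * Q x) has_vector_derivative - \<mu> * Q x) (at x within {-T..T})"
    "\<And>x. x \<in> {-T..T} \<Longrightarrow> ((\<lambda>x. of_real (\<phi> x) * P1 x + Q x - of_real c * H x) has_vector_derivative - \<mu> * H x) (at x within {-T..T})"
    by (rule eigenfunction_regularity[OF T c per d1 cont(2) U[unfolded Ueq] eig[unfolded Ueq] W]) blast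
  have zero: "P1 x = 0 \<and> P2 x = 0 \<and> Q x = 0 \<and> H x = 0" if "x \<in> {-T..T}" for x
    by (rule eigenvector_zero[OF c gc \<mu> W_def R' that])
  have L: "p2 \<in> L2_per T" "p1 \<in> L2_per T" "q \<in> L2_per T" "h \<in> L2_per T"
    using U by (auto simp: Ueq dom_JH_def H1_mean0_def numeral_2_eq_2)
  have Z: "AE x in lebesgue. f x = 0"
    if "f \<in> L2_per T" "AE x in lebesgue. x \<in> {-T..T} \<longrightarrow> f x = F x" "\<And>x. x \<in> {-T..T} \<Longrightarrow> F x = 0" for f F
  proof (rule AE_periodic[OF T])
    show "AE x in lebesgue. x \<in> {-T..T} \<longrightarrow> f x = 0" using that(2) by eventually_elim (use that(3) in auto)
    show "Defs.periodic (2 * T) f" using that(1) by (simp add: L2_per_def)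
  qed
  have "AE x in lebesgue. p1 x = 0" "AE x in lebesgue. p2 x = 0" "AE x in lebesgue. q x = 0" "AE x in lebesgue. h x = 0"
    using Z[OF L(2) R(1)] Z[OF L(1) R(2)] Z[OF L(3) R(3)] Z[OF L(4) R(4)] zero by simp_all
  then have "ae_eq4 U zero4" unfolding Ueq ae_eq4_def zero4_def by simp
  with nz show False by simp
qed

text \<open>For functions of \<open>x - c * t\<close> the wave equation reduces to
  \<open>2 * k * (1 - c\<^sup>2) = 1\<close>. In the Schroedinger equation the phase speed
  \<open>c / 2\<close> cancels the terms in \<open>\<phi>'\<close>, and the frequency leaves the
  profile equation.\<close>

lemma travelling_wave_zakharov:
  fixes \<phi> \<phi>' \<phi>'' :: "real \<Rightarrow> real"
  assumes d1: "\<And>x. (\<phi> has_real_derivative \<phi>' x) (at x)"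
    and d2: "\<And>x. (\<phi>' has_real_derivative \<phi>'' x) (at x)"
    and ode: "\<And>x. \<phi>'' x = \<sigma> * \<phi> x - (\<phi> x) ^ 3 / (2 * (1 - c\<^sup>2))"
    and c: "1 - c\<^sup>2 > 0"
  shows "zakharov_solution (\<lambda>t x. - (\<phi> (x - c * t))\<^sup>2 / (2 * (1 - c\<^sup>2)))
    (\<lambda>t x. exp (- \<i> * complex_of_real ((- \<sigma> - c\<^sup>2 / 4) * t)) * exp (\<i> * complex_of_real (c / 2 * (x - c * t)))
       * complex_of_real (\<phi> (x - c * t)))"
proof -
  define k where "k = 1 / (2 * (1 - c\<^sup>2))"
  have k: "2 * k * (1 - c\<^sup>2) = 1" using c by (simp add: k_def)
  define N where "N x = 2 * ((\<phi>' x)\<^sup>2 + \<phi> x * \<phi>'' x)" for x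
  have xt: "((\<lambda>s. x - c * s) has_real_derivative - c) (at t)" "((\<lambda>y. y - c * t) has_real_derivative 1) (at x)" for x t
    by (auto intro!: derivative_eq_intros)
  note ch = DERIV_chain2[OF d1 xt(1)] DERIV_chain2[OF d1 xt(2), unfolded mult_1_right] DERIV_chain2[OF d2 xt(1)] DERIV_chain2[OF d2 xt(2), unfolded mult_1_right]
  define e where "e t x = exp (\<i> * complex_of_real ((\<sigma> + c\<^sup>2 / 4) * t + c / 2 * (x - c * t)))" for t x
  have ee: "exp (- \<i> * complex_of_real ((- \<sigma> - c\<^sup>2 / 4) * t)) * exp (\<i> * complex_of_real (c / 2 * (x - c * t))) = e t x" for t x
    unfolding e_def exp_add[symmetric] by (rule arg_cong[where f = exp]) (simp add: algebra_simps)
  have et: "((\<lambda>s. e s x) has_vector_derivative \<i> * of_real (\<sigma> + c\<^sup>2 / 4 - c\<^sup>2 / 2) * e t x) (at t)" for t x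
  proof -
    have "((\<lambda>s. (\<sigma> + c\<^sup>2 / 4) * s + c / 2 * (x - c * s)) has_real_derivative (\<sigma> + c\<^sup>2 / 4 - c\<^sup>2 / 2)) (at t)"
      by (auto intro!: derivative_eq_intros simp: power2_eq_square)
    from field_vector_diff_chain_at[OF has_vector_derivative_mult_right[OF has_vector_derivative_of_real[OF this], of \<i>] DERIV_exp]
    show ?thesis by (simp add: e_def o_def)
  qed
  have ex: "((\<lambda>y. e t y) has_vector_derivative \<i> * of_real (c / 2) * e t x) (at x)" for t x
  proof -
    have "((\<lambda>y. (\<sigma> + c\<^sup>2 / 4) * t + c / 2 * (y - c * t)) has_real_derivative c / 2) (at x)"
      by (auto intro!: derivative_eq_intros)
    from field_vector_diff_chain_at[OF has_vector_derivative_mult_right[OF has_vector_derivative_of_real[OF this], of \<i>] DERIV_exp]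
    show ?thesis by (simp add: e_def o_def)
  qed
  note cv = ch[THEN has_vector_derivative_of_real[where ?'a = complex]]
  have nrm: "(cmod (e t x * of_real (\<phi> (x - c * t))))\<^sup>2 = (\<phi> (x - c * t))\<^sup>2" for t x
    by (simp add: norm_mult e_def)
  have veq: "- (\<phi> y)\<^sup>2 / (2 * (1 - c\<^sup>2)) = - k * (\<phi> y)\<^sup>2" for y by (simp add: k_def)
  show ?thesis
    unfolding zakharov_solution_def ee nrm veq
  proof (intro exI allI conjI)
    fix t x
    let ?z = "x - c * t"
    show "((\<lambda>s. - k * (\<phi> (x - c * s))\<^sup>2) has_real_derivative (\<lambda>t x. 2 * c * k * \<phi> (x - c * t) * \<phi>' (x - c * t)) t x) (at t)"
      by (auto intro!: derivative_eq_intros ch)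
    show "((\<lambda>s. (\<lambda>t x. 2 * c * k * \<phi> (x - c * t) * \<phi>' (x - c * t)) s x) has_real_derivative (\<lambda>t x. - c\<^sup>2 * k * N (x - c * t)) t x) (at t)"
    proof -
      have "((\<lambda>s. 2 * c * k * \<phi> (x - c * s) * \<phi>' (x - c * s)) has_real_derivative
        (2 * c * k * (\<phi>' ?z * - c)) * \<phi>' ?z + (\<phi>'' ?z * - c) * (2 * c * k * \<phi> ?z)) (at t)"
        by (intro DERIV_mult DERIV_cmult ch)
      then show ?thesis by (simp add: N_def power2_eq_square algebra_simps)
    qed
    show "((\<lambda>y. - k * (\<phi> (y - c * t))\<^sup>2) has_real_derivative (\<lambda>t x. - 2 * k * \<phi> (x - c * t) * \<phi>' (x - c * t)) t x) (at x)"
      by (auto intro!: derivative_eq_intros ch)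
    show "((\<lambda>y. (\<lambda>t x. - 2 * k * \<phi> (x - c * t) * \<phi>' (x - c * t)) t y) has_real_derivative (\<lambda>t x. - k * N (x - c * t)) t x) (at x)"
      by (auto intro!: derivative_eq_intros ch simp: N_def power2_eq_square algebra_simps)
    show "((\<lambda>y. (\<phi> (y - c * t))\<^sup>2) has_real_derivative (\<lambda>t x. 2 * \<phi> (x - c * t) * \<phi>' (x - c * t)) t x) (at x)"
      by (auto intro!: derivative_eq_intros ch)
    show "((\<lambda>y. (\<lambda>t x. 2 * \<phi> (x - c * t) * \<phi>' (x - c * t)) t y) has_real_derivative (\<lambda>t x. N (x - c * t)) t x) (at x)"
      by (auto intro!: derivative_eq_intros ch simp: N_def power2_eq_square algebra_simps)
    show "((\<lambda>s. e s x * of_real (\<phi> (x - c * s))) has_vector_derivative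
       (\<lambda>t x. e t x * of_real (\<phi>' (x - c * t) * - c) + \<i> * of_real (\<sigma> + c\<^sup>2 / 4 - c\<^sup>2 / 2) * e t x * of_real (\<phi> (x - c * t))) t x) (at t)"
      by (intro has_vector_derivative_mult et cv)
    show "((\<lambda>y. e t y * of_real (\<phi> (y - c * t))) has_vector_derivative
       (\<lambda>t x. e t x * of_real (\<phi>' (x - c * t)) + \<i> * of_real (c / 2) * e t x * of_real (\<phi> (x - c * t))) t x) (at x)"
      by (intro has_vector_derivative_mult ex cv)
    show "((\<lambda>y. (\<lambda>t x. e t x * of_real (\<phi>' (x - c * t)) + \<i> * of_real (c / 2) * e t x * of_real (\<phi> (x - c * t))) t y) has_vector_derivative
       (\<lambda>t x. (e t x * of_real (\<phi>'' (x - c * t)) + \<i> * of_real (c / 2) * e t x * of_real (\<phi>' (x - c * t)))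
          + (\<i> * of_real (c / 2) * e t x * of_real (\<phi>' (x - c * t)) + \<i> * of_real (c / 2) * (\<i> * of_real (c / 2) * e t x) * of_real (\<phi> (x - c * t)))) t x) (at x)"
      by (rule has_vector_derivative_add[OF has_vector_derivative_mult[OF ex cv(4)]
            has_vector_derivative_mult[OF has_vector_derivative_mult_right[OF ex] cv(2)]])
    have "(1 - c\<^sup>2) * k = 1 / 2" using k by (simp add: algebra_simps)
    moreover have "- c\<^sup>2 * k * N ?z - - k * N ?z = (1 - c\<^sup>2) * k * N ?z" by (simp add: algebra_simps)
    ultimately show "- c\<^sup>2 * k * N ?z - - k * N ?z = N ?z / 2" by simp
    have o: "\<phi>'' ?z = \<sigma> * \<phi> ?z - k * \<phi> ?z ^ 3" unfolding ode k_def by simp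
    show "\<i> * (e t x * of_real (\<phi>' ?z * - c) + \<i> * of_real (\<sigma> + c\<^sup>2 / 4 - c\<^sup>2 / 2) * e t x * of_real (\<phi> ?z)) +
         ((e t x * of_real (\<phi>'' ?z) + \<i> * of_real (c / 2) * e t x * of_real (\<phi>' ?z))
          + (\<i> * of_real (c / 2) * e t x * of_real (\<phi>' ?z) + \<i> * of_real (c / 2) * (\<i> * of_real (c / 2) * e t x) * of_real (\<phi> ?z)))
         - e t x * of_real (\<phi> ?z) * of_real (- k * (\<phi> ?z)\<^sup>2) = 0"
      unfolding o
      by (simp add: algebra_simps power2_eq_square power3_eq_cube)
  qed
qed

theorem theorem1:
  fixes c \<sigma> a1 \<phi>0 \<phi>1 \<kappa> \<alpha> T \<omega> :: real
    and l :: int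
    and \<phi> \<psi> :: "real \<Rightarrow> real"
    and v :: "real \<Rightarrow> real \<Rightarrow> real"
    and u :: "real \<Rightarrow> real \<Rightarrow> complex"
  assumes "1 - c\<^sup>2 > 0" and "\<sigma> > 0"
    and "\<phi>0 > \<phi>1" and "\<phi>1 > 0"
    and "(\<phi>0\<^sup>2)\<^sup>2 - 4 * \<sigma> * (1 - c\<^sup>2) * \<phi>0\<^sup>2 - a1 = 0"
    and "(\<phi>1\<^sup>2)\<^sup>2 - 4 * \<sigma> * (1 - c\<^sup>2) * \<phi>1\<^sup>2 - a1 = 0"
    and "\<kappa>\<^sup>2 = (\<phi>0\<^sup>2 - \<phi>1\<^sup>2) / \<phi>0\<^sup>2"
    and "\<alpha>\<^sup>2 = \<phi>0\<^sup>2 / (4 * (1 - c\<^sup>2))" and "\<alpha>\<^sup>2 = \<sigma> / (2 - \<kappa>\<^sup>2)" and "\<alpha> > 0"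
    and "T = elliptic_K \<kappa> / \<alpha>"
    and "\<phi> = (\<lambda>x. \<phi>0 * jacobi_dn (\<alpha> * x) \<kappa>)"
    and "\<psi> = (\<lambda>x. - (\<phi> x)\<^sup>2 / (2 * (1 - c\<^sup>2)))"
    and "\<omega> = - \<sigma> - c\<^sup>2 / 4"
    and "c = 2 * pi * real_of_int l / T"
    and "v = (\<lambda>t x. \<psi> (x - c * t))"
    and "u = (\<lambda>t x. exp (- \<i> * complex_of_real (\<omega> * t))
                    * exp (\<i> * complex_of_real (c / 2 * (x - c * t)))
                    * complex_of_real (\<phi> (x - c * t)))"
  shows "zakharov_solution v u \<and>
         (\<forall>t. periodic (2 * T) (v t) \<and> periodic (2 * T) (u t)) \<and>
         spectrally_stable T c \<sigma> \<phi>"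
proof -
  note c = assms(1) and \<phi>eq = assms(12)
  have \<phi>0: "\<phi>0 > 0" using assms(3,4) by simp
  have "\<phi>1\<^sup>2 < \<phi>0\<^sup>2" using assms(3,4) by (intro power_strict_mono) auto
  then have \<kappa>0: "\<kappa>\<^sup>2 > 0" and \<kappa>1: "\<kappa>\<^sup>2 < 1" using assms(4) \<phi>0 by (auto simp: assms(7) field_simps)
  have "\<kappa> \<noteq> 0" using \<kappa>0 by auto
  note \<alpha> = assms(10)
  note K = elliptic_K_pos[OF \<kappa>1]
  define g where "g = 1 / (2 * (1 - c\<^sup>2))"
  have gc: "2 * g * (1 - c\<^sup>2) = 1" using c by (simp add: g_def)
  \<comment> \<open>The constant of the first integral of dn, scaled by the squares of the amplitude
    \<phi>0 and of the rate \<alpha>.\<close>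
  define \<rho> where "\<rho> = \<phi>0\<^sup>2 * \<alpha>\<^sup>2 * (1 - \<kappa>\<^sup>2)"
  have \<alpha>\<sigma>: "\<alpha>\<^sup>2 * (2 - \<kappa>\<^sup>2) = \<sigma>" using assms(9) \<kappa>1 by simp
  have \<alpha>g: "2 * \<alpha>\<^sup>2 = g * \<phi>0\<^sup>2" unfolding assms(8) g_def using c by (simp add: field_simps)
  define \<phi>' where "\<phi>' x = \<phi>0 * (jacobi_dn' \<kappa> (\<alpha> * x) * \<alpha>)" for x
  have ax: "((\<lambda>x. \<alpha> * x) has_real_derivative \<alpha>) (at x)" for x
    by (auto intro!: derivative_eq_intros)
  have d1: "(\<phi> has_real_derivative \<phi>' x) (at x)" for x
    unfolding \<phi>eq \<phi>'_def by (intro DERIV_cmult DERIV_chain2[OF jacobi_dn_deriv[OF \<kappa>1] ax])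
  have d2: "(\<phi>' has_real_derivative \<sigma> * \<phi> x - g * \<phi> x ^ 3) (at x)" for x
  proof -
    let ?d = "jacobi_dn (\<alpha> * x) \<kappa>"
    have "(\<phi>' has_real_derivative \<phi>0 * ((((2 - \<kappa>\<^sup>2) * ?d - 2 * ?d ^ 3) * \<alpha>) * \<alpha>)) (at x)"
      unfolding \<phi>'_def by (intro DERIV_cmult DERIV_cmult_right DERIV_chain2[OF jacobi_dn'_deriv[OF \<kappa>1] ax])
    also have "\<phi>0 * ((((2 - \<kappa>\<^sup>2) * ?d - 2 * ?d ^ 3) * \<alpha>) * \<alpha>) = (\<alpha>\<^sup>2 * (2 - \<kappa>\<^sup>2)) * (\<phi>0 * ?d) - (2 * \<alpha>\<^sup>2) * \<phi>0 * ?d ^ 3"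
      by (simp add: power2_eq_square algebra_simps)
    also have "\<dots> = \<sigma> * \<phi> x - g * \<phi> x ^ 3"
      unfolding \<alpha>\<sigma> \<alpha>g \<phi>eq by (simp add: power2_eq_square power3_eq_cube algebra_simps)
    finally show ?thesis .
  qed
  interpret dnoidal_profile \<phi> \<phi>' \<sigma> g \<rho> T
  proof
    show "T > 0" using K \<alpha> by (simp add: assms(11))
    show "\<sigma> > 0" by (rule assms(2))
    show "g > 0" using c by (simp add: g_def)
    show "\<rho> > 0" using \<phi>0 \<alpha> \<kappa>1 by (simp add: \<rho>_def)
    \<comment> \<open>With \<open>2 * \<alpha>\<^sup>2 = g * \<phi>0\<^sup>2\<close>, the inequality
      rests on \<open>4 * (1 - \<kappa>\<^sup>2) = (2 - \<kappa>\<^sup>2)\<^sup>2 -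
      (\<kappa>\<^sup>2)\<^sup>2\<close> and \<kappa> being nonzero.\<close>
    have "2 * \<rho> * g = 2 * \<alpha>\<^sup>2 * (g * \<phi>0\<^sup>2) * (1 - \<kappa>\<^sup>2)" by (simp add: \<rho>_def)
    also have "\<dots> = (\<alpha>\<^sup>2)\<^sup>2 * ((2 - \<kappa>\<^sup>2)\<^sup>2 - (\<kappa>\<^sup>2)\<^sup>2)" unfolding \<alpha>g[symmetric] by (simp add: power2_eq_square algebra_simps)
    also have "\<dots> < (\<alpha>\<^sup>2)\<^sup>2 * (2 - \<kappa>\<^sup>2)\<^sup>2" using \<alpha> \<kappa>0 by (intro mult_strict_left_mono) auto
    also have "\<dots> = \<sigma>\<^sup>2" unfolding \<alpha>\<sigma>[symmetric] by (simp add: power_mult_distrib)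
    finally show "2 * \<rho> * g < \<sigma>\<^sup>2" .
    show "\<phi> x > 0" for x using \<phi>0 jacobi_dn_pos[OF \<kappa>1] by (simp add: \<phi>eq)
    show "(\<phi>' x)\<^sup>2 = \<sigma> * (\<phi> x)\<^sup>2 - g * \<phi> x ^ 4 / 2 - \<rho>" for x
    proof -
      let ?d = "jacobi_dn (\<alpha> * x) \<kappa>"
      have "(\<phi>' x)\<^sup>2 = \<phi>0\<^sup>2 * \<alpha>\<^sup>2 * ((2 - \<kappa>\<^sup>2) * ?d\<^sup>2 - ?d ^ 4 - (1 - \<kappa>\<^sup>2))"
        unfolding jacobi_dn'_square[OF \<kappa>1, symmetric] by (simp add: \<phi>'_def power_mult_distrib)
      also have "\<dots> = (\<alpha>\<^sup>2 * (2 - \<kappa>\<^sup>2)) * (\<phi>0 * ?d)\<^sup>2 - (2 * \<alpha>\<^sup>2) * \<phi>0\<^sup>2 * ?d ^ 4 / 2 - \<rho>"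
        unfolding \<rho>_def by (simp add: power_mult_distrib algebra_simps)
      also have "\<dots> = \<sigma> * (\<phi> x)\<^sup>2 - g * \<phi> x ^ 4 / 2 - \<rho>"
        unfolding \<alpha>\<sigma> \<alpha>g \<phi>eq by (simp add: power_mult_distrib power2_eq_square power4_eq_xxxx)
      finally show ?thesis .
    qed
    show "\<phi> (- x) = \<phi> x" for x using jacobi_dn_minus[OF \<kappa>1] by (simp add: \<phi>eq)
    show "\<phi> (x + 2 * T) = \<phi> x" for x
      using jacobi_dn_periodic[OF \<kappa>1, of "\<alpha> * x"] \<alpha> by (simp add: \<phi>eq assms(11) algebra_simps)
    show "\<phi>' x < 0" if "0 < x" "x < T" for x
    proof -
      have "jacobi_dn' \<kappa> (\<alpha> * x) < 0"
        using that \<alpha> by (intro jacobi_dn'_neg[OF \<kappa>1 \<open>\<kappa> \<noteq> 0\<close>]) (auto simp: assms(11) field_simps)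
      then show ?thesis using \<phi>0 \<alpha> by (simp add: \<phi>'_def mult_pos_neg mult_neg_pos)
    qed
  qed (fact d1 d2)+
  have "zakharov_solution v u"
    unfolding assms(13,14,16,17)
    by (rule travelling_wave_zakharov[OF d1 d2 _ c]) (simp add: g_def)
  moreover have "Defs.periodic (2 * T) (v t)" for t
    using periodic[of "_ - c * t"] by (simp add: assms(13,16) periodic_def algebra_simps)
  moreover have "Defs.periodic (2 * T) (u t)" for t
  proof -
    have "\<phi> (x + 2 * T - c * t) = \<phi> (x - c * t)" for x
      using periodic[of "x - c * t"] by (simp add: algebra_simps)
    \<comment> \<open>A shift by \<open>2 * T\<close> changes the carrier phase by
      \<open>c * T\<close>, which the quantisation of \<open>c\<close> makes a multiple of
      \<open>2 * pi\<close>.\<close>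
    moreover have "exp (\<i> * complex_of_real (c / 2 * (x + 2 * T - c * t))) = exp (\<i> * complex_of_real (c / 2 * (x - c * t)))" for x
    proof -
      have "c * T = 2 * pi * of_int l" using assms(15) T by (simp add: field_simps)
      moreover have "c / 2 * (x + 2 * T - c * t) = c / 2 * (x - c * t) + c * T" by (simp add: field_simps)
      ultimately have "c / 2 * (x + 2 * T - c * t) = c / 2 * (x - c * t) + 2 * of_int l * pi" by simp
      then have "\<i> * complex_of_real (c / 2 * (x + 2 * T - c * t)) = \<i> * complex_of_real (c / 2 * (x - c * t)) + (2 * of_int l * pi) * \<i>"
        by (simp add: algebra_simps)
      then show ?thesis unfolding exp_eq by (intro exI[of _ l]) simp
    qed
    ultimately show ?thesis by (simp add: assms(17) periodic_def)
  qed
  moreover have "spectrally_stable T c \<sigma> \<phi>" by (rule spectrally_stable_profile[OF c gc])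
  ultimately show ?thesis by blast
qed

end
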